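(* Let $1\le j\le c$ be integers, let $W^c_j$ be the $j\times(c+1-j)$ Hankel matrix in indeterminates $w_1,\dots,w_c$, let $K$ be an $F$-finite field of characteristic $p>0$, and $R=K[w_1,\dots,w_c]$. For every integer $t$ with $1\le t\le\min\{j,c+1-j\}$, the ideal $I_t(W^c_j)$ generated by the $t\times t$ minors of $W^c_j$ is symbolic $F$-split. In particular, the rings $\mathcal{R}^s(I_t(W^c_j))$ and $\mathrm{gr}^s(I_t(W^c_j))$ are $F$-split.
   Context: The Hankel matrix $W^c_j$ has $(a,b)$ entry $w_{a+b-1}$. For an ideal $I$ of $R$ and $n\ge0$, $I^{(n)}=I^nR_S\cap R$, where $S$ is the complement of the union of the minimal primes of $I$; $\mathcal{R}^s(I)=\bigoplus_{n\ge0}I^{(n)}T^n\subseteq R[T]$ ($T$ a variable) and $\mathrm{gr}^s(I)=\bigoplus_{n\ge0}I^{(n)}/I^{(n+1)}$. The ideal $I$ is called symbolic $F$-split if there is an $R$-linear map $\phi:R^{1/p}\to R$ with $\phi|_R=\mathrm{id}_R$ (a splitting of the inclusion $R\subseteq R^{1/p}$) such that $\phi\big((I^{(np+1)})^{1/p}\big)\subseteq I^{(n+1)}$ for every $n\ge0$, where $R^{1/p}$ is the ring of $p$-th roots of elements of $R$ and $J^{1/p}=\{f^{1/p}\mid f\in J\}$. A ring $A$ of characteristic $p$ is $F$-split if the Frobenius $F:A\to A$ is a split monomorphism. A field $K$ of characteristic $p$ is $F$-finite if $[K:K^p]<\infty$. *)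

theory Defs
  imports
    "HOL-Algebra.Algebraic_Closure_Type"
    "HOL-Algebra.Ideal_Product"
    "HOL-Algebra.QuotRing"
    "HOL-Algebra.UnivPoly"
    "HOL-Library.Poly_Mapping"
    "Jordan_Normal_Form.Determinant"
    "Jordan_Normal_Form.DL_Submatrix"
begin

section \<open>Polynomial rings and Hankel ideals\<close>

text \<open>Polynomials in variables indexed by the natural numbers; a monomial is its exponent vector.
  The ring in the variables \<open>1, \<dots>, c\<close> is cut out by its carrier.\<close>

type_synonym 'k mpol = "(nat \<Rightarrow>\<^sub>0 nat) \<Rightarrow>\<^sub>0 'k"

definition indet :: "nat \<Rightarrow> 'k::field mpol" where
  "indet i = Poly_Mapping.single (Poly_Mapping.single i 1) 1"

definition mpoly_ring :: "nat \<Rightarrow> 'k::field mpol ring" where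
  "mpoly_ring c = ring_of_type_algebra
     \<lparr>carrier := {f. \<forall>m \<in> Poly_Mapping.keys f. Poly_Mapping.keys m \<subseteq> {1..c}}\<rparr>"

text \<open>Matrix indices start at 0, so the entry in row \<open>a + 1\<close> and column \<open>b + 1\<close> sits at
  position \<open>(a, b)\<close>; its variable has index \<open>(a + 1) + (b + 1) - 1\<close>.\<close>

definition hankel_matrix :: "nat \<Rightarrow> nat \<Rightarrow> 'k::field mpol mat" where
  "hankel_matrix j c = mat j (c + 1 - j) (\<lambda>(a, b). indet (a + b + 1))"

definition minors :: "nat \<Rightarrow> 'a::comm_ring_1 mat \<Rightarrow> 'a set" where
  "minors t A = {det (submatrix A I J) | I J.
     I \<subseteq> {..<dim_row A} \<and> J \<subseteq> {..<dim_col A} \<and> card I = t \<and> card J = t}"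

definition hankel_ideal :: "nat \<Rightarrow> nat \<Rightarrow> nat \<Rightarrow> 'k::field mpol set" where
  "hankel_ideal t j c = genideal (mpoly_ring c) (minors t (hankel_matrix j c))"


section \<open>Localization and symbolic powers\<close>

definition loc_rel :: "('a, 'm) ring_scheme \<Rightarrow> 'a set \<Rightarrow> (('a \<times> 'a) \<times> ('a \<times> 'a)) set" where
  "loc_rel R S = {((a, s), (b, t)). a \<in> carrier R \<and> b \<in> carrier R \<and> s \<in> S \<and> t \<in> S \<and>
     (\<exists>u \<in> S. u \<otimes>\<^bsub>R\<^esub> (t \<otimes>\<^bsub>R\<^esub> a) = u \<otimes>\<^bsub>R\<^esub> (s \<otimes>\<^bsub>R\<^esub> b))}"

definition loc_frac :: "('a, 'm) ring_scheme \<Rightarrow> 'a set \<Rightarrow> 'a \<Rightarrow> 'a \<Rightarrow> ('a \<times> 'a) set" where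
  "loc_frac R S a s = loc_rel R S `` {(a, s)}"

text \<open>The ring of fractions \<open>S\<inverse>R\<close>, for a multiplicatively closed set \<open>S\<close> containing 1.\<close>

definition localization :: "('a, 'm) ring_scheme \<Rightarrow> 'a set \<Rightarrow> ('a \<times> 'a) set ring" where
  "localization R S = \<lparr>
     carrier = (carrier R \<times> S) // loc_rel R S,
     monoid.mult = (\<lambda>x y. \<Union>(a, s) \<in> x. \<Union>(b, t) \<in> y. loc_frac R S (a \<otimes>\<^bsub>R\<^esub> b) (s \<otimes>\<^bsub>R\<^esub> t)),
     one = loc_frac R S \<one>\<^bsub>R\<^esub> \<one>\<^bsub>R\<^esub>,
     zero = loc_frac R S \<zero>\<^bsub>R\<^esub> \<one>\<^bsub>R\<^esub>,
     add = (\<lambda>x y. \<Union>(a, s) \<in> x. \<Union>(b, t) \<in> y.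
       loc_frac R S ((t \<otimes>\<^bsub>R\<^esub> a) \<oplus>\<^bsub>R\<^esub> (s \<otimes>\<^bsub>R\<^esub> b)) (s \<otimes>\<^bsub>R\<^esub> t))\<rparr>"

definition minimal_primes :: "('a, 'm) ring_scheme \<Rightarrow> 'a set \<Rightarrow> 'a set set" where
  "minimal_primes R I = {P. primeideal P R \<and> I \<subseteq> P \<and>
     (\<forall>Q. primeideal Q R \<and> I \<subseteq> Q \<and> Q \<subseteq> P \<longrightarrow> Q = P)}"

text \<open>\<open>I\<^sup>(\<^sup>n\<^sup>) = I\<^sup>n R\<^sub>S \<inter> R\<close>: extend the ordinary power along \<open>R \<rightarrow> R\<^sub>S\<close>, then contract.
  The power \<open>I\<^sup>n\<close> is taken in the library's monoid of ideals, so \<open>I\<^sup>0 = R\<close>.\<close>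

definition symbolic_power :: "('a, 'm) ring_scheme \<Rightarrow> 'a set \<Rightarrow> nat \<Rightarrow> 'a set" where
  "symbolic_power R I n =
     (let S = carrier R - \<Union> (minimal_primes R I) in
      {x \<in> carrier R. loc_frac R S x \<one>\<^bsub>R\<^esub> \<in>
         genideal (localization R S)
           ((\<lambda>a. loc_frac R S a \<one>\<^bsub>R\<^esub>) ` (I [^]\<^bsub>ideals_set R\<^esub> n))})"


section \<open>Symbolic Rees algebra and symbolic associated graded ring\<close>

definition symbolic_rees :: "('a, 'm) ring_scheme \<Rightarrow> 'a set \<Rightarrow> ('a, nat \<Rightarrow> 'a) up_ring" where
  "symbolic_rees R I = (UP R)
     \<lparr>carrier := {f \<in> carrier (UP R). \<forall>n. UnivPoly.coeff (UP R) f n \<in> symbolic_power R I n}\<rparr>"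

text \<open>An element is a finitely supported family whose \<open>n\<close>-th member is a coset of
  \<open>I\<^sup>(\<^sup>n\<^sup>+\<^sup>1\<^sup>)\<close> in \<open>I\<^sup>(\<^sup>n\<^sup>)\<close>, viewed inside \<open>R / I\<^sup>(\<^sup>n\<^sup>+\<^sup>1\<^sup>)\<close>.  The product of the classes of
  \<open>x \<in> I\<^sup>(\<^sup>i\<^sup>)\<close> and \<open>y \<in> I\<^sup>(\<^sup>k\<^sup>)\<close> is the class of \<open>x y\<close> modulo \<open>I\<^sup>(\<^sup>i\<^sup>+\<^sup>k\<^sup>+\<^sup>1\<^sup>)\<close>; this is
  \<^const>\<open>rcoset_mult\<close> for that ideal, applied to cosets of two larger ideals.\<close>

definition symbolic_gr :: "('a, 'm) ring_scheme \<Rightarrow> 'a set \<Rightarrow> (nat \<Rightarrow> 'a set) ring" where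
  "symbolic_gr R I = (let J = symbolic_power R I in \<lparr>
     carrier = {f. (\<forall>n. \<exists>a \<in> J n. f n = J (n + 1) +>\<^bsub>R\<^esub> a) \<and> finite {n. f n \<noteq> J (n + 1)}},
     monoid.mult = (\<lambda>f g n. finsum (R Quot J (n + 1))
       (\<lambda>i. rcoset_mult R (J (n + 1)) (f i) (g (n - i))) {..n}),
     one = (\<lambda>n. J (n + 1) +>\<^bsub>R\<^esub> (if n = 0 then \<one>\<^bsub>R\<^esub> else \<zero>\<^bsub>R\<^esub>)),
     zero = (\<lambda>n. J (n + 1)),
     add = (\<lambda>f g n. f n \<oplus>\<^bsub>R Quot J (n + 1)\<^esub> g n)\<rparr>)"


section \<open>Frobenius splittings\<close>

definition linear_map ::
  "('a, 'm) ring_scheme \<Rightarrow> ('a, 'b, 'n) module_scheme \<Rightarrow> ('a, 'c, 'l) module_scheme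
    \<Rightarrow> ('b \<Rightarrow> 'c) \<Rightarrow> bool" where
  "linear_map R M N f \<longleftrightarrow> f \<in> carrier M \<rightarrow> carrier N \<and>
     (\<forall>x \<in> carrier M. \<forall>y \<in> carrier M. f (x \<oplus>\<^bsub>M\<^esub> y) = f x \<oplus>\<^bsub>N\<^esub> f y) \<and>
     (\<forall>a \<in> carrier R. \<forall>x \<in> carrier M. f (a \<odot>\<^bsub>M\<^esub> x) = a \<odot>\<^bsub>N\<^esub> f x)"

definition self_module :: "('a, 'm) ring_scheme \<Rightarrow> ('a, 'a) module" where
  "self_module A = \<lparr>carrier = carrier A, monoid.mult = monoid.mult A, one = one A,
     zero = zero A, add = add A, module.smult = monoid.mult A\<rparr>"

text \<open>\<open>A\<close> as a module over itself through the Frobenius \<open>a \<mapsto> a\<^sup>p\<close>.\<close>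

definition frobenius_module :: "nat \<Rightarrow> ('a, 'm) ring_scheme \<Rightarrow> ('a, 'a) module" where
  "frobenius_module p A = (self_module A)\<lparr>module.smult := (\<lambda>a x. (a [^]\<^bsub>A\<^esub> p) \<otimes>\<^bsub>A\<^esub> x)\<rparr>"

definition has_char :: "('a, 'm) ring_scheme \<Rightarrow> nat \<Rightarrow> bool" where
  "has_char A p \<longleftrightarrow> (\<forall>n::nat. [n] \<cdot>\<^bsub>A\<^esub> \<one>\<^bsub>A\<^esub> = \<zero>\<^bsub>A\<^esub> \<longleftrightarrow> p dvd n)"

text \<open>\<open>\<theta>\<close> is an \<open>A\<close>-linear left inverse of the Frobenius from \<open>A\<close> to \<^term>\<open>frobenius_module p A\<close>.\<close>

definition F_split :: "nat \<Rightarrow> ('a, 'm) ring_scheme \<Rightarrow> bool" where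
  "F_split p A \<longleftrightarrow> cring A \<and> has_char A p \<and>
     (\<exists>\<theta>. linear_map A (frobenius_module p A) (self_module A) \<theta> \<and>
       (\<forall>a \<in> carrier A. \<theta> (a [^]\<^bsub>A\<^esub> p) = a))"

definition F_finite :: "nat \<Rightarrow> ('a, 'm) ring_scheme \<Rightarrow> bool" where
  "F_finite p K \<longleftrightarrow>
     ring.finite_dimension K ((\<lambda>x. x [^]\<^bsub>K\<^esub> p) ` carrier K) (carrier K)"

text \<open>For a reduced commutative ring \<open>R\<close> of prime characteristic \<open>p\<close>, the ring \<open>R\<^sup>1\<^sup>/\<^sup>p\<close> consists
  of one formal root \<open>f\<^sup>1\<^sup>/\<^sup>p\<close>, written \<open>Root f\<close>, for each \<open>f\<close> in \<open>R\<close>; roots are added and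
  multiplied by \<open>f\<^sup>1\<^sup>/\<^sup>p + g\<^sup>1\<^sup>/\<^sup>p = (f + g)\<^sup>1\<^sup>/\<^sup>p\<close> and \<open>f\<^sup>1\<^sup>/\<^sup>p g\<^sup>1\<^sup>/\<^sup>p = (f g)\<^sup>1\<^sup>/\<^sup>p\<close>.  The inclusion
  \<open>R \<subseteq> R\<^sup>1\<^sup>/\<^sup>p\<close> is \<open>r = (r\<^sup>p)\<^sup>1\<^sup>/\<^sup>p\<close>, and \<open>R\<close> acts through it.  The wrapper type keeps elements of
  \<open>R\<close> and of \<open>R\<^sup>1\<^sup>/\<^sup>p\<close> apart.\<close>

datatype 'a root = Root (unroot: 'a)

definition root_incl :: "nat \<Rightarrow> ('a, 'm) ring_scheme \<Rightarrow> 'a \<Rightarrow> 'a root" where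
  "root_incl p R r = Root (r [^]\<^bsub>R\<^esub> p)"

definition root_ring :: "nat \<Rightarrow> ('a, 'm) ring_scheme \<Rightarrow> ('a, 'a root) module" where
  "root_ring p R = \<lparr>
     carrier = Root ` carrier R,
     monoid.mult = (\<lambda>x y. Root (unroot x \<otimes>\<^bsub>R\<^esub> unroot y)),
     one = Root \<one>\<^bsub>R\<^esub>,
     zero = Root \<zero>\<^bsub>R\<^esub>,
     add = (\<lambda>x y. Root (unroot x \<oplus>\<^bsub>R\<^esub> unroot y)),
     module.smult = (\<lambda>a x. Root (unroot (root_incl p R a) \<otimes>\<^bsub>R\<^esub> unroot x))\<rparr>"

lemma root_ring_power: "Root f [^]\<^bsub>root_ring p R\<^esub> (n::nat) = Root (f [^]\<^bsub>R\<^esub> n)"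
  by (induction n) (auto simp: root_ring_def nat_pow_def)

lemma root_ring_pth_power: "Root f [^]\<^bsub>root_ring p R\<^esub> p = root_incl p R f"
  by (simp add: root_ring_power root_incl_def)

lemma root_ring_smult:
  "a \<odot>\<^bsub>root_ring p R\<^esub> x = root_incl p R a \<otimes>\<^bsub>root_ring p R\<^esub> x"
  by (simp add: root_ring_def)

definition symbolic_F_split :: "nat \<Rightarrow> ('a, 'm) ring_scheme \<Rightarrow> 'a set \<Rightarrow> bool" where
  "symbolic_F_split p R I \<longleftrightarrow>
     (\<exists>\<phi>. linear_map R (root_ring p R) (self_module R) \<phi> \<and>
       (\<forall>r \<in> carrier R. \<phi> (root_incl p R r) = r) \<and>
       (\<forall>n. \<phi> ` (Root ` symbolic_power R I (n * p + 1)) \<subseteq> symbolic_power R I (n + 1)))"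

end

theory Submission
  imports Defs
begin

text \<open>Let \<open>q = t - 1\<close>.  Comparing coefficients in the Leibniz expansion shows that \<open>I\<^sub>t(W\<^sub>j)\<close> depends only
  on \<open>t\<close> and \<open>c\<close>, so \<open>I\<close> may be taken to be the ideal of maximal minors of a matrix with \<open>t\<close> rows.
  The sequences \<open>w\<^sub>1, \<dots>, w\<^sub>c\<close> that satisfy a linear recurrence of order \<open>q\<close> are parametrized by an
  affine space; the kernel \<open>Q\<close> of this parametrization is prime and contains \<open>I\<close>.  A prime containing
  \<open>I\<close> admits a recurrence relation modulo the prime, which can be corrected to an exact one over the
  local ring, so the prime contains \<open>Q\<close>.  Hence \<open>Q\<close> is the only minimal prime of \<open>I\<close>.

  Away from a corner minor of size \<open>q\<close>, which is not in \<open>Q\<close>, the ideal \<open>I\<close> is generated by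
  \<open>h = c - 2 q\<close> bordered minors, and an \<open>s \<times> s\<close> Hankel minor lies in \<open>I\<^sup>s\<^sup>-\<^sup>q\<close>.  So the product \<open>f\<close> of the
  Hankel determinants of sizes \<open>\<lceil>c/2\<rceil>\<close> in \<open>w\<^sub>1, w\<^sub>2, \<dots>\<close> and \<open>\<lfloor>c/2\<rfloor>\<close> in \<open>w\<^sub>2, w\<^sub>3, \<dots>\<close> lies in \<open>I\<^sup>(\<^sup>h\<^sup>)\<close>, while
  its leading monomial is \<open>w\<^sub>1 \<dots> w\<^sub>c\<close>.  With \<open>\<Phi>\<close> the trace dual to \<open>(w\<^sub>1 \<dots> w\<^sub>c)\<^sup>p\<^sup>-\<^sup>1\<close>, the map
  \<open>\<Phi>(f\<^sup>p\<^sup>-\<^sup>1 \<cdot> _)\<close> is then a splitting, and by the pigeonhole principle on the exponents of the \<open>h\<close>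
  generators it sends \<open>I\<^sup>(\<^sup>n\<^sup>p\<^sup>+\<^sup>1\<^sup>)\<close> into \<open>I\<^sup>(\<^sup>n\<^sup>+\<^sup>1\<^sup>)\<close>.  Applied to the coefficients of index divisible by \<open>p\<close>,
  it splits the Frobenius of the symbolic Rees algebra and, modulo the next symbolic power, of the
  associated graded ring.\<close>

section \<open>Subrings of a domain and their ideals\<close>


text \<open>Two demands pull \<open>f\<close> in opposite directions: it must lie deep in
  \<open>I\<close>, yet \<open>f ^ (p - 1)\<close> must have trace 1, which asks for a term as small
  as the squarefree monomial in all variables. Both hold because the sizes of the two Hankel
  determinants add up to \<open>c\<close>: their diagonals use each variable once, and each
  determinant loses \<open>q\<close> in passing from its size to the power of \<open>I\<close> that
  contains it locally, which leaves exactly \<open>c - 2 * q = h\<close>. The number of local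
  generators must be this same \<open>h\<close>: a monomial of degree
  \<open>h * (p - 1) + n * p + 1\<close> in \<open>h\<close> elements contains the
  \<open>p\<close>-th power of a monomial of degree \<open>n + 1\<close>, and the summand
  \<open>h * (p - 1)\<close> is what multiplication by \<open>f ^ (p - 1)\<close> contributes.
  Denominators do no harm, since the trace turns a factor \<open>s ^ p\<close> into
  \<open>s\<close>. For the minimal prime the obstacle is that a relation modulo a prime may have
  last coefficient zero and then cannot be solved for its last term; it is perturbed inside the
  prime until it can, and the resulting errors stay in the maximal ideal of the local ring.\<close>

lemma (in cring) idealI_cring:
  assumes "J \<subseteq> carrier R" "\<zero> \<in> J"
    and add: "\<And>x y. x \<in> J \<Longrightarrow> y \<in> J \<Longrightarrow> x \<oplus> y \<in> J"
    and mult: "\<And>a x. a \<in> carrier R \<Longrightarrow> x \<in> J \<Longrightarrow> a \<otimes> x \<in> J"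
  shows "ideal J R"
proof (rule idealI)
  show "ring R" by (rule ring_axioms)
  show "subgroup J (add_monoid R)"
  proof
    fix x assume x: "x \<in> J"
    then have "x \<in> carrier R" using assms(1) by auto
    then have "inv\<^bsub>add_monoid R\<^esub> x = (\<ominus> \<one>) \<otimes> x"
      by (simp add: l_minus flip: a_inv_def)
    then show "inv\<^bsub>add_monoid R\<^esub> x \<in> J"
      using mult[of "\<ominus> \<one>" x] x by simp
  qed (use assms in auto)
  fix a x assume "a \<in> J" "x \<in> carrier R"
  then show "x \<otimes> a \<in> J" "a \<otimes> x \<in> J"
    using mult[of x a] assms(1) m_comm[of x a] by auto
qed

text \<open>Transports the ring axioms to \<open>localization\<close>, \<open>symbolic_rees\<close>
  and \<open>symbolic_gr\<close>, whose operations are awkward to check directly.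
  \<open>Ring.ring_hom\<close> says nothing about zero and \<open>B\<close> is not yet known to be a
  ring, so zero has its own hypothesis.\<close>

lemma cring_surjective_image:
  assumes "cring A" "h \<in> Ring.ring_hom A B" "h ` carrier A = carrier B" "h \<zero>\<^bsub>A\<^esub> = \<zero>\<^bsub>B\<^esub>"
  shows "cring B"
proof -
  interpret A: cring A by fact
  have "ring (B\<lparr>carrier := h ` carrier A, zero := h \<zero>\<^bsub>A\<^esub>\<rparr>)"
    by (rule A.ring_hom_imp_img_ring[OF assms(2)])
  then have "ring B" using assms by simp
  then interpret B: ring B .
  show ?thesis
  proof
    fix x y assume "x \<in> carrier B" "y \<in> carrier B"
    then obtain a b where "a \<in> carrier A" "b \<in> carrier A" "x = h a" "y = h b"
      using assms(3) by blast
    then show "x \<otimes>\<^bsub>B\<^esub> y = y \<otimes>\<^bsub>B\<^esub> x"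
      using assms(2) A.m_comm by (metis ring_hom_mult)
  qed
qed

abbreviation subring_algebra :: "'a::ring_1 set \<Rightarrow> 'a ring" where
  "subring_algebra C \<equiv> ring_of_type_algebra\<lparr>carrier := C\<rparr>"

text \<open>Arithmetic happens in the type class \<open>idom\<close>, while ideals, primes and
  quotients keep their HOL-Algebra meaning. Instances are the polynomial ring, the Rees algebra
  inside \<open>'a poly\<close>, and localizations inside the fraction field.\<close>

locale type_subring =
  fixes C :: "'a::idom set"
  assumes zero_closed [simp]: "0 \<in> C" and one_closed [simp]: "1 \<in> C"
    and add_closed [simp]: "x \<in> C \<Longrightarrow> y \<in> C \<Longrightarrow> x + y \<in> C"
    and uminus_closed [simp]: "x \<in> C \<Longrightarrow> - x \<in> C"
    and mult_closed [simp]: "x \<in> C \<Longrightarrow> y \<in> C \<Longrightarrow> x * y \<in> C"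
begin

abbreviation "R \<equiv> subring_algebra C"

lemma diff_closed [simp]: "x \<in> C \<Longrightarrow> y \<in> C \<Longrightarrow> x - y \<in> C"
  using add_closed[of x "- y"] by simp

lemma power_closed [simp]: "x \<in> C \<Longrightarrow> x ^ n \<in> C"
  by (induction n) auto

lemma sum_closed: "(\<And>i. i \<in> A \<Longrightarrow> f i \<in> C) \<Longrightarrow> sum f A \<in> C"
  by (induction A rule: infinite_finite_induct) auto

lemma prod_closed: "(\<And>i. i \<in> A \<Longrightarrow> f i \<in> C) \<Longrightarrow> prod f A \<in> C"
  by (induction A rule: infinite_finite_induct) auto

lemma of_nat_closed [simp]: "of_nat n \<in> C"
  by (induction n) auto

lemma of_int_closed [simp]: "of_int n \<in> C"
  by (cases n) auto

lemma R_simps [simp]: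
  "monoid.mult R = (*)" "one R = 1" "zero R = 0" "add R = (+)"
  by (auto simp: ring_of_type_algebra_def)

lemma cring_R: "cring R"
  by unfold_locales
    (auto simp: algebra_simps Units_def intro!: exI[of _ "- _"] bexI[of _ "- _"])

sublocale R: cring R by (rule cring_R)

lemma nat_pow_R [simp]: "x [^]\<^bsub>R\<^esub> (n::nat) = x ^ n"
  by (induction n) (auto simp: nat_pow_def mult.commute)

lemma ideal_iff:
  "ideal J R \<longleftrightarrow> J \<subseteq> C \<and> 0 \<in> J \<and> (\<forall>x\<in>J. \<forall>y\<in>J. x + y \<in> J) \<and> (\<forall>a\<in>C. \<forall>x\<in>J. a * x \<in> J)"
proof
  assume "ideal J R"
  then interpret ideal J R .
  show "J \<subseteq> C \<and> 0 \<in> J \<and> (\<forall>x\<in>J. \<forall>y\<in>J. x + y \<in> J) \<and> (\<forall>a\<in>C. \<forall>x\<in>J. a * x \<in> J)"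
    using a_subset zero_closed a_closed I_l_closed by auto
next
  assume "J \<subseteq> C \<and> 0 \<in> J \<and> (\<forall>x\<in>J. \<forall>y\<in>J. x + y \<in> J) \<and> (\<forall>a\<in>C. \<forall>x\<in>J. a * x \<in> J)"
  then show "ideal J R"
    by (intro R.idealI_cring) auto
qed

lemma ideal_uminus: "ideal J R \<Longrightarrow> x \<in> J \<Longrightarrow> - x \<in> J"
  using ideal_iff[of J] by (metis mult_minus1 one_closed uminus_closed)

lemma ideal_diff: "ideal J R \<Longrightarrow> x \<in> J \<Longrightarrow> y \<in> J \<Longrightarrow> x - y \<in> J"
  using ideal_uminus[of J y] ideal_iff[of J] by (metis add_uminus_conv_diff)

lemma ideal_mult_left: "ideal J R \<Longrightarrow> x \<in> J \<Longrightarrow> a \<in> C \<Longrightarrow> a * x \<in> J"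
  using ideal_iff[of J] by auto

lemma ideal_mult_right: "ideal J R \<Longrightarrow> x \<in> J \<Longrightarrow> a \<in> C \<Longrightarrow> x * a \<in> J"
  using ideal_mult_left[of J x a] by (simp add: mult.commute)

lemma ideal_sum: "ideal J R \<Longrightarrow> (\<And>i. i \<in> A \<Longrightarrow> f i \<in> J) \<Longrightarrow> sum f A \<in> J"
  by (induction A rule: infinite_finite_induct) (auto simp: ideal_iff)

lemma ideal_subset: "ideal J R \<Longrightarrow> x \<in> J \<Longrightarrow> x \<in> C"
  by (auto simp: ideal_iff)

lemma primeideal_iff:
  "primeideal J R \<longleftrightarrow> ideal J R \<and> 1 \<notin> J \<and> (\<forall>x\<in>C. \<forall>y\<in>C. x * y \<in> J \<longrightarrow> x \<in> J \<or> y \<in> J)"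
proof -
  have eq: "J = C \<longleftrightarrow> 1 \<in> J" if "ideal J R"
    using that ideal_mult_left[OF that, of 1] by (auto simp: ideal_iff)
  show ?thesis
  proof
    assume J: "primeideal J R"
    note id = primeideal.axioms(1)[OF J]
    show "ideal J R \<and> 1 \<notin> J \<and> (\<forall>x\<in>C. \<forall>y\<in>C. x * y \<in> J \<longrightarrow> x \<in> J \<or> y \<in> J)"
      using id eq[OF id] primeideal.I_notcarr[OF J] primeideal.I_prime[OF J] by auto
  next
    assume J: "ideal J R \<and> 1 \<notin> J \<and> (\<forall>x\<in>C. \<forall>y\<in>C. x * y \<in> J \<longrightarrow> x \<in> J \<or> y \<in> J)"
    show "primeideal J R"
      by (rule primeidealI) (use J eq cring_R in auto)
  qed
qed

lemma prime_power: "primeideal J R \<Longrightarrow> x \<in> C \<Longrightarrow> x \<notin> J \<Longrightarrow> x ^ n \<notin> J"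
  by (induction n) (auto simp: primeideal_iff)


section \<open>Powers of ideals\<close>

definition ideal_power :: "'a set \<Rightarrow> nat \<Rightarrow> 'a set" where
  "ideal_power I n = I [^]\<^bsub>ideals_set R\<^esub> n"

lemma ideal_power_0 [simp]: "ideal_power I 0 = C"
  by (simp add: ideal_power_def nat_pow_def ideals_set_def)

lemma ideal_power_Suc: "ideal_power I (Suc n) = ideal_prod R (ideal_power I n) I"
  by (simp add: ideal_power_def nat_pow_def ideals_set_def)

lemma ideal_ideal_power: "ideal I R \<Longrightarrow> ideal (ideal_power I n) R"
proof (induction n)
  case 0
  then show ?case by (simp add: ideal_iff)
next
  case (Suc n)
  then show ?case by (simp add: ideal_power_Suc R.ideal_prod_is_ideal)
qed

lemma ideal_power_Suc_subset: "ideal I R \<Longrightarrow> ideal_power I (Suc n) \<subseteq> ideal_power I n"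
  using R.ideal_prod_inter[OF ideal_ideal_power[of I n]] by (simp add: ideal_power_Suc)

lemma ideal_power_antimono: "ideal I R \<Longrightarrow> m \<le> n \<Longrightarrow> ideal_power I n \<subseteq> ideal_power I m"
  by (rule lift_Suc_antimono_le) (auto dest: ideal_power_Suc_subset)

lemma ideal_power_Suc_mult:
  "x \<in> ideal_power I n \<Longrightarrow> y \<in> I \<Longrightarrow> x * y \<in> ideal_power I (Suc n)"
  using ideal_prod.prod[of x "ideal_power I n" y I R] by (simp add: ideal_power_Suc)

lemma ideal_power_mult:
  assumes "ideal I R" "x \<in> ideal_power I m" "y \<in> ideal_power I n"
  shows "x * y \<in> ideal_power I (m + n)"
  using assms(3)
proof (induction n arbitrary: y)
  case 0
  then show ?case
    using ideal_mult_right[OF ideal_ideal_power[OF assms(1)] assms(2)] by simp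
next
  case (Suc n)
  from Suc.prems[unfolded ideal_power_Suc] show ?case
  proof induction
    case (prod i j)
    then show ?case
      using ideal_power_Suc_mult[OF Suc.IH[of i], of j] by (simp add: mult.assoc)
  next
    case (sum a b)
    then show ?case
      using ideal_ideal_power[OF assms(1), of "m + Suc n"]
      by (auto simp: ideal_iff distrib_left)
  qed
qed

lemma power_in_ideal_power:
  "ideal I R \<Longrightarrow> x \<in> ideal_power I m \<Longrightarrow> x ^ n \<in> ideal_power I (m * n)"
proof (induction n)
  case (Suc n)
  then show ?case
    using ideal_power_mult[of I x m "x ^ n" "m * n"] by simp
qed simp


section \<open>Contraction from a localization\<close>

text \<open>Since \<^term>\<open>C\<close> lies in a domain, the classes of fractions with denominators in \<open>S\<close> are
  the fibres of \<open>(a, s) \<mapsto> a / s\<close> into the fraction field of the ambient type, so the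
  localization is a copy of a subring of that field.\<close>

definition frac_class :: "'a set \<Rightarrow> 'a fract \<Rightarrow> ('a \<times> 'a) set" where
  "frac_class S x = {(b, t). b \<in> C \<and> t \<in> S \<and> Fraction_Field.Fract b t = x}"

definition fracs :: "'a set \<Rightarrow> 'a set \<Rightarrow> 'a fract set" where
  "fracs J S = {Fraction_Field.Fract a s | a s. a \<in> J \<and> s \<in> S}"

lemma fracsI: "a \<in> J \<Longrightarrow> s \<in> S \<Longrightarrow> Fraction_Field.Fract a s \<in> fracs J S"
  unfolding fracs_def by (rule CollectI, intro exI conjI) (rule refl)

definition mult_set :: "'a set \<Rightarrow> bool" where
  "mult_set S \<longleftrightarrow> S \<subseteq> C \<and> 1 \<in> S \<and> 0 \<notin> S \<and> (\<forall>s\<in>S. \<forall>t\<in>S. s * t \<in> S)"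

context
  fixes S assumes S: "mult_set S"
begin

lemma denom [simp]: "s \<in> S \<Longrightarrow> s \<in> C" "s \<in> S \<Longrightarrow> s \<noteq> 0" "1 \<in> S"
    "s \<in> S \<Longrightarrow> t \<in> S \<Longrightarrow> s * t \<in> S"
  using S by (auto simp: mult_set_def)

text \<open>The extra factor \<open>u\<close> in \<open>loc_rel\<close> cancels in a domain, which
  leaves cross multiplication, that is, equality of fractions.\<close>

lemma loc_frac_eq: "a \<in> C \<Longrightarrow> s \<in> S \<Longrightarrow> loc_frac R S a s = frac_class S (Fraction_Field.Fract a s)"
  by (auto simp: loc_frac_def loc_rel_def frac_class_def eq_fract mult.commute intro!: bexI[of _ 1])

lemma fracs_closed:
  assumes "ideal J R"
  shows "x \<in> fracs J S \<Longrightarrow> y \<in> fracs J S \<Longrightarrow> x + y \<in> fracs J S"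
    and "x \<in> fracs C S \<Longrightarrow> y \<in> fracs J S \<Longrightarrow> x * y \<in> fracs J S"
proof -
  assume "x \<in> fracs J S" "y \<in> fracs J S"
  then obtain a s b t where "a \<in> J" "s \<in> S" "x = Fraction_Field.Fract a s"
      "b \<in> J" "t \<in> S" "y = Fraction_Field.Fract b t"
    by (auto simp: fracs_def)
  then have "x + y = Fraction_Field.Fract (t * a + s * b) (s * t)" "t * a + s * b \<in> J" "s * t \<in> S"
    using assms by (auto simp: ideal_iff mult.commute[of t a] mult.commute[of s b])
      (metis denom(1) mult.commute)
  then show "x + y \<in> fracs J S" using fracsI by metis
next
  assume "x \<in> fracs C S" "y \<in> fracs J S"
  then obtain a s b t where "a \<in> C" "s \<in> S" "x = Fraction_Field.Fract a s"
      "b \<in> J" "t \<in> S" "y = Fraction_Field.Fract b t"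
    by (auto simp: fracs_def)
  then have "x * y = Fraction_Field.Fract (a * b) (s * t)" "a * b \<in> J" "s * t \<in> S"
    using assms by (auto simp: ideal_iff)
  then show "x * y \<in> fracs J S" using fracsI by metis
qed

lemma ideal_C: "ideal C R"
  by (simp add: ideal_iff)

lemma type_subring_fracs: "type_subring (fracs C S)"
proof
  fix x assume "x \<in> fracs C S"
  then obtain a s where "a \<in> C" "s \<in> S" "x = Fraction_Field.Fract a s"
    by (auto simp: fracs_def)
  then have "- x = Fraction_Field.Fract (- a) s" "- a \<in> C" "s \<in> S" by auto
  then show "- x \<in> fracs C S" using fracsI by metis
next
  have "Fraction_Field.Fract 0 1 \<in> fracs C S" "Fraction_Field.Fract 1 1 \<in> fracs C S"
    by (intro fracsI zero_closed one_closed denom(3))+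
  then show "0 \<in> fracs C S" "1 \<in> fracs C S"
    by (auto simp: Zero_fract_def One_fract_def)
qed (auto intro: fracs_closed ideal_C)

lemma frac_class_rep:
  assumes "x \<in> fracs C S"
  shows "\<exists>a s. (a, s) \<in> frac_class S x"
  using assms by (auto simp: fracs_def frac_class_def)

lemma frac_classD:
  "(a, s) \<in> frac_class S x \<Longrightarrow> a \<in> C \<and> s \<in> S \<and> x = Fraction_Field.Fract a s"
  by (auto simp: frac_class_def)

lemma frac_class_inj: "x \<in> fracs C S \<Longrightarrow> frac_class S x = frac_class S y \<Longrightarrow> x = y"
  using frac_class_rep[of x] by (fastforce simp: frac_class_def)

text \<open>The operations of \<open>localization\<close> are unions over all representatives; a
  constant family over nonempty index sets has its value as union.\<close>

lemma frac_class_union: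
  assumes x: "x \<in> fracs C S" and y: "y \<in> fracs C S"
    and h: "\<And>a s b t. (a, s) \<in> frac_class S x \<Longrightarrow> (b, t) \<in> frac_class S y \<Longrightarrow> h a s b t = Z"
  shows "(\<Union>(a, s) \<in> frac_class S x. \<Union>(b, t) \<in> frac_class S y. h a s b t) = Z"
proof -
  have "(\<Union>(a, s) \<in> frac_class S x. \<Union>(b, t) \<in> frac_class S y. h a s b t) =
      (\<Union>(a, s) \<in> frac_class S x. \<Union>(b, t) \<in> frac_class S y. Z)"
    using h by (intro SUP_cong refl) auto
  then show ?thesis using frac_class_rep[OF x] frac_class_rep[OF y] by auto
qed

lemma frac_class_mult:
  assumes "x \<in> fracs C S" "y \<in> fracs C S"
  shows "frac_class S x \<otimes>\<^bsub>localization R S\<^esub> frac_class S y = frac_class S (x * y)"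
  unfolding localization_def monoid.simps using assms
  by (rule frac_class_union) ((drule frac_classD)+, simp add: loc_frac_eq)

lemma frac_class_add:
  assumes "x \<in> fracs C S" "y \<in> fracs C S"
  shows "frac_class S x \<oplus>\<^bsub>localization R S\<^esub> frac_class S y = frac_class S (x + y)"
  unfolding localization_def ring.simps using assms
  by (rule frac_class_union) ((drule frac_classD)+, simp add: loc_frac_eq mult.commute)

lemma frac_class_hom:
  "frac_class S \<in> Ring.ring_hom (subring_algebra (fracs C S)) (localization R S)"
  "frac_class S ` fracs C S = carrier (localization R S)"
  "frac_class S 0 = \<zero>\<^bsub>localization R S\<^esub>"
proof -
  interpret F: type_subring "fracs C S" by (rule type_subring_fracs)
  have "carrier (localization R S) = (\<lambda>(a, s). loc_frac R S a s) ` (C \<times> S)"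
    by (auto simp: localization_def quotient_def loc_frac_def)
  also have "\<dots> = (\<lambda>(a, s). frac_class S (Fraction_Field.Fract a s)) ` (C \<times> S)"
    by (intro image_cong) (auto simp: loc_frac_eq)
  also have "\<dots> = frac_class S ` fracs C S"
    by (auto simp: fracs_def)
  finally show *: "frac_class S ` fracs C S = carrier (localization R S)" ..
  have "frac_class S 1 = \<one>\<^bsub>localization R S\<^esub>"
    by (simp add: localization_def loc_frac_eq One_fract_def)
  then show "frac_class S \<in> Ring.ring_hom (subring_algebra (fracs C S)) (localization R S)"
    using * by (intro ring_hom_memI) (auto simp: frac_class_mult frac_class_add)
  show "frac_class S 0 = \<zero>\<^bsub>localization R S\<^esub>"
    by (simp add: localization_def loc_frac_eq Zero_fract_def)
qed

lemma cring_localization: "cring (localization R S)"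
proof -
  interpret F: type_subring "fracs C S" by (rule type_subring_fracs)
  show ?thesis
    using cring_surjective_image[OF F.cring_R frac_class_hom(1)] frac_class_hom(2,3) by simp
qed

text \<open>The fractions with numerator in \<open>J\<close> form an ideal that contains the image
  of \<open>J\<close> and so bounds the generated ideal from above; in a domain
  \<open>x / 1 = a / s\<close> reads \<open>s * x = a\<close>. Conversely \<open>x\<close> is
  \<open>1 / s\<close> times the image of \<open>s * x\<close>.\<close>

lemma contraction_iff:
  assumes J: "ideal J R" and x: "x \<in> C"
  shows "loc_frac R S x 1 \<in> genideal (localization R S) ((\<lambda>a. loc_frac R S a 1) ` J) \<longleftrightarrow>
    (\<exists>s\<in>S. s * x \<in> J)"
proof
  interpret L: cring "localization R S" by (rule cring_localization)
  interpret F: type_subring "fracs C S" by (rule type_subring_fracs)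
  have sub: "fracs J S \<subseteq> fracs C S"
    using J unfolding fracs_def by (auto simp: ideal_iff)
  have fracs_J: "Fraction_Field.Fract a 1 \<in> fracs J S" if "a \<in> J" for a
    using that by (intro fracsI denom(3))
  have "Fraction_Field.Fract 0 1 \<in> fracs J S"
    by (rule fracs_J) (use J in \<open>simp add: ideal_iff\<close>)
  then have 0: "0 \<in> fracs J S" by (simp add: Zero_fract_def)
  have K: "ideal (frac_class S ` fracs J S) (localization R S)"
  proof (rule L.idealI_cring)
    show "frac_class S ` fracs J S \<subseteq> carrier (localization R S)"
      using sub by (auto simp flip: frac_class_hom(2))
    show "\<zero>\<^bsub>localization R S\<^esub> \<in> frac_class S ` fracs J S"
      using 0 by (auto simp flip: frac_class_hom(3))
  next
    fix x y assume "x \<in> frac_class S ` fracs J S" "y \<in> frac_class S ` fracs J S"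
    then obtain a b where "a \<in> fracs J S" "b \<in> fracs J S" "x = frac_class S a" "y = frac_class S b"
      by auto
    then show "x \<oplus>\<^bsub>localization R S\<^esub> y \<in> frac_class S ` fracs J S"
      using frac_class_add[of a b] fracs_closed(1)[OF J, of a b] sub by auto
  next
    fix x y assume "x \<in> carrier (localization R S)" "y \<in> frac_class S ` fracs J S"
    then obtain a b where "a \<in> fracs C S" "b \<in> fracs J S" "x = frac_class S a" "y = frac_class S b"
      by (auto simp flip: frac_class_hom(2))
    then show "x \<otimes>\<^bsub>localization R S\<^esub> y \<in> frac_class S ` fracs J S"
      using frac_class_mult[of a b] fracs_closed(2)[OF J, of a b] sub by auto
  qed
  have inK: "(\<lambda>a. loc_frac R S a 1) ` J \<subseteq> frac_class S ` fracs J S"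
    using fracs_J ideal_subset[OF J] by (auto simp: loc_frac_eq)
  assume "loc_frac R S x 1 \<in> genideal (localization R S) ((\<lambda>a. loc_frac R S a 1) ` J)"
  then have "loc_frac R S x 1 \<in> frac_class S ` fracs J S"
    using K inK by (auto simp: genideal_def)
  then obtain a s where as: "a \<in> J" "s \<in> S"
      "frac_class S (Fraction_Field.Fract x 1) = frac_class S (Fraction_Field.Fract a s)"
    using x by (auto simp: loc_frac_eq fracs_def)
  have "Fraction_Field.Fract x 1 = Fraction_Field.Fract a s"
    by (rule frac_class_inj[OF _ as(3)]) (intro fracsI x denom(3))
  then show "\<exists>s\<in>S. s * x \<in> J"
    using as by (auto simp: eq_fract mult.commute[of _ x])
next
  assume "\<exists>s\<in>S. s * x \<in> J"
  then obtain s where s: "s \<in> S" "s * x \<in> J" by auto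
  have "loc_frac R S x 1 \<in> K"
    if K: "ideal K (localization R S)" and sub: "(\<lambda>a. loc_frac R S a 1) ` J \<subseteq> K" for K
  proof -
    have sx: "loc_frac R S (s * x) 1 \<in> K" using sub s by (rule_tac subsetD[OF sub imageI])
    have fr: "Fraction_Field.Fract 1 s \<in> fracs C S" "Fraction_Field.Fract (s * x) 1 \<in> fracs C S"
      using s x mult_closed[of s x] by (simp_all add: fracsI)
    have "frac_class S (Fraction_Field.Fract 1 s) \<in> carrier (localization R S)"
      using fr by (auto simp flip: frac_class_hom(2))
    from ideal.I_l_closed[OF K sx this] have
      "frac_class S (Fraction_Field.Fract 1 s * Fraction_Field.Fract (s * x) 1) \<in> K"
      unfolding loc_frac_eq[OF mult_closed[OF denom(1)[OF s(1)] x] denom(3)]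
        frac_class_mult[OF fr] .
    also have "Fraction_Field.Fract 1 s * Fraction_Field.Fract (s * x) 1 = Fraction_Field.Fract x 1"
      unfolding mult_fract using mult_fract_cancel[of s x 1] denom(2)[OF s(1)]
      by (simp only: mult_1_left mult_1_right not_False_eq_True)
    finally show ?thesis unfolding loc_frac_eq[OF x denom(3)] .
  qed
  then show "loc_frac R S x 1 \<in> genideal (localization R S) ((\<lambda>a. loc_frac R S a 1) ` J)"
    unfolding genideal_def by (intro InterI) (elim CollectE conjE)
qed

end


section \<open>Symbolic powers of an ideal with a single minimal prime\<close>

lemma mult_set_compl_prime:
  assumes "primeideal Q R"
  shows "mult_set (C - Q)"
proof -
  have Q: "ideal Q R" "1 \<notin> Q" "\<And>x y. x \<in> C \<Longrightarrow> y \<in> C \<Longrightarrow> x * y \<in> Q \<Longrightarrow> x \<in> Q \<or> y \<in> Q"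
    using assms unfolding primeideal_iff by auto
  then have "0 \<in> Q" by (simp add: ideal_iff)
  then show ?thesis
    unfolding mult_set_def using Q(2,3) by fastforce
qed

text \<open>With one minimal prime the denominators are the complement of \<open>Q\<close>. All
  later facts about symbolic powers come from this description.\<close>

lemma symbolic_power_iff:
  assumes "ideal I R" "primeideal Q R" "minimal_primes R I = {Q}"
  shows "x \<in> symbolic_power R I n \<longleftrightarrow> x \<in> C \<and> (\<exists>s\<in>C - Q. s * x \<in> ideal_power I n)"
  using contraction_iff[OF mult_set_compl_prime[OF assms(2)] ideal_ideal_power[OF assms(1)]] assms(3)
  by (auto simp: symbolic_power_def Let_def ideal_power_def)

end


section \<open>Descent of Frobenius splittings\<close>

lemma linear_map_frobenius_iff:
  "linear_map A (frobenius_module p A) (self_module A) \<theta> \<longleftrightarrow> \<theta> \<in> carrier A \<rightarrow> carrier A \<and>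
    (\<forall>x\<in>carrier A. \<forall>y\<in>carrier A. \<theta> (x \<oplus>\<^bsub>A\<^esub> y) = \<theta> x \<oplus>\<^bsub>A\<^esub> \<theta> y) \<and>
    (\<forall>a\<in>carrier A. \<forall>x\<in>carrier A. \<theta> (a [^]\<^bsub>A\<^esub> p \<otimes>\<^bsub>A\<^esub> x) = a \<otimes>\<^bsub>A\<^esub> \<theta> x)"
  by (simp add: linear_map_def frobenius_module_def self_module_def)

text \<open>Hypothesis \<open>ker\<close> is what makes the induced map independent of the chosen
  preimages. It is automatic for the Rees algebra, where \<open>h\<close> is injective; for the
  graded ring it is the actual content.\<close>

lemma F_split_surjective_image:
  assumes B: "cring B" and h: "h \<in> Ring.ring_hom B A" "h ` carrier B = carrier A" "h \<zero>\<^bsub>B\<^esub> = \<zero>\<^bsub>A\<^esub>"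
    and char: "has_char A p"
    and \<theta>: "linear_map B (frobenius_module p B) (self_module B) \<theta>"
      "\<And>a. a \<in> carrier B \<Longrightarrow> \<theta> (a [^]\<^bsub>B\<^esub> p) = a"
    and ker: "\<And>x y. x \<in> carrier B \<Longrightarrow> y \<in> carrier B \<Longrightarrow> h x = h y \<Longrightarrow> h (\<theta> x) = h (\<theta> y)"
  shows "F_split p A"
proof -
  interpret B: cring B by (rule B)
  interpret A: cring A using cring_surjective_image[OF B h] .
  interpret h: ring_hom_cring B A h
    by (rule ring_hom_cringI[OF B.is_cring A.is_cring]) (use h in \<open>auto simp: ring_hom_ring_def ring_hom_ring_axioms_def B.ring_axioms A.ring_axioms\<close>)
  have \<theta>_closed: "\<theta> x \<in> carrier B" if "x \<in> carrier B" for x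
    using \<theta>(1)[unfolded linear_map_frobenius_iff] that by blast
  have \<theta>_add: "\<theta> (x \<oplus>\<^bsub>B\<^esub> y) = \<theta> x \<oplus>\<^bsub>B\<^esub> \<theta> y" if "x \<in> carrier B" "y \<in> carrier B" for x y
    using \<theta>(1)[unfolded linear_map_frobenius_iff] that by blast
  have \<theta>_mult: "\<theta> (a [^]\<^bsub>B\<^esub> p \<otimes>\<^bsub>B\<^esub> y) = a \<otimes>\<^bsub>B\<^esub> \<theta> y" if "a \<in> carrier B" "y \<in> carrier B" for a y
    using \<theta>(1)[unfolded linear_map_frobenius_iff] that by blast
  have surj: "\<exists>x. x \<in> carrier B \<and> z = h x" if "z \<in> carrier A" for z
    using that unfolding h(2)[symmetric] by auto
  define g where "g = (\<lambda>z. SOME x. x \<in> carrier B \<and> h x = z)"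
  have g: "g z \<in> carrier B \<and> h (g z) = z" if "z \<in> carrier A" for z
    unfolding g_def by (rule someI_ex) (use that in \<open>unfold h(2)[symmetric], auto\<close>)
  define \<theta>' where "\<theta>' = (\<lambda>z. h (\<theta> (g z)))"
  have \<theta>': "\<theta>' (h x) = h (\<theta> x)" if "x \<in> carrier B" for x
    unfolding \<theta>'_def using g[of "h x"] that ker[of "g (h x)" x] by simp
  have "\<theta>' (z \<oplus>\<^bsub>A\<^esub> w) = \<theta>' z \<oplus>\<^bsub>A\<^esub> \<theta>' w" if "z \<in> carrier A" "w \<in> carrier A" for z w
  proof -
    obtain x where "x \<in> carrier B" "z = h x" using surj[of z] \<open>z \<in> carrier A\<close> by blast
    moreover obtain y where "y \<in> carrier B" "w = h y" using surj[of w] \<open>w \<in> carrier A\<close> by blast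
    ultimately show ?thesis
      using \<theta>'[of "x \<oplus>\<^bsub>B\<^esub> y"] by (simp add: \<theta>' \<theta>_add \<theta>_closed)
  qed
  moreover have "\<theta>' (z [^]\<^bsub>A\<^esub> p \<otimes>\<^bsub>A\<^esub> w) = z \<otimes>\<^bsub>A\<^esub> \<theta>' w"
    if "z \<in> carrier A" "w \<in> carrier A" for z w
  proof -
    obtain x where "x \<in> carrier B" "z = h x" using surj[of z] \<open>z \<in> carrier A\<close> by blast
    moreover obtain y where "y \<in> carrier B" "w = h y" using surj[of w] \<open>w \<in> carrier A\<close> by blast
    ultimately show ?thesis
      using \<theta>'[of "x [^]\<^bsub>B\<^esub> p \<otimes>\<^bsub>B\<^esub> y"] by (simp add: \<theta>' \<theta>_mult \<theta>_closed)
  qed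
  moreover have "\<theta>' (z [^]\<^bsub>A\<^esub> p) = z" if "z \<in> carrier A" for z
  proof -
    obtain x where "x \<in> carrier B" "z = h x" using surj[of z] \<open>z \<in> carrier A\<close> by blast
    then show ?thesis
      using \<theta>'[of "x [^]\<^bsub>B\<^esub> p"] by (simp add: \<theta>(2))
  qed
  moreover have "\<theta>' z \<in> carrier A" if "z \<in> carrier A" for z
    using g[OF that] \<theta>_closed by (simp add: \<theta>'_def)
  ultimately show ?thesis
    unfolding F_split_def linear_map_frobenius_iff
    by (intro conjI exI[of _ \<theta>'] A.is_cring char Pi_I ballI) auto
qed

text \<open>By the freshman's dream the Frobenius may be applied to the monomials of
  \<open>P\<close> one at a time.\<close>

lemma coeff_power_char:
  fixes P :: "'a::comm_ring_1 poly"
  assumes "prime CHAR('a)"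
  shows "Polynomial.coeff (P ^ CHAR('a)) n =
    (if CHAR('a) dvd n then Polynomial.coeff P (n div CHAR('a)) ^ CHAR('a) else 0)"
proof -
  let ?p = "CHAR('a)"
  have p: "?p > 0" using assms by (simp add: prime_gt_0_nat)
  have ch: "CHAR('a poly) = ?p" by simp
  have "P ^ ?p = (\<Sum>i\<le>Polynomial.degree P. Polynomial.monom (Polynomial.coeff P i) i) ^ ?p"
    by (simp add: poly_as_sum_of_monoms)
  also have "\<dots> = (\<Sum>i\<le>Polynomial.degree P. Polynomial.monom (Polynomial.coeff P i) i ^ ?p)"
    by (rule freshmans_dream_sum) (simp_all add: ch assms)
  finally have "Polynomial.coeff (P ^ ?p) n =
      (\<Sum>i\<le>Polynomial.degree P. if n = i * ?p then Polynomial.coeff P i ^ ?p else 0)"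
    by (simp add: Polynomial.coeff_sum monom_power mult.commute)
      (intro sum.cong, auto)
  also have "\<dots> = (if ?p dvd n then Polynomial.coeff P (n div ?p) ^ ?p else 0)"
  proof (cases "?p dvd n")
    case True
    then obtain k where k: "n = k * ?p" by (metis dvd_def mult.commute)
    have "(\<Sum>i\<le>Polynomial.degree P. if n = i * ?p then Polynomial.coeff P i ^ ?p else 0) =
        (\<Sum>i\<le>Polynomial.degree P. if k = i then Polynomial.coeff P i ^ ?p else 0)"
      using p k by (intro sum.cong) auto
    also have "\<dots> = Polynomial.coeff P k ^ ?p"
      using p by (auto simp: coeff_eq_0 zero_power)
    finally show ?thesis using k p by simp
  next
    case False
    then have "n \<noteq> i * ?p" for i by auto
    then show ?thesis using False by (simp cong: if_cong)
  qed
  finally show ?thesis .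
qed

context type_subring
begin

text \<open>If \<open>p\<close> does not divide \<open>n\<close>, Bezout gives an \<open>m\<close>
  for which \<open>n * m\<close> equals 1 in the ring, so \<open>h (of_nat n)\<close> could vanish
  only in the zero ring.\<close>

lemma has_char_image:
  assumes "CHAR('a) = p" "prime p" and A: "cring A" "h \<in> Ring.ring_hom R A" "h 0 = \<zero>\<^bsub>A\<^esub>" "\<one>\<^bsub>A\<^esub> \<noteq> \<zero>\<^bsub>A\<^esub>"
  shows "has_char A p"
proof -
  interpret A: cring A by (rule A)
  interpret h: ring_hom_cring R A h
    by (rule ring_hom_cringI[OF cring_R A(1)]) (use A in \<open>auto simp: ring_hom_ring_def ring_hom_ring_axioms_def R.ring_axioms A.ring_axioms\<close>)
  have nat: "[n] \<cdot>\<^bsub>A\<^esub> \<one>\<^bsub>A\<^esub> = h (of_nat n)" for n :: nat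
  proof (induction n)
    case (Suc n)
    have "h (of_nat n + 1) = h (of_nat n) \<oplus>\<^bsub>A\<^esub> h 1"
      using h.hom_add[of "of_nat n" 1] by simp
    then show ?case using Suc h.hom_one by (simp add: add.commute)
  qed (use A in simp)
  show ?thesis
    unfolding has_char_def nat
  proof (intro allI iffI)
    fix n assume "p dvd n"
    then have "(of_nat n :: 'a) = 0" using assms(1) by (simp add: of_nat_eq_0_iff_char_dvd)
    then show "h (of_nat n) = \<zero>\<^bsub>A\<^esub>" using A by simp
  next
    fix n assume n: "h (of_nat n) = \<zero>\<^bsub>A\<^esub>"
    show "p dvd n"
    proof (rule ccontr)
      assume "\<not> p dvd n"
      then have "coprime n p" using assms(2) by (metis coprime_commute prime_imp_coprime)
      moreover from this have "n \<noteq> 0" using assms(2) by (metis coprime_0_left_iff not_prime_unit)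
      ultimately obtain m y where "n * m = p * y + 1"
        using bezout_nat[of n p] by (metis coprime_iff_gcd_eq_1)
      then have "(of_nat (n * m) :: 'a) = of_nat p * of_nat y + 1"
        by (metis of_nat_1 of_nat_add of_nat_mult)
      also have "(of_nat p :: 'a) = 0"
        using assms(1) by (simp add: of_nat_eq_0_iff_char_dvd)
      finally have "(of_nat (n * m) :: 'a) = 1" by simp
      then have "h 1 = h (of_nat n * of_nat m)" by simp
      also have "\<dots> = \<zero>\<^bsub>A\<^esub>" using n h.hom_mult[of "of_nat n" "of_nat m"] by simp
      finally show False using h.hom_one A by simp
    qed
  qed
qed


section \<open>Frobenius splittings of symbolic blowup algebras\<close>

lemma finsum_R: "finite A \<Longrightarrow> f \<in> A \<rightarrow> C \<Longrightarrow> finsum R f A = sum f A"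
  by (induction A rule: finite_induct) (auto simp: R.finsum_insert Pi_iff)

text \<open>The properties of symbolic powers on which both blowup algebras rest. That 1 is not in
  the first symbolic power keeps the associated graded ring from being zero.\<close>

definition sym_filtration :: "'a set \<Rightarrow> bool" where
  "sym_filtration I \<longleftrightarrow> (\<forall>n. ideal (symbolic_power R I n) R) \<and> symbolic_power R I 0 = C \<and>
    (\<forall>n. symbolic_power R I (Suc n) \<subseteq> symbolic_power R I n) \<and> 1 \<notin> symbolic_power R I 1 \<and>
    (\<forall>m n. \<forall>x\<in>symbolic_power R I m. \<forall>y\<in>symbolic_power R I n. x * y \<in> symbolic_power R I (m + n))"

lemma sym_filtrationI:
  assumes I: "ideal I R" and Q: "primeideal Q R" "minimal_primes R I = {Q}"
  shows "sym_filtration I"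
proof -
  note iff = symbolic_power_iff[OF I Q]
  note S = mult_set_compl_prime[OF Q(1), unfolded mult_set_def]
  note J = ideal_ideal_power[OF I]
  have SM: "s * t \<in> C - Q" if "s \<in> C - Q" "t \<in> C - Q" for s t using S that by blast
  have IQ: "I \<subseteq> Q" using Q(2) by (auto simp: minimal_primes_def)
  have I1: "ideal_power I (Suc 0) \<subseteq> I"
    unfolding ideal_power_Suc using R.ideal_prod_inter[OF J I, of 0] by blast
  have Sm: "x \<in> symbolic_power R I n" if "s \<in> C - Q" "s * x \<in> ideal_power I n" "x \<in> C" for s x n
    using that iff by blast
  have Sd: "\<exists>s\<in>C - Q. s * x \<in> ideal_power I n" "x \<in> C" if "x \<in> symbolic_power R I n" for x n
    using that iff by blast+
  have "ideal (symbolic_power R I n) R" for n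
    unfolding ideal_iff
  proof (intro conjI ballI subsetI)
    show "x \<in> C" if "x \<in> symbolic_power R I n" for x using that iff by blast
    show "0 \<in> symbolic_power R I n"
      by (rule Sm[of 1]) (use S J in \<open>auto simp: ideal_iff\<close>)
    fix x assume x: "x \<in> symbolic_power R I n"
    then obtain s where s: "s \<in> C - Q" "s * x \<in> ideal_power I n" using Sd by blast
    show "a * x \<in> symbolic_power R I n" if a: "a \<in> C" for a
    proof (rule Sm[of s])
      have "s * (a * x) = a * (s * x)" by (simp add: algebra_simps)
      then show "s * (a * x) \<in> ideal_power I n"
        using ideal_mult_left[OF J s(2) a] by (simp only:)
    qed (use s a Sd(2)[OF x] in auto)
    fix y assume y: "y \<in> symbolic_power R I n"
    then obtain t where t: "t \<in> C - Q" "t * y \<in> ideal_power I n" using Sd by blast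
    show "x + y \<in> symbolic_power R I n"
    proof (rule Sm[of "s * t"])
      have eq: "s * t * (x + y) = t * (s * x) + s * (t * y)" by (simp add: algebra_simps)
      show "s * t * (x + y) \<in> ideal_power I n"
        unfolding eq using ideal_mult_left[OF J s(2), of t] ideal_mult_left[OF J t(2), of s] s t J[of n]
        by (auto simp: ideal_iff)
    qed (use SM[OF s(1) t(1)] Sd(2)[OF x] Sd(2)[OF y] in auto)
  qed
  moreover have "symbolic_power R I 0 = C"
  proof -
    have "1 \<in> C - Q" using S by blast
    then have "\<exists>s\<in>C - Q. s * x \<in> C" if "x \<in> C" for x
      using that by (intro bexI[of _ 1]) auto
    then show ?thesis using iff[of _ 0] unfolding ideal_power_0 by blast
  qed
  moreover have "symbolic_power R I (Suc n) \<subseteq> symbolic_power R I n" for n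
    using iff ideal_power_Suc_subset[OF I, of n] by blast
  \<comment> \<open>An \<open>s\<close> outside \<open>Q\<close> with \<open>s * 1\<close> in
    \<open>I\<close> would lie in \<open>Q\<close>, as \<open>I\<close> is contained in
    \<open>Q\<close>.\<close>
  moreover have "1 \<notin> symbolic_power R I 1"
    using iff[of 1 1] I1 IQ by auto
  moreover have "x * y \<in> symbolic_power R I (m + n)"
    if xy: "x \<in> symbolic_power R I m" "y \<in> symbolic_power R I n" for x y m n
  proof -
    obtain s where s: "s \<in> C - Q" "s * x \<in> ideal_power I m" using Sd xy by blast
    obtain t where t: "t \<in> C - Q" "t * y \<in> ideal_power I n" using Sd xy by blast
    have eq: "(s * t) * (x * y) = (s * x) * (t * y)" by (simp add: algebra_simps)
    show ?thesis
      by (rule Sm[of "s * t"], rule SM[OF s(1) t(1)], unfold eq, rule ideal_power_mult[OF I s(2) t(2)])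
        (use xy Sd(2) in auto)
  qed
  ultimately show ?thesis unfolding sym_filtration_def by blast
qed

lemma a_r_coset_eq: "J +>\<^bsub>R\<^esub> a = {x + a | x. x \<in> J}"
  by (auto simp: a_r_coset_def')

lemma coset_zero: "J +>\<^bsub>R\<^esub> 0 = J"
  by (simp add: a_r_coset_eq)

lemma coset_eq_iff:
  assumes J: "ideal J R"
  shows "J +>\<^bsub>R\<^esub> a = J +>\<^bsub>R\<^esub> b \<longleftrightarrow> a - b \<in> J"
proof
  assume eq: "J +>\<^bsub>R\<^esub> a = J +>\<^bsub>R\<^esub> b"
  have "0 + a \<in> J +>\<^bsub>R\<^esub> a" unfolding a_r_coset_eq using J ideal_iff[of J] by blast
  then have "a \<in> J +>\<^bsub>R\<^esub> b" using eq by simp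
  then show "a - b \<in> J" by (auto simp: a_r_coset_eq)
next
  have sub: "J +>\<^bsub>R\<^esub> a \<subseteq> J +>\<^bsub>R\<^esub> b" if "a - b \<in> J" for a b
  proof
    fix y assume "y \<in> J +>\<^bsub>R\<^esub> a"
    then obtain x where "x \<in> J" "y = x + a" by (auto simp: a_r_coset_eq)
    moreover have "x + (a - b) \<in> J" using \<open>x \<in> J\<close> that J ideal_iff[of J] by blast
    moreover have "x + a = (x + (a - b)) + b" by simp
    ultimately show "y \<in> J +>\<^bsub>R\<^esub> b" unfolding a_r_coset_eq by blast
  qed
  assume "a - b \<in> J"
  moreover have "b - a \<in> J" using ideal_uminus[OF J \<open>a - b \<in> J\<close>] by simp
  ultimately show "J +>\<^bsub>R\<^esub> a = J +>\<^bsub>R\<^esub> b" using sub by blast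
qed

end

text \<open>Here \<open>\<psi> x\<close> stands for \<open>\<phi> (Root x)\<close>. Working on
  \<open>R\<close> in place of its ring of \<open>p\<close>-th roots turns linearity into
  \<open>\<psi> (a ^ p * x) = a * \<psi> x\<close>.\<close>

locale F_split_filtration = type_subring +
  fixes I p \<psi>
  assumes fil: "sym_filtration I" and char: "CHAR('a) = p" and prime_p: "prime p"
    and \<psi>_closed: "\<And>x. x \<in> C \<Longrightarrow> \<psi> x \<in> C"
    and \<psi>_add: "\<And>x y. x \<in> C \<Longrightarrow> y \<in> C \<Longrightarrow> \<psi> (x + y) = \<psi> x + \<psi> y"
    and \<psi>_mult: "\<And>a x. a \<in> C \<Longrightarrow> x \<in> C \<Longrightarrow> \<psi> (a ^ p * x) = a * \<psi> x"
    and \<psi>_one: "\<psi> 1 = 1"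
    and \<psi>_sym: "\<And>n x. x \<in> symbolic_power R I (n * p + 1) \<Longrightarrow> \<psi> x \<in> symbolic_power R I (n + 1)"
begin

abbreviation "J \<equiv> symbolic_power R I"

lemma p_pos: "p > 0"
  using prime_p by (simp add: prime_gt_0_nat)

lemma J_facts:
  "ideal (J n) R" "J 0 = C" "J (Suc n) \<subseteq> J n" "1 \<notin> J 1"
  "x \<in> J m \<Longrightarrow> y \<in> J n \<Longrightarrow> x * y \<in> J (m + n)"
  using fil unfolding sym_filtration_def by blast+

lemma J_closed: "x \<in> J n \<Longrightarrow> x \<in> C"
  using ideal_subset[OF J_facts(1)] .

lemma J_antimono: "m \<le> n \<Longrightarrow> J n \<subseteq> J m"
  by (rule lift_Suc_antimono_le[of J]) (rule J_facts(3))

lemma \<psi>_zero: "\<psi> 0 = 0"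
  using \<psi>_add[of 0 0] add_left_imp_eq[of "\<psi> 0" "\<psi> 0" 0]
  by (simp only: add_0_right zero_closed simp_thms)

lemma \<psi>_diff: "x \<in> C \<Longrightarrow> y \<in> C \<Longrightarrow> \<psi> (x - y) = \<psi> x - \<psi> y"
  using \<psi>_add[of "x - y" y] by simp

lemma \<psi>_sum: "(\<And>i. i \<in> A \<Longrightarrow> f i \<in> C) \<Longrightarrow> \<psi> (sum f A) = (\<Sum>i\<in>A. \<psi> (f i))"
  by (induction A rule: infinite_finite_induct) (auto simp: \<psi>_zero \<psi>_add sum_closed)

text \<open>For \<open>n = m + 1\<close> one has \<open>m * p + 1 \<le> n * p\<close>, so the
  hypothesis at \<open>m\<close> applies. This keeps \<open>rees_split\<close> inside
  \<open>rees\<close>.\<close>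

lemma \<psi>_sym': "x \<in> J (n * p) \<Longrightarrow> \<psi> x \<in> J n"
proof (cases n)
  case 0
  then show "x \<in> J (n * p) \<Longrightarrow> \<psi> x \<in> J n" using \<psi>_closed by (simp add: J_facts)
next
  case (Suc m)
  then have "m * p + 1 \<le> n * p" using p_pos by simp
  then show "x \<in> J (n * p) \<Longrightarrow> \<psi> x \<in> J n" using J_antimono[of "m * p + 1" "n * p"] \<psi>_sym[of x m] Suc by auto
qed

definition rees :: "'a poly set" where
  "rees = {P. \<forall>n. Polynomial.coeff P n \<in> J n}"

lemma type_subring_rees: "type_subring rees"
proof
  have J: "0 \<in> J n" "x \<in> J n \<Longrightarrow> y \<in> J n \<Longrightarrow> x + y \<in> J n" for x y n
    using J_facts(1)[of n] ideal_iff[of "J n"] by blast+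
  show "0 \<in> rees" by (simp add: rees_def J)
  show "1 \<in> rees" by (simp add: rees_def J J_facts(2))
  fix P assume P: "P \<in> rees"
  then show "- P \<in> rees" using ideal_uminus[OF J_facts(1)] by (simp add: rees_def)
  fix Q assume Q: "Q \<in> rees"
  show "P + Q \<in> rees" using P Q J by (simp add: rees_def)
  show "P * Q \<in> rees"
    unfolding rees_def Polynomial.coeff_mult mem_Collect_eq
  proof (rule allI, rule ideal_sum[OF J_facts(1)])
    fix n i :: nat assume "i \<in> {..n}"
    then show "Polynomial.coeff P i * Polynomial.coeff Q (n - i) \<in> J n"
      using J_facts(5)[of "Polynomial.coeff P i" i "Polynomial.coeff Q (n - i)" "n - i"] P Q
      by (simp add: rees_def)
  qed
qed

sublocale rees: type_subring rees by (rule type_subring_rees)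

definition rees_split :: "'a poly \<Rightarrow> 'a poly" where
  "rees_split P = Abs_poly (\<lambda>n. \<psi> (Polynomial.coeff P (n * p)))"

lemma coeff_rees_split: "Polynomial.coeff (rees_split P) n = \<psi> (Polynomial.coeff P (n * p))"
proof -
  have "Polynomial.coeff (Abs_poly (\<lambda>n. \<psi> (Polynomial.coeff P (n * p)))) =
      (\<lambda>n. \<psi> (Polynomial.coeff P (n * p)))"
  proof (rule coeff_Abs_poly[of "Polynomial.degree P"])
    fix i assume i: "i > Polynomial.degree P"
    have "i * 1 \<le> i * p" using p_pos by (intro mult_le_mono2) simp
    then have "i * p > Polynomial.degree P" using i by linarith
    then show "\<psi> (Polynomial.coeff P (i * p)) = 0"
      using i by (simp add: coeff_eq_0 \<psi>_zero)
  qed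
  then show ?thesis by (simp add: rees_split_def)
qed

lemma rees_coeff_closed: "P \<in> rees \<Longrightarrow> Polynomial.coeff P n \<in> C"
  using J_closed by (auto simp: rees_def)

text \<open>Only the coefficients of \<open>A ^ p\<close> with index divisible by \<open>p\<close>
  are nonzero, and they are \<open>p\<close>-th powers. So \<open>\<psi>\<close> takes them out of
  the convolution for index \<open>n * p\<close>, and the convolution for
  \<open>A * rees_split P\<close> remains.\<close>

lemma rees_split_mult:
  assumes A: "A \<in> rees" and P: "P \<in> rees"
  shows "rees_split (A ^ p * P) = A * rees_split P"
proof (rule poly_eqI)
  fix n
  let ?c = Polynomial.coeff
  have "?c (A ^ p * P) (n * p) = (\<Sum>i\<le>n * p. ?c (A ^ p) i * ?c P (n * p - i))"
    by (rule Polynomial.coeff_mult)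
  also have "\<dots> = (\<Sum>i\<in>(\<lambda>k. k * p) ` {..n}. ?c (A ^ p) i * ?c P (n * p - i))"
  proof (rule sum.mono_neutral_right)
    show "\<forall>i\<in>{..n * p} - (\<lambda>k. k * p) ` {..n}. ?c (A ^ p) i * ?c P (n * p - i) = 0"
    proof
      fix i assume i: "i \<in> {..n * p} - (\<lambda>k. k * p) ` {..n}"
      have "\<not> p dvd i"
      proof
        assume "p dvd i"
        then obtain k where "i = k * p" by (metis dvd_def mult.commute)
        with i p_pos show False by auto
      qed
      then show "?c (A ^ p) i * ?c P (n * p - i) = 0"
        using coeff_power_char[of A i] char prime_p by simp
    qed
  qed auto
  also have "\<dots> = (\<Sum>k\<le>n. ?c (A ^ p) (k * p) * ?c P (n * p - k * p))"
    using p_pos by (subst sum.reindex) (auto simp: inj_on_def)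
  also have "\<dots> = (\<Sum>k\<le>n. ?c A k ^ p * ?c P ((n - k) * p))"
    using coeff_power_char[of A] char prime_p p_pos
    by (intro sum.cong refl) (simp add: diff_mult_distrib)
  finally have eq: "?c (A ^ p * P) (n * p) = (\<Sum>k\<le>n. ?c A k ^ p * ?c P ((n - k) * p))" .
  have "?c (rees_split (A ^ p * P)) n = (\<Sum>k\<le>n. \<psi> (?c A k ^ p * ?c P ((n - k) * p)))"
    unfolding coeff_rees_split eq
    by (rule \<psi>_sum) (simp add: rees_coeff_closed A P)
  also have "\<dots> = (\<Sum>k\<le>n. ?c A k * \<psi> (?c P ((n - k) * p)))"
    by (intro sum.cong refl \<psi>_mult rees_coeff_closed A P)
  also have "\<dots> = ?c (A * rees_split P) n"
    by (simp add: Polynomial.coeff_mult coeff_rees_split)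
  finally show "?c (rees_split (A ^ p * P)) n = ?c (A * rees_split P) n" .
qed

lemma rees_split_splits:
  "linear_map rees.R (frobenius_module p rees.R) (self_module rees.R) rees_split"
  "A \<in> rees \<Longrightarrow> rees_split (A ^ p) = A"
proof -
  have one: "rees_split 1 = 1"
    using p_pos by (intro poly_eqI) (auto simp: coeff_rees_split \<psi>_one \<psi>_zero)
  show "A \<in> rees \<Longrightarrow> rees_split (A ^ p) = A"
    using rees_split_mult[of A 1] one by simp
  have "rees_split P \<in> rees" if "P \<in> rees" for P
    using that \<psi>_sym' by (simp add: rees_def coeff_rees_split)
  moreover have "rees_split (P + Q) = rees_split P + rees_split Q" if "P \<in> rees" "Q \<in> rees" for P Q
    by (intro poly_eqI) (simp add: coeff_rees_split \<psi>_add rees_coeff_closed that)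
  ultimately show "linear_map rees.R (frobenius_module p rees.R) (self_module rees.R) rees_split"
    unfolding linear_map_frobenius_iff by (simp add: rees_split_mult)
qed

text \<open>Taking coefficient functions identifies \<open>rees\<close> with the carrier built from
  \<open>UP R\<close>, so the splitting is carried over from type-class polynomials.\<close>

lemma F_split_symbolic_rees: "F_split p (symbolic_rees R I)"
proof -
  let ?A = "symbolic_rees R I"
  have up: "f \<in> up R \<longleftrightarrow> (\<forall>n. f n \<in> C) \<and> (\<exists>n. \<forall>m>n. f m = 0)" for f
    by (auto simp: up_def bound_def)
  have carr: "carrier ?A = {f \<in> up R. \<forall>n. f n \<in> J n}"
    by (auto simp: symbolic_rees_def UP_def)
  have img: "Polynomial.coeff ` rees = carrier ?A"
  proof safe
    fix P assume P: "P \<in> rees"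
    have "\<exists>n. \<forall>m>n. Polynomial.coeff P m = 0"
      by (rule exI[of _ "Polynomial.degree P"]) (auto simp: coeff_eq_0)
    then show "Polynomial.coeff P \<in> carrier ?A"
      using P rees_coeff_closed[OF P] by (simp add: carr up rees_def)
  next
    fix f assume f: "f \<in> carrier ?A"
    then obtain n where "\<forall>m>n. f m = 0" by (auto simp: carr up)
    then have "Polynomial.coeff (Abs_poly f) = f" by (intro coeff_Abs_poly) auto
    moreover from this have "Abs_poly f \<in> rees" using f by (simp add: rees_def carr)
    ultimately show "f \<in> Polynomial.coeff ` rees" by (metis imageI)
  qed
  have upc: "Polynomial.coeff P \<in> up R" if "P \<in> rees" for P
    using that img by (auto simp: carr)
  have one: "\<one>\<^bsub>?A\<^esub> = Polynomial.coeff 1"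
    by (auto simp: symbolic_rees_def UP_def fun_eq_iff)
  have zero: "\<zero>\<^bsub>?A\<^esub> = Polynomial.coeff 0"
    by (auto simp: symbolic_rees_def UP_def fun_eq_iff)
  have hom: "Polynomial.coeff \<in> Ring.ring_hom rees.R ?A"
  proof (rule ring_hom_memI)
    fix P Q assume "P \<in> carrier rees.R" "Q \<in> carrier rees.R"
    then have P: "P \<in> rees" and Q: "Q \<in> rees" by simp_all
    show "Polynomial.coeff (P \<oplus>\<^bsub>rees.R\<^esub> Q) = Polynomial.coeff P \<oplus>\<^bsub>?A\<^esub> Polynomial.coeff Q"
      using upc[OF P] upc[OF Q] by (simp add: symbolic_rees_def UP_def fun_eq_iff)
    have "finsum R (\<lambda>i. Polynomial.coeff P i * Polynomial.coeff Q (n - i)) {..n} =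
        Polynomial.coeff (P * Q) n" for n
      unfolding Polynomial.coeff_mult
      by (rule finsum_R) (auto simp: rees_coeff_closed P Q)
    then show "Polynomial.coeff (P \<otimes>\<^bsub>rees.R\<^esub> Q) = Polynomial.coeff P \<otimes>\<^bsub>?A\<^esub> Polynomial.coeff Q"
      using upc[OF P] upc[OF Q] by (simp add: symbolic_rees_def UP_def fun_eq_iff)
  qed (use img one in auto)
  have crA: "cring ?A"
    using cring_surjective_image[OF rees.cring_R hom] img zero by simp
  have ne: "\<one>\<^bsub>?A\<^esub> \<noteq> \<zero>\<^bsub>?A\<^esub>"
  proof
    assume "\<one>\<^bsub>?A\<^esub> = \<zero>\<^bsub>?A\<^esub>"
    then have "Polynomial.coeff 1 0 = Polynomial.coeff (0 :: 'a poly) 0" by (simp only: one zero)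
    then show False by simp
  qed
  show ?thesis
  proof (rule F_split_surjective_image[OF rees.cring_R hom])
    show "has_char ?A p"
      by (rule rees.has_char_image[OF _ prime_p crA hom zero[symmetric] ne]) (simp add: char)
  qed (use img zero rees_split_splits in \<open>auto simp: poly.coeff_inject\<close>)
qed

end

section \<open>The Frobenius splitting of the symbolic associated graded ring\<close>

context F_split_filtration begin

lemma J0: "0 \<in> J n"
  using J_facts(1)[of n] ideal_iff[of "J n"] by blast

lemma F_split_symbolic_gr: "F_split p (symbolic_gr R I)"
proof -
  let ?G = "symbolic_gr R I" and ?c = Polynomial.coeff
  define h where "h = (\<lambda>P n. J (n + 1) +>\<^bsub>R\<^esub> ?c P n)"
  have carr: "carrier ?G = {f. (\<forall>n. \<exists>a\<in>J n. f n = J (n + 1) +>\<^bsub>R\<^esub> a) \<and> finite {n. f n \<noteq> J (n + 1)}}"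
    by (simp add: symbolic_gr_def Let_def)
  have img: "h ` rees = carrier ?G"
  proof safe
    fix P assume P: "P \<in> rees"
    have "{n. h P n \<noteq> J (n + 1)} \<subseteq> {..Polynomial.degree P}"
    proof
      fix n assume "n \<in> {n. h P n \<noteq> J (n + 1)}"
      moreover have "h P n = J (n + 1)" if "?c P n = 0"
        by (simp only: h_def that coset_zero)
      ultimately have "?c P n \<noteq> 0" by blast
      then show "n \<in> {..Polynomial.degree P}" by (simp add: le_degree)
    qed
    then have "finite {n. h P n \<noteq> J (n + 1)}" by (rule finite_subset) simp
    moreover have "\<exists>a\<in>J n. h P n = J (n + 1) +>\<^bsub>R\<^esub> a" for n
      using P by (auto simp: h_def rees_def)
    ultimately show "h P \<in> carrier ?G" unfolding carr by blast
  next
    fix f assume f: "f \<in> carrier ?G"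
    \<comment> \<open>Representatives are taken to be 0 wherever the coset is trivial; otherwise
      they need not form a polynomial.\<close>
    have "\<exists>a. a \<in> J n \<and> f n = J (n + 1) +>\<^bsub>R\<^esub> a \<and> (f n = J (n + 1) \<longrightarrow> a = 0)" for n
    proof (cases "f n = J (n + 1)")
      case True
      show ?thesis using True J0[of n] coset_zero[of "J (n + 1)"] by (intro exI[of _ 0]) auto
    next
      case False
      then show ?thesis using f unfolding carr by blast
    qed
    then obtain a where a: "\<And>n. a n \<in> J n" "\<And>n. f n = J (n + 1) +>\<^bsub>R\<^esub> a n"
        "\<And>n. f n = J (n + 1) \<Longrightarrow> a n = 0"
      by metis
    have "finite {n. f n \<noteq> J (n + 1)}" using f unfolding carr by blast
    then obtain N where N: "\<And>n. f n \<noteq> J (n + 1) \<Longrightarrow> n \<le> N"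
      using finite_nat_set_iff_bounded_le by auto
    have "?c (Abs_poly a) = a"
      by (rule coeff_Abs_poly[of N]) (use a(3) N in \<open>meson not_le\<close>)
    then have "Abs_poly a \<in> rees" "f = h (Abs_poly a)"
      using a(1,2) by (auto simp: rees_def h_def)
    then show "f \<in> h ` rees" by blast
  qed
  have zero: "h 0 = \<zero>\<^bsub>?G\<^esub>"
    by (simp add: symbolic_gr_def Let_def h_def coset_zero)
  have one: "h 1 = \<one>\<^bsub>?G\<^esub>"
    by (simp add: symbolic_gr_def Let_def h_def)
      (rule ext, simp)
  have qh: "ring_hom_cring R (R Quot J n) ((+>\<^bsub>R\<^esub>) (J n))" for n
    using ideal.rcos_ring_hom_cring[OF J_facts(1) cring_R] .
  have coset_mult: "rcoset_mult R (J (n + 1)) (h P i) (h Q (n - i)) = J (n + 1) +>\<^bsub>R\<^esub> (?c P i * ?c Q (n - i))"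
    if P: "P \<in> rees" and Q: "Q \<in> rees" and i: "i \<le> n" for P Q n i
  proof -
    let ?x = "?c P i" and ?y = "?c Q (n - i)"
    have xy: "?x \<in> J i" "?y \<in> J (n - i)" using P Q by (simp_all add: rees_def)
    have ne: "h P i \<noteq> {}" "h Q (n - i) \<noteq> {}"
      using J0[of "i + 1"] J0[of "n - i + 1"] by (auto simp: h_def a_r_coset_eq)
    have "J (n + 1) +>\<^bsub>R\<^esub> (a * b) = J (n + 1) +>\<^bsub>R\<^esub> (?x * ?y)"
      if a: "a \<in> h P i" and b: "b \<in> h Q (n - i)" for a b
    proof -
      obtain u where u: "u \<in> J (i + 1)" "a = u + ?x" using a by (auto simp: h_def a_r_coset_eq)
      obtain v where v: "v \<in> J (n - i + 1)" "b = v + ?y" using b by (auto simp: h_def a_r_coset_eq)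
      have v': "v \<in> J (n - i)" using v(1) J_antimono[of "n - i" "n - i + 1"] by auto
      have yv: "v + ?y \<in> J (n - i)"
        using v' xy(2) J_facts(1)[of "n - i"] ideal_iff[of "J (n - i)"] by blast
      have 1: "u * (v + ?y) \<in> J (n + 1)"
        using J_facts(5)[OF u(1) yv] i by simp
      have 2: "?x * v \<in> J (n + 1)"
        using J_facts(5)[OF xy(1) v(1)] i by simp
      have "a * b - ?x * ?y = u * (v + ?y) + ?x * v" by (simp add: u v algebra_simps)
      also have "\<dots> \<in> J (n + 1)" using 1 2 J_facts(1)[of "n + 1"] ideal_iff[of "J (n + 1)"] by blast
      finally show ?thesis by (simp only: coset_eq_iff[OF J_facts(1)])
    qed
    then show ?thesis
      unfolding rcoset_mult_def using ne by auto
  qed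
  have hom: "h \<in> Ring.ring_hom rees.R ?G"
  proof (rule ring_hom_memI)
    fix P Q assume "P \<in> carrier rees.R" "Q \<in> carrier rees.R"
    then have P: "P \<in> rees" and Q: "Q \<in> rees" by simp_all
    show "h (P \<oplus>\<^bsub>rees.R\<^esub> Q) = h P \<oplus>\<^bsub>?G\<^esub> h Q"
    proof
      fix n
      interpret q: ring_hom_cring R "R Quot J (n + 1)" "(+>\<^bsub>R\<^esub>) (J (n + 1))" by (rule qh)
      show "h (P \<oplus>\<^bsub>rees.R\<^esub> Q) n = (h P \<oplus>\<^bsub>?G\<^esub> h Q) n"
        using q.hom_add[of "?c P n" "?c Q n"] rees_coeff_closed[OF P] rees_coeff_closed[OF Q]
        by (simp add: symbolic_gr_def Let_def h_def)
    qed
    show "h (P \<otimes>\<^bsub>rees.R\<^esub> Q) = h P \<otimes>\<^bsub>?G\<^esub> h Q"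
    proof
      fix n
      interpret q: ring_hom_cring R "R Quot J (n + 1)" "(+>\<^bsub>R\<^esub>) (J (n + 1))" by (rule qh)
      let ?f = "\<lambda>i. ?c P i * ?c Q (n - i)"
      have f: "?f \<in> {..n} \<rightarrow> carrier R" by (simp add: rees_coeff_closed P Q)
      have "(h P \<otimes>\<^bsub>?G\<^esub> h Q) n = finsum (R Quot J (n + 1))
          (\<lambda>i. rcoset_mult R (J (n + 1)) (h P i) (h Q (n - i))) {..n}"
        by (simp add: symbolic_gr_def Let_def)
      also have "\<dots> = finsum (R Quot J (n + 1)) ((+>\<^bsub>R\<^esub>) (J (n + 1)) \<circ> ?f) {..n}"
      proof (rule q.S.finsum_cong')
        show "(+>\<^bsub>R\<^esub>) (J (n + 1)) \<circ> ?f \<in> {..n} \<rightarrow> carrier (R Quot J (n + 1))"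
          using q.hom_closed f by (simp only: Pi_iff o_def) blast
        fix i assume "i \<in> {..n}"
        then show "rcoset_mult R (J (n + 1)) (h P i) (h Q (n - i)) = ((+>\<^bsub>R\<^esub>) (J (n + 1)) \<circ> ?f) i"
          using coset_mult[OF P Q, of i n] by (simp only: o_def atMost_iff)
      qed simp
      also have "\<dots> = J (n + 1) +>\<^bsub>R\<^esub> finsum R ?f {..n}"
        by (rule q.hom_finsum[OF f, symmetric])
      also have "finsum R ?f {..n} = ?c (P * Q) n"
        unfolding Polynomial.coeff_mult using f by (intro finsum_R) auto
      finally show "h (P \<otimes>\<^bsub>rees.R\<^esub> Q) n = (h P \<otimes>\<^bsub>?G\<^esub> h Q) n"
        by (simp add: h_def)
    qed
  qed (use img one in auto)
  have crG: "cring ?G"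
    using cring_surjective_image[OF rees.cring_R hom] img zero by simp
  have ne: "\<one>\<^bsub>?G\<^esub> \<noteq> \<zero>\<^bsub>?G\<^esub>"
  proof
    assume "\<one>\<^bsub>?G\<^esub> = \<zero>\<^bsub>?G\<^esub>"
    then have "h 1 0 = h 0 0" by (simp only: one zero)
    then show False using J_facts(4) coset_eq_iff[OF J_facts(1), of 1 1 0] by (simp add: h_def)
  qed
  show ?thesis
  proof (rule F_split_surjective_image[OF rees.cring_R hom])
    show "has_char ?G p"
      by (rule rees.has_char_image[OF _ prime_p crG hom zero ne]) (simp add: char)
    fix P Q assume "P \<in> carrier rees.R" "Q \<in> carrier rees.R" and eq: "h P = h Q"
    then have P: "P \<in> rees" and Q: "Q \<in> rees" by simp_all
    have "?c P n - ?c Q n \<in> J (n + 1)" for n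
      using fun_cong[OF eq, of n] coset_eq_iff[OF J_facts(1)] by (simp only: h_def)
    \<comment> \<open>The coefficients of index \<open>n * p\<close> differ by an element of
      \<open>J (n * p + 1)\<close>, which is exactly the index in the definition of a symbolic
      F-splitting. The weaker \<open>\<psi>_sym'\<close> would only give a difference in
      \<open>J n\<close>.\<close>
    then have "\<psi> (?c P (n * p)) - \<psi> (?c Q (n * p)) \<in> J (n + 1)" for n
      using \<psi>_sym[of "?c P (n * p) - ?c Q (n * p)" n] \<psi>_diff rees_coeff_closed P Q by metis
    then show "h (rees_split P) = h (rees_split Q)"
      unfolding h_def coeff_rees_split using coset_eq_iff[OF J_facts(1)] by (intro ext) blast
  qed (use img zero rees_split_splits in auto)
qed

end

lemma (in type_subring) F_split_of_symbolic_F_split: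
  assumes I: "ideal I R" "primeideal Q R" "minimal_primes R I = {Q}"
    and p: "CHAR('a) = p" "prime p" and split: "symbolic_F_split p R I"
  shows "F_split p (symbolic_rees R I)" "F_split p (symbolic_gr R I)"
proof -
  obtain \<phi> where lin: "linear_map R (root_ring p R) (self_module R) \<phi>"
      and one: "\<forall>r\<in>C. \<phi> (root_incl p R r) = r"
      and sym: "\<And>n. \<phi> ` Root ` symbolic_power R I (n * p + 1) \<subseteq> symbolic_power R I (n + 1)"
    using split by (auto simp: symbolic_F_split_def)
  interpret F_split_filtration C I p "\<lambda>x. \<phi> (Root x)"
  proof
    show "sym_filtration I" by (rule sym_filtrationI[OF I])
    show "\<phi> (Root 1) = 1" using one[rule_format, of 1] by (simp add: root_incl_def)
    show "\<phi> (Root x) \<in> symbolic_power R I (n + 1)" if "x \<in> symbolic_power R I (n * p + 1)" for n x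
      using sym[of n] that by blast
  qed (use p lin in \<open>auto simp: linear_map_def root_ring_def self_module_def root_incl_def\<close>)
  show "F_split p (symbolic_rees R I)" by (rule F_split_symbolic_rees)
  show "F_split p (symbolic_gr R I)" by (rule F_split_symbolic_gr)
qed


section \<open>Determinants\<close>

definition fdet :: "nat \<Rightarrow> (nat \<Rightarrow> nat \<Rightarrow> 'a::comm_ring_1) \<Rightarrow> 'a" where
  "fdet n f = det (mat n n (\<lambda>(i, k). f i k))"

lemma fdet_leibniz:
  "fdet n f = (\<Sum>\<sigma> | \<sigma> permutes {0..<n}. of_int (sign \<sigma>) * (\<Prod>i=0..<n. f i (\<sigma> i)))"
proof -
  have "(\<Prod>i=0..<n. mat n n (\<lambda>(i, k). f i k) $$ (i, \<sigma> i)) = (\<Prod>i=0..<n. f i (\<sigma> i))"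
    if "\<sigma> permutes {0..<n}" for \<sigma>
    using permutes_in_image[OF that] by (intro prod.cong) auto
  then show ?thesis
    unfolding fdet_def Determinant.det_def by (auto intro!: sum.cong)
qed

lemma fdet_cong: "(\<And>i k. i < n \<Longrightarrow> k < n \<Longrightarrow> f i k = g i k) \<Longrightarrow> fdet n f = fdet n g"
  unfolding fdet_def by (intro arg_cong[of _ _ det] eq_matI) auto

lemma fdet_0 [simp]: "fdet 0 f = 1"
  by (simp add: fdet_leibniz)

lemma fdet_transpose: "fdet n (\<lambda>i k. f k i) = fdet n f"
proof -
  have "mat n n (\<lambda>(i, k). f k i) = transpose_mat (mat n n (\<lambda>(i, k). f i k))"
    by (intro eq_matI) auto
  then show ?thesis unfolding fdet_def using det_transpose by (metis mat_carrier)
qed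

lemma fdet_identical_rows:
  assumes "i < n" "j < n" "i \<noteq> j" "\<And>k. k < n \<Longrightarrow> f i k = f j k"
  shows "fdet n f = 0"
  unfolding fdet_def
  by (rule det_identical_rows[of _ n i j]) (use assms in \<open>auto intro!: eq_vecI\<close>)

lemma fdet_identical_cols:
  assumes "i < n" "j < n" "i \<noteq> j" "\<And>k. k < n \<Longrightarrow> f k i = f k j"
  shows "fdet n f = 0"
  unfolding fdet_transpose[of n f, symmetric]
  by (rule fdet_identical_rows[OF assms(1-3)]) (rule assms(4))

lemma fdet_permute_rows:
  assumes "p permutes {0..<n}"
  shows "fdet n (\<lambda>i k. f (p i) k) = of_int (sign p) * fdet n f"
proof -
  have "mat n n (\<lambda>(i, k). f (p i) k) = mat n n (\<lambda>(i, k). mat n n (\<lambda>(i, k). f i k) $$ (p i, k))"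
    using permutes_in_image[OF assms] by (intro eq_matI) auto
  then show ?thesis
    unfolding fdet_def using det_permute_rows[OF _ assms, of "mat n n (\<lambda>(i, k). f i k)"] by simp
qed

text \<open>This is the product of the matrix with its adjugate, tested on a row combination
  \<open>\<mu>\<close>: if the combination vanishes or lies in an ideal, so does
  \<open>\<mu> r\<close> times the determinant. The second clause exhibits the cofactors as signed
  minors, so that they lie in any subring containing the entries.\<close>

lemma fdet_adjugate:
  assumes "r < n"
  obtains c where
    "\<And>\<mu>. \<mu> r * fdet n f = (\<Sum>k<n. (\<Sum>i<n. \<mu> i * f i k) * c k)"
    "\<And>k. k < n \<Longrightarrow> \<exists>g e. c k = (- 1) ^ e * fdet (n - 1) g \<and> (\<forall>i k'. \<exists>i' k''. g i k' = f i' k'')"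
proof
  let ?A = "mat n n (\<lambda>(i, k). f i k)"
  let ?c = "\<lambda>k. cofactor ?A r k"
  have A: "?A \<in> carrier_mat n n" by simp
  have adj: "(\<Sum>k<n. f i k * ?c k) = (if i = r then fdet n f else 0)" if "i < n" for i
  proof -
    have "(?A * adj_mat ?A) $$ (i, r) = (\<Sum>k<n. f i k * ?c k)"
      using that assms by (simp add: scalar_prod_def adj_mat_def atLeast0LessThan)
    also have "?A * adj_mat ?A = det ?A \<cdot>\<^sub>m 1\<^sub>m n" using adj_mat(2)[OF A] .
    finally have "(\<Sum>k<n. f i k * ?c k) = (det ?A \<cdot>\<^sub>m 1\<^sub>m n) $$ (i, r)" by (rule sym)
    also have "\<dots> = (if i = r then fdet n f else 0)" using that assms by (simp add: fdet_def)
    finally show ?thesis .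
  qed
  show "\<mu> r * fdet n f = (\<Sum>k<n. (\<Sum>i<n. \<mu> i * f i k) * ?c k)" for \<mu>
  proof -
    have "(\<Sum>k<n. (\<Sum>i<n. \<mu> i * f i k) * ?c k) = (\<Sum>i<n. \<mu> i * (\<Sum>k<n. f i k * ?c k))"
      unfolding sum_distrib_left sum_distrib_right by (subst sum.swap) (simp add: mult.assoc)
    also have "\<dots> = (\<Sum>i<n. if i = r then \<mu> r * fdet n f else 0)"
      by (intro sum.cong refl) (simp add: adj)
    finally show ?thesis using assms by simp
  qed
  show "\<exists>g e. ?c k = (- 1) ^ e * fdet (n - 1) g \<and> (\<forall>i k'. \<exists>i' k''. g i k' = f i' k'')" if "k < n" for k
  proof -
    let ?g = "\<lambda>i k'. f (if i < r then i else Suc i) (if k' < k then k' else Suc k')"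
    have "mat_delete ?A r k = mat (n - 1) (n - 1) (\<lambda>(i, k'). ?g i k')"
      by (auto simp: mat_delete_def intro!: eq_matI)
    then have "?c k = (- 1) ^ (r + k) * fdet (n - 1) ?g"
      by (simp add: cofactor_def fdet_def)
    then show ?thesis by blast
  qed
qed

text \<open>Laplace expansion along the last column. The cofactors \<open>l\<close> are fixed before
  \<open>g\<close> varies, so one relation among rows serves for all border columns.\<close>

lemma fdet_last_col:
  obtains l where
    "\<And>g. fdet (Suc q) (\<lambda>i k. if k = q then g i else f i k) = (\<Sum>i<Suc q. l i * g i)"
    "l q = fdet q f"
    "\<And>i. i < Suc q \<Longrightarrow> \<exists>g e. l i = (- 1) ^ e * fdet q g \<and> (\<forall>i k. \<exists>i' k'. g i k = f i' k')"
proof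
  let ?M = "\<lambda>i. mat q q (\<lambda>(i', k). f (if i' < i then i' else Suc i') k)"
  let ?l = "\<lambda>i. (- 1) ^ (i + q) * det (?M i)"
  show "fdet (Suc q) (\<lambda>i k. if k = q then g i else f i k) = (\<Sum>i<Suc q. ?l i * g i)" for g
  proof -
    let ?A = "mat (Suc q) (Suc q) (\<lambda>(i, k). if k = q then g i else f i k)"
    have "mat_delete ?A i q = ?M i" if "i < Suc q" for i
      using that by (auto simp: mat_delete_def intro!: eq_matI)
    then show ?thesis
      unfolding fdet_def
      by (subst laplace_expansion_column[of ?A "Suc q" q])
        (auto simp: cofactor_def mult.commute intro!: sum.cong)
  qed
  show "?l q = fdet q f"
    unfolding fdet_def by (auto intro!: arg_cong[of _ _ det] eq_matI simp flip: mult_2)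
  show "\<exists>g e. ?l i = (- 1) ^ e * fdet q g \<and> (\<forall>i k. \<exists>i' k'. g i k = f i' k')" if "i < Suc q" for i
    by (rule exI[of _ "\<lambda>i' k. f (if i' < i then i' else Suc i') k"], rule exI[of _ "i + q"])
      (auto simp: fdet_def)
qed

section \<open>Hankel minors\<close>

abbreviation hdet :: "(nat \<Rightarrow> 'a::comm_ring_1) \<Rightarrow> nat \<Rightarrow> (nat \<Rightarrow> nat) \<Rightarrow> (nat \<Rightarrow> nat) \<Rightarrow> 'a" where
  "hdet w n a b \<equiv> fdet n (\<lambda>i k. w (a i + b k))"

lemma hdet_swap: "hdet w n a b = hdet w n b a"
  using fdet_transpose[of n "\<lambda>i k. w (b i + a k)"] by (simp add: add.commute)

text \<open>Multiplying the symbolic expansion by the elementary symmetric polynomial of degree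
  \<open>r\<close> in the rows may be done on the row indices or on the column indices.\<close>

lemma hdet_shift:
  "(\<Sum>S | S \<subseteq> {0..<n} \<and> card S = r. hdet w n (\<lambda>i. a i + of_bool (i \<in> S)) b) =
   (\<Sum>S | S \<subseteq> {0..<n} \<and> card S = r. hdet w n a (\<lambda>i. b i + of_bool (i \<in> S)))"
proof -
  let ?S = "{S. S \<subseteq> {0..<n} \<and> card S = r}"
  have eq: "(\<Sum>S\<in>?S. \<Prod>i=0..<n. w (a i + of_bool (i \<in> S) + b (\<sigma> i))) =
      (\<Sum>S\<in>?S. \<Prod>i=0..<n. w (a i + (b (\<sigma> i) + of_bool (\<sigma> i \<in> S))))"
    if p: "\<sigma> permutes {0..<n}" for \<sigma>
  proof (rule sum.reindex_bij_witness[of _ "\<lambda>S. inv_into UNIV \<sigma> ` S" "\<lambda>S. \<sigma> ` S"])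
    note inv = permutes_inv[OF p] and bij = permutes_bij[OF p]
    fix S assume S: "S \<in> ?S"
    show "inv_into UNIV \<sigma> ` \<sigma> ` S = S" "\<sigma> ` inv_into UNIV \<sigma> ` S = S"
      using permutes_inverses[OF p] by (auto simp: image_image)
    show "\<sigma> ` S \<in> ?S"
      using S permutes_image[OF p] card_image[of \<sigma> S] permutes_inj_on[OF p] by (auto simp: subset_iff)
    show "inv_into UNIV \<sigma> ` S \<in> ?S"
      using S permutes_image[OF inv] card_image[of "inv_into UNIV \<sigma>" S] permutes_inj_on[OF inv]
      by (auto simp: subset_iff)
    show "(\<Prod>i=0..<n. w (a i + (b (\<sigma> i) + of_bool (\<sigma> i \<in> \<sigma> ` S)))) =
        (\<Prod>i=0..<n. w (a i + of_bool (i \<in> S) + b (\<sigma> i)))"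
      using bij by (intro prod.cong refl) (simp add: bij_is_inj inj_image_mem_iff add_ac)
  qed
  have "(\<Sum>S\<in>?S. hdet w n (\<lambda>i. a i + of_bool (i \<in> S)) b) =
      (\<Sum>\<sigma> | \<sigma> permutes {0..<n}. of_int (sign \<sigma>) *
        (\<Sum>S\<in>?S. \<Prod>i=0..<n. w (a i + of_bool (i \<in> S) + b (\<sigma> i))))"
    unfolding fdet_leibniz sum_distrib_left by (rule sum.swap)
  also have "\<dots> = (\<Sum>\<sigma> | \<sigma> permutes {0..<n}. of_int (sign \<sigma>) *
        (\<Sum>S\<in>?S. \<Prod>i=0..<n. w (a i + (b (\<sigma> i) + of_bool (\<sigma> i \<in> S)))))"
    by (intro sum.cong refl arg_cong2[of _ _ _ _ "(*)"] eq) simp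
  also have "\<dots> = (\<Sum>S\<in>?S. hdet w n a (\<lambda>i. b i + of_bool (i \<in> S)))"
    unfolding fdet_leibniz sum_distrib_left by (rule sum.swap)
  finally show ?thesis .
qed

text \<open>The sorting permutation depends only on \<open>a\<close>, hence one sign works for all
  \<open>f\<close>; \<open>pick\<close> lists the image of \<open>a\<close> in increasing
  order.\<close>

lemma fdet_sort:
  fixes a :: "nat \<Rightarrow> nat"
  assumes inj: "inj_on a {..<n}"
  shows "\<exists>s (e :: nat). (\<forall>i j. i < j \<longrightarrow> j < n \<longrightarrow> s i < s j) \<and> (\<forall>i<n. s i \<in> a ` {..<n}) \<and>
    (\<forall>f :: nat \<Rightarrow> nat \<Rightarrow> 'a::comm_ring_1.
      fdet n (\<lambda>i k. f (a i) k) = (- 1) ^ e * fdet n (\<lambda>i k. f (s i) k))"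
proof -
  let ?A = "a ` {..<n}"
  have card: "card ?A = n" using card_image[OF inj] by simp
  define p where "p = (\<lambda>i. if i < n then inv_into {..<n} a (pick ?A i) else i)"
  have pick: "pick ?A i \<in> ?A" if "i < n" for i using pick_in_set_le[of i ?A] card that by simp
  have pr: "p i < n" "a (p i) = pick ?A i" if "i < n" for i
    using inv_into_into[OF pick[OF that]] f_inv_into_f[OF pick[OF that]] that by (auto simp: p_def)
  have mono: "pick ?A i < pick ?A j" if "i < j" "j < n" for i j
    using pick_mono_le[of j ?A i] card that by simp
  have "inj_on p {0..<n}"
  proof (rule inj_onI)
    fix i j assume "i \<in> {0..<n}" "j \<in> {0..<n}" "p i = p j"
    then have "pick ?A i = pick ?A j" using pr(2)[of i] pr(2)[of j] by auto
    then show "i = j" using mono[of i j] mono[of j i] \<open>i \<in> _\<close> \<open>j \<in> _\<close> by (cases i j rule: linorder_cases) auto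
  qed
  moreover from this have "p ` {0..<n} = {0..<n}"
    by (intro endo_inj_surj) (use pr(1) in auto)
  ultimately have "bij_betw p {0..<n} {0..<n}"
    unfolding bij_betw_def by blast
  then have p: "p permutes {0..<n}" by (rule bij_imp_permutes) (auto simp: p_def)
  obtain e where e: "sign p = (- 1) ^ e"
    by (cases p rule: sign_cases) (metis power_0, metis power_one_right)
  have "fdet n (\<lambda>i k. f (a i) k) = (- 1) ^ e * fdet n (\<lambda>i k. f (pick ?A i) k)"
    for f :: "nat \<Rightarrow> nat \<Rightarrow> 'a"
  proof -
    have "fdet n (\<lambda>i k. f (pick ?A i) k) = fdet n (\<lambda>i k. f (a (p i)) k)"
      by (rule fdet_cong) (simp add: pr)
    also have "\<dots> = (- 1) ^ e * fdet n (\<lambda>i k. f (a i) k)"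
      using fdet_permute_rows[OF p, of "\<lambda>i k. f (a i) k"] by (simp add: e)
    finally show ?thesis by (simp flip: mult.assoc power_add mult_2)
  qed
  then show ?thesis
    using mono pick by (intro exI[of _ "pick ?A"] exI[of _ e] conjI) auto
qed


text \<open>Index sequences may be unordered or repeat an entry. This adds only zeros and signed
  copies of minors, and the shifted sequences of \<open>hdet_shift\<close> need no case distinction
  to qualify.\<close>

definition hgen :: "(nat \<Rightarrow> 'a::comm_ring_1) \<Rightarrow> nat \<Rightarrow> nat \<Rightarrow> nat \<Rightarrow> 'a set" where
  "hgen w t m n = {hdet w t a b | a b. (\<forall>i<t. a i < m) \<and> (\<forall>k<t. b k < n)}"

definition incr :: "nat \<Rightarrow> (nat \<Rightarrow> nat) \<Rightarrow> bool" where
  "incr t a \<longleftrightarrow> (\<forall>i j. i < j \<longrightarrow> j < t \<longrightarrow> a i < a j)"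

lemma incr_gap: "incr t a \<Longrightarrow> i + d < t \<Longrightarrow> a i + d \<le> a (i + d)"
proof (induction d)
  case (Suc d)
  then have "a (i + d) < a (Suc (i + d))" by (auto simp: incr_def)
  then show ?case using Suc by simp
qed simp

lemma incr_inj: "incr t a \<Longrightarrow> inj_on a {..<t}"
  unfolding incr_def by (intro linorder_inj_onI) force+

lemma hgen_swap: "hgen w t m n = hgen w t n m"
proof -
  have "x \<in> hgen w t n m" if x: "x \<in> hgen w t m n" for x m n
  proof -
    obtain a b where ab: "\<forall>i<t. a i < m" "\<forall>k<t. b k < n" "x = hdet w t a b"
      using x unfolding hgen_def by blast
    have "x = hdet w t b a" unfolding ab(3) by (rule hdet_swap)
    then show ?thesis using ab(1,2) unfolding hgen_def by blast
  qed
  then show ?thesis by blast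
qed

lemma pick_incr:
  assumes a: "incr t a" and i: "i < t"
  shows "pick (a ` {..<t}) i = a i"
proof -
  have "{x \<in> a ` {..<t}. x < a i} = a ` {..<i}"
  proof safe
    fix j assume "j < t" "a j < a i"
    then show "a j \<in> a ` {..<i}"
      using a i unfolding incr_def by (metis imageI lessThan_iff linorder_neqE_nat order_less_asym)
  qed (use a i in \<open>auto simp: incr_def\<close>)
  moreover have "card (a ` {..<i}) = i"
    using card_image[OF inj_on_subset[OF incr_inj[OF a], of "{..<i}"]] i by auto
  ultimately show ?thesis
    using pick_card_in_set[of "a i" "a ` {..<t}"] i by auto
qed

text \<open>Index sets of size \<open>t\<close> and increasing sequences of length \<open>t\<close>
  determine each other through \<open>pick\<close>.\<close>

lemma minors_hankel:
  "minors t (mat m n (\<lambda>(a, b). w (a + b))) =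
    {hdet w t a b | a b. incr t a \<and> incr t b \<and> (\<forall>i<t. a i < m) \<and> (\<forall>k<t. b k < n)}" (is "?L = ?R")
proof
  let ?A = "mat m n (\<lambda>(a, b). w (a + b))"
  have det: "det (submatrix ?A I J) = hdet w t (pick I) (pick J)"
    if "I \<subseteq> {..<m}" "J \<subseteq> {..<n}" "card I = t" "card J = t" for I J
  proof -
    have "{i. i < m \<and> i \<in> I} = I" "{j. j < n \<and> j \<in> J} = J" using that by auto
    moreover have "pick I i < m" "pick J i < n" if "i < t" for i
      using pick_in_set_le[of i I] pick_in_set_le[of i J] that \<open>card I = t\<close> \<open>card J = t\<close>
        \<open>I \<subseteq> _\<close> \<open>J \<subseteq> _\<close> by auto
    ultimately show ?thesis
      using that unfolding submatrix_def fdet_def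
      by (intro arg_cong[of _ _ det] eq_matI) auto
  qed
  show "?L \<subseteq> ?R"
  proof
    fix x assume "x \<in> ?L"
    then obtain I J where IJ: "I \<subseteq> {..<m}" "J \<subseteq> {..<n}" "card I = t" "card J = t"
        "x = det (submatrix ?A I J)"
      by (auto simp: minors_def)
    have "incr t (pick I)" "incr t (pick J)"
      using pick_mono_le IJ by (auto simp: incr_def)
    moreover have "pick I i < m" "pick J i < n" if "i < t" for i
      using pick_in_set_le[of i I] pick_in_set_le[of i J] that IJ by auto
    ultimately show "x \<in> ?R" using IJ det[OF IJ(1-4)] by blast
  qed
  show "?R \<subseteq> ?L"
  proof
    fix x assume "x \<in> ?R"
    then obtain a b where ab: "incr t a" "incr t b" "\<forall>i<t. a i < m" "\<forall>k<t. b k < n"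
        "x = hdet w t a b" by blast
    let ?I = "a ` {..<t}" and ?J = "b ` {..<t}"
    have IJ: "?I \<subseteq> {..<m}" "?J \<subseteq> {..<n}" "card ?I = t" "card ?J = t"
      using ab card_image[OF incr_inj[OF ab(1)]] card_image[OF incr_inj[OF ab(2)]] by auto
    have "hdet w t (pick ?I) (pick ?J) = hdet w t a b"
      by (intro fdet_cong) (simp add: pick_incr ab)
    then have "x = det (submatrix ?A ?I ?J)" using det[OF IJ] ab by simp
    then show "x \<in> ?L" using IJ unfolding minors_def by auto
  qed
qed

section \<open>Exchanging rows for columns of a Hankel matrix\<close>

context type_subring
begin

lemma fdet_closed: "(\<And>i k. f i k \<in> C) \<Longrightarrow> fdet n f \<in> C"
  unfolding fdet_leibniz by (intro sum_closed mult_closed prod_closed of_int_closed)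

lemma minus_one_power_closed [simp]: "(- 1) ^ (e::nat) \<in> C"
  by (intro power_closed uminus_closed one_closed)

text \<open>Let \<open>U\<close> be the set of the \<open>k\<close> rows whose index is as large as
  possible, and lower these by one to get \<open>a'\<close>. In \<open>hdet_shift\<close> for
  \<open>a'\<close> and degree \<open>k\<close>, the column side consists of minors with row indices
  below \<open>m\<close> and column indices below \<open>n + 1\<close>, hence lies in
  \<open>K\<close>. On the row side \<open>S = U\<close> gives the wanted minor; every other
  \<open>S\<close> gives two equal rows or fewer than \<open>k\<close> extremal rows, which is
  covered by induction on \<open>k\<close>.\<close>

lemma hgen_step:
  assumes K: "ideal K R" and gen: "hgen w t m (Suc n) \<subseteq> K" and tm: "t \<le> m"
  shows "hgen w t (Suc m) n \<subseteq> K"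
proof -
  \<comment> \<open>The \<open>i\<close>-th entry of an increasing sequence of length
    \<open>t\<close> with values below \<open>m + 1\<close> is at most \<open>d + i\<close>.\<close>
  define d where "d = Suc m - t"
  have d: "d \<ge> 1" "d + t = Suc m" using tm by (auto simp: d_def)
  have zeroK: "0 \<in> K" using K by (simp add: ideal_iff)
  have genK: "hdet w t a b \<in> K" if "\<forall>i<t. a i < m" "\<forall>k<t. b k < Suc n" for a b
    using gen that unfolding hgen_def by blast
  have main: "hdet w t a b \<in> K"
    if "incr t a" "\<forall>i<t. a i \<le> d + i" "\<forall>k<t. b k < n" "card {i. i < t \<and> a i = d + i} = k" for k a b
    using that
  proof (induction k arbitrary: a rule: less_induct)
    case (less k)
    note a = less.prems(1,2)
    define U where "U = {i. i < t \<and> a i = d + i}"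
    have cU: "card U = k" and finU: "finite U" using less.prems by (auto simp: U_def)
    have up: "j \<in> {i. i < t \<and> e i = d + i}"
      if "incr t e" "\<forall>i<t. e i \<le> d + i" "i \<in> {i. i < t \<and> e i = d + i}" "i < j" "j < t" for e i j
    proof -
      have "d + j \<le> e j" using incr_gap[OF that(1), of i "j - i"] that by auto
      then show ?thesis using that(2,5) by (auto intro: antisym)
    qed
    define a' where "a' = (\<lambda>i. a i - of_bool (i \<in> U))"
    have a'_le: "Suc (a' i) \<le> d + i" if "i < t" for i
      using a(2) that d by (auto simp: a'_def U_def le_less)
    have a'_incr: "incr t a'"
      unfolding incr_def
    proof (intro allI impI)
      fix i j assume ij: "i < j" "j < t"
      show "a' i < a' j"
      proof (cases "j \<in> U")
        case True
        then have "a' j = d + j - 1" by (simp add: a'_def U_def)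
        then show ?thesis using a'_le[of i] ij d by linarith
      next
        case False
        then have "i \<notin> U" using up[OF a, of i j] ij by (auto simp: U_def)
        then show ?thesis using False a(1) ij by (simp add: a'_def incr_def)
      qed
    qed
    let ?F = "{S. S \<subseteq> {0..<t} \<and> card S = k}"
    have fin: "finite ?F" by (rule finite_subset[of _ "Pow {0..<t}"]) auto
    have UF: "U \<in> ?F" using cU by (auto simp: U_def)
    have other: "hdet w t (\<lambda>i. a' i + of_bool (i \<in> S)) b \<in> K" if S: "S \<in> ?F - {U}" for S
    proof -
      define e where "e = (\<lambda>i. a' i + of_bool (i \<in> S))"
      have e_le: "\<forall>i<t. e i \<le> d + i"
      proof (intro allI impI)
        fix i assume "i < t"
        then show "e i \<le> d + i" using a'_le[of i] by (cases "i \<in> S") (simp_all add: e_def)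
      qed
      have finS: "finite S" using S by (auto intro: finite_subset)
      show ?thesis
      proof (cases "incr t e")
        case True
        let ?V = "{i. i < t \<and> e i = d + i}"
        have VS: "?V \<subseteq> S"
        proof
          fix i assume "i \<in> ?V"
          then show "i \<in> S" using a'_le[of i] by (cases "i \<in> S") (simp_all add: e_def)
        qed
        have "?V \<noteq> S"
        proof
          assume VS: "?V = S"
          \<comment> \<open>The extremal positions of an increasing sequence form a final segment,
            so \<open>?V\<close> and \<open>U\<close> are comparable; having the same size they
            would coincide, against \<open>S \<noteq> U\<close>.\<close>
          have "S \<subseteq> U \<or> U \<subseteq> S"
          proof (rule ccontr)
            assume "\<not> (S \<subseteq> U \<or> U \<subseteq> S)"
            then obtain x y where xy: "x \<in> S" "x \<notin> U" "y \<in> U" "y \<notin> S" by blast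
            then have "x < t" "y < t" using S by (auto simp: U_def)
            have "x \<in> ?V" "y \<notin> ?V" "y \<in> {i. i < t \<and> a i = d + i}" "x \<notin> {i. i < t \<and> a i = d + i}"
              unfolding VS using xy unfolding U_def by simp_all
            then have "\<not> x < y" "\<not> y < x" "x \<noteq> y"
              using up[OF True e_le, of x y] up[OF a, of y x] \<open>x < t\<close> \<open>y < t\<close> by blast+
            then show False by simp
          qed
          moreover have "card S = card U" "S \<noteq> U" using S cU by simp_all
          ultimately show False using card_subset_eq[OF finU] card_subset_eq[OF finS] by metis
        qed
        then have "card ?V < k" using VS S finS psubset_card_mono[of S ?V] by auto
        then show ?thesis
          using less.IH[OF _ True e_le less.prems(3) refl] unfolding e_def by blast
      next
        case False
        then obtain i j where ij: "i < j" "j < t" "\<not> e i < e j" by (auto simp: incr_def)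
        have "a' i < a' j" using a'_incr ij by (auto simp: incr_def)
        then have "e i = e j" using ij(3) by (cases "i \<in> S"; cases "j \<in> S") (auto simp: e_def)
        then have "hdet w t e b = 0"
          using ij by (intro fdet_identical_rows[of i t j]) auto
        then show ?thesis using zeroK by (simp add: e_def)
      qed
    qed
    have aU: "a' i + of_bool (i \<in> U) = a i" for i
      using d by (simp add: a'_def U_def)
    have "hdet w t a b + (\<Sum>S\<in>?F - {U}. hdet w t (\<lambda>i. a' i + of_bool (i \<in> S)) b) =
        (\<Sum>S\<in>?F. hdet w t (\<lambda>i. a' i + of_bool (i \<in> S)) b)"
      using sum.remove[OF fin UF, of "\<lambda>S. hdet w t (\<lambda>i. a' i + of_bool (i \<in> S)) b"]
      by (simp only: aU)
    also have "\<dots> = (\<Sum>S\<in>?F. hdet w t a' (\<lambda>i. b i + of_bool (i \<in> S)))"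
      by (rule hdet_shift)
    finally have eq: "hdet w t a b = (\<Sum>S\<in>?F. hdet w t a' (\<lambda>i. b i + of_bool (i \<in> S))) -
        (\<Sum>S\<in>?F - {U}. hdet w t (\<lambda>i. a' i + of_bool (i \<in> S)) b)"
      by (simp add: algebra_simps)
    show ?case
      unfolding eq
    proof (intro ideal_diff[OF K] ideal_sum[OF K] other)
      fix S
      have "\<forall>i<t. a' i < m" using a'_le d by fastforce
      moreover have "\<forall>k<t. b k + of_bool (k \<in> S) < Suc n" using less.prems(3) by auto
      ultimately show "hdet w t a' (\<lambda>i. b i + of_bool (i \<in> S)) \<in> K" by (rule genK)
    qed
  qed
  show ?thesis
  proof
    fix x assume "x \<in> hgen w t (Suc m) n"
    then obtain a b where ab: "\<forall>i<t. a i < Suc m" "\<forall>k<t. b k < n" "x = hdet w t a b"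
      unfolding hgen_def by blast
    show "x \<in> K"
    proof (cases "inj_on a {..<t}")
      case True
      obtain s and e :: nat where s: "\<forall>i j. i < j \<longrightarrow> j < t \<longrightarrow> s i < s j" "\<forall>i<t. s i \<in> a ` {..<t}"
          "\<forall>f :: nat \<Rightarrow> nat \<Rightarrow> 'a. fdet t (\<lambda>i k. f (a i) k) = (- 1) ^ e * fdet t (\<lambda>i k. f (s i) k)"
        using fdet_sort[OF True] by blast
      have inc: "incr t s" using s(1) by (simp only: incr_def)
      have "s i \<le> d + i" if "i < t" for i
      proof -
        have "s i + (t - 1 - i) \<le> s (t - 1)" using incr_gap[OF inc, of i "t - 1 - i"] that by auto
        moreover have "s (t - 1) < Suc m" using s(2)[rule_format, of "t - 1"] that ab(1) by auto
        ultimately show ?thesis using d that by linarith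
      qed
      then have "hdet w t s b \<in> K" using main[OF inc _ ab(2) refl] by blast
      then have "(- 1) ^ e * hdet w t s b \<in> K" using ideal_mult_left[OF K] by simp
      moreover have "x = (- 1) ^ e * hdet w t s b"
        unfolding ab(3) by (rule s(3)[rule_format, of "\<lambda>a k. w (a + b k)"])
      ultimately show ?thesis by simp
    next
      case False
      then obtain i j where "i < t" "j < t" "i \<noteq> j" "a i = a j" by (auto simp: inj_on_def)
      then have "x = 0" unfolding ab(3) by (intro fdet_identical_rows[of i t j]) auto
      then show ?thesis using zeroK by simp
    qed
  qed
qed

lemma hgen_shift_ideal:
  assumes K: "ideal K R" and gen: "hgen w t t (n + d) \<subseteq> K"
  shows "hgen w t (t + d) n \<subseteq> K"
  using gen
proof (induction d arbitrary: n)
  case (Suc d)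
  then have "hgen w t (t + d) (Suc n) \<subseteq> K" by simp
  then show ?case using hgen_step[OF K] by simp
qed simp

text \<open>\<open>hgen_step\<close> applied to the transposed matrix, where
  \<open>t \<le> n\<close> is its size condition.\<close>

lemma hgen_unshift_ideal:
  assumes K: "ideal K R" and gen: "hgen w t (t + d) n \<subseteq> K" and n: "t \<le> n"
  shows "hgen w t t (n + d) \<subseteq> K"
  using gen n
proof (induction d arbitrary: n)
  case (Suc d)
  have "hgen w t n (Suc (t + d)) \<subseteq> K" using Suc.prems hgen_swap[of w t n] by simp
  then have "hgen w t (Suc n) (t + d) \<subseteq> K" using hgen_step[OF K] Suc.prems by blast
  then have "hgen w t (t + d) (Suc n) \<subseteq> K" using hgen_swap[of w t "Suc n"] by simp
  then show ?case using Suc.IH[of "Suc n"] Suc.prems by simp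
qed simp

end


section \<open>Linear recurrences\<close>

fun recseq :: "nat \<Rightarrow> (nat \<Rightarrow> 'a::comm_ring_1) \<Rightarrow> (nat \<Rightarrow> 'a) \<Rightarrow> nat \<Rightarrow> 'a" where
  "recseq q u l n = (if n < q then u n else (\<Sum>k<q. l k * recseq q u l (n - q + k)))"

declare recseq.simps [simp del]

lemma recseq_init: "n < q \<Longrightarrow> recseq q u l n = u n"
  by (subst recseq.simps) simp

lemma recseq_rec: "recseq q u l (n + q) = (\<Sum>k<q. l k * recseq q u l (n + k))"
  by (subst recseq.simps) simp

lemma recseq_unique:
  assumes "\<And>n. n + q < c \<Longrightarrow> v (n + q) = (\<Sum>k<q. l k * v (n + k))"
  shows "n < c \<Longrightarrow> recseq q v l n = v n"
proof (induction n rule: less_induct)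
  case (less n)
  show ?case
  proof (cases "n < q")
    case False
    then obtain m where m: "n = m + q" by (metis add.commute le_Suc_ex not_less)
    have "recseq q v l n = (\<Sum>k<q. l k * v (m + k))"
      unfolding m recseq_rec by (intro sum.cong refl) (use less m in simp)
    then show ?thesis using assms[of m] less.prems m by simp
  qed (simp add: recseq_init)
qed

lemma recseq_hom:
  assumes "comm_ring_hom h"
  shows "h (recseq q u l n) = recseq q (\<lambda>i. h (u i)) (\<lambda>i. h (l i)) n"
proof (induction n rule: less_induct)
  case (less n)
  interpret comm_ring_hom h by fact
  show ?case
  proof (cases "n < q")
    case False
    then obtain m where m: "n = m + q" by (metis add.commute le_Suc_ex not_less)
    have "h (recseq q u l n) = (\<Sum>k<q. h (l k) * h (recseq q u l (m + k)))"
      unfolding m recseq_rec by (simp add: hom_sum hom_mult)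
    also have "\<dots> = recseq q (\<lambda>i. h (u i)) (\<lambda>i. h (l i)) n"
      unfolding m recseq_rec by (intro sum.cong refl) (use less m in simp)
    finally show ?thesis .
  qed (simp add: recseq_init)
qed

lemma fdet_hom:
  assumes "comm_ring_hom h"
  shows "h (fdet n f) = fdet n (\<lambda>i k. h (f i k))"
proof -
  interpret comm_ring_hom h by fact
  show ?thesis by (simp add: fdet_leibniz hom_sum hom_mult hom_prod hom_of_int)
qed

text \<open>The recurrence is a relation between the \<open>q + 1\<close> rows in which the last row
  has coefficient 1, so the adjugate identity kills the determinant itself.\<close>

lemma hdet_recseq_eq_0: "fdet (Suc q) (\<lambda>i k. recseq q u l (i + b k)) = 0"
proof -
  let ?v = "recseq q u l"
  define \<mu> where "\<mu> = (\<lambda>i. if i = q then 1 else - l i)"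
  have zero: "(\<Sum>i<Suc q. \<mu> i * ?v (i + \<beta>)) = 0" for \<beta>
  proof -
    have "(\<Sum>i<Suc q. \<mu> i * ?v (i + \<beta>)) = (\<Sum>i<q. - (l i * ?v (\<beta> + i))) + ?v (\<beta> + q)"
      by (simp add: \<mu>_def add.commute)
    then show ?thesis by (simp add: recseq_rec sum_negf)
  qed
  obtain c where "\<And>\<mu>. \<mu> q * fdet (Suc q) (\<lambda>i k. ?v (i + b k)) =
      (\<Sum>k<Suc q. (\<Sum>i<Suc q. \<mu> i * ?v (i + b k)) * c k)"
    by (rule fdet_adjugate[of q "Suc q" "\<lambda>i k. ?v (i + b k)"]) (simp, blast)
  from this[of \<mu>] have "\<mu> q * fdet (Suc q) (\<lambda>i k. ?v (i + b k)) = 0"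
    unfolding zero by simp
  then show ?thesis by (simp add: \<mu>_def)
qed

text \<open>The Hankel minors of the \<open>q\<close>-periodic sequence with one nonzero entry per period are
  determinants of permutation matrices.\<close>

lemma hdet_periodic_neq_0:
  "hdet (recseq q (\<lambda>i. of_bool (i = q - 1)) (\<lambda>i. of_bool (i = 0)) :: nat \<Rightarrow> 'a::idom) q
    (\<lambda>i. m + i) (\<lambda>i. i) \<noteq> 0"
proof (cases q)
  case (Suc r)
  define v where "v = (recseq q (\<lambda>i. of_bool (i = q - 1)) (\<lambda>i. of_bool (i = 0)) :: nat \<Rightarrow> 'a)"
  have q0: "0 < q" using Suc by simp
  have v: "v n = of_bool (n mod q = r)" for n
  proof (induction n rule: less_induct)
    case (less n)
    show ?case
    proof (cases "n < q")
      case True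
      then show ?thesis using Suc by (simp add: v_def recseq_init)
    next
      case False
      then obtain m where m: "n = m + q" by (metis add.commute le_Suc_ex not_less)
      have "v n = (\<Sum>k<q. if k = 0 then v m else 0)"
        unfolding m v_def recseq_rec by (intro sum.cong) auto
      also have "\<dots> = v m" using q0 by simp
      finally have "v n = v m" .
      moreover have "n mod q = m mod q" by (simp add: m)
      ultimately show ?thesis using less[of m] m Suc by simp
    qed
  qed
  have cancel: "a = b" if eq: "(y + a) mod q = (y + b) mod q" and lt: "a < q" "b < q" for y a b :: nat
  proof -
    have le: "a = b" if "(y + a) mod q = (y + b) mod q" "a \<le> b" "b < q" for a b
    proof -
      have "q dvd (y + b) - (y + a)"
        using that mod_eq_dvd_iff_nat[of "y + a" "y + b" q] by simp
      then have "q dvd b - a" by simp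
      then have "\<not> 0 < b - a" using dvd_imp_le[of q "b - a"] \<open>b < q\<close> by linarith
      then show ?thesis using \<open>a \<le> b\<close> by simp
    qed
    show ?thesis using le[of a b] le[of b a] eq lt by (cases "a \<le> b") auto
  qed
  \<comment> \<open>The matrix is symmetric, so orthonormality of its rows says that its square is
    the identity, and its determinant squares to 1.\<close>
  have key: "(\<Sum>k<q. v (m + i + k) * v (m + k + j)) = of_bool (i = j)" if ij: "i < q" "j < q" for i j
  proof -
    \<comment> \<open>As \<open>r = q - 1\<close> is -1 modulo \<open>q\<close>, this is
      \<open>r - (m + i)\<close> modulo \<open>q\<close> written without subtraction: the column of
      the single 1 in row \<open>i\<close>.\<close>
    define x where "x = (r + r * (m + i)) mod q"
    have "(m + i + x) mod q = (m + i + (r + r * (m + i))) mod q"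
      by (simp add: x_def mod_add_right_eq)
    also have "m + i + (r + r * (m + i)) = r + q * (m + i)" using Suc by (simp add: algebra_simps)
    also have "(r + q * (m + i)) mod q = r" using Suc by (simp only: mod_mult_self2) simp
    finally have x: "(m + i + x) mod q = r" .
    have xq: "x < q" using Suc by (simp add: x_def)
    have "v (m + i + k) * v (m + k + j) = (if k = x then of_bool (i = j) else 0)" if k: "k < q" for k
    proof (cases "k = x")
      case True
      have "(m + x + j) mod q = r \<longleftrightarrow> i = j"
      proof
        assume "(m + x + j) mod q = r"
        then have "(m + x + i) mod q = (m + x + j) mod q" using x by (simp add: add_ac)
        then show "i = j" by (rule cancel) (use ij in auto)
      qed (use x in \<open>simp add: add_ac\<close>)
      then show ?thesis using True x by (simp add: v)
    next
      case False
      have "(m + i + k) mod q \<noteq> r"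
      proof
        assume "(m + i + k) mod q = r"
        then have "(m + i + k) mod q = (m + i + x) mod q" using x by simp
        then have "k = x" by (rule cancel) (use xq k in simp_all)
        then show False using False by simp
      qed
      then show ?thesis using False by (simp add: v)
    qed
    then have "(\<Sum>k<q. v (m + i + k) * v (m + k + j)) = (\<Sum>k<q. if k = x then of_bool (i = j) else 0)"
      by (intro sum.cong refl) simp
    then show ?thesis using xq by simp
  qed
  let ?A = "mat q q (\<lambda>(i, k). v (m + i + k))"
  have "?A * ?A = 1\<^sub>m q"
  proof (rule eq_matI)
    fix i j assume "i < dim_row (1\<^sub>m q :: 'a mat)" "j < dim_col (1\<^sub>m q :: 'a mat)"
    then have ij: "i < q" "j < q" by auto
    have "(?A * ?A) $$ (i, j) = (\<Sum>k<q. v (m + i + k) * v (m + k + j))"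
      using ij by (simp add: scalar_prod_def atLeast0LessThan)
    then show "(?A * ?A) $$ (i, j) = 1\<^sub>m q $$ (i, j)"
      using ij unfolding key[OF ij] by simp
  qed auto
  then have "det ?A * det ?A = 1"
    by (metis det_mult det_one mat_carrier)
  then show ?thesis unfolding fdet_def v_def[symmetric] by auto
qed simp

section \<open>Bordered minors and rank arguments modulo an ideal\<close>

context type_subring
begin

lemma ideal_power_prod:
  assumes I: "ideal I R" and "finite A" "\<And>i. i \<in> A \<Longrightarrow> g i \<in> I"
  shows "prod g A \<in> ideal_power I (card A)"
  using assms(2,3)
proof (induction A rule: finite_induct)
  case (insert x A)
  then have "prod g A * g x \<in> ideal_power I (Suc (card A))"
    by (intro ideal_power_Suc_mult) auto
  then show ?case using insert by (simp add: mult.commute)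
qed simp

text \<open>Every term of the Leibniz expansion takes one factor from each of the
  \<open>s - q\<close> rows whose entries lie in \<open>I\<close>.\<close>

lemma fdet_rows_in_ideal:
  assumes I: "ideal I R" and C: "\<And>i k. h i k \<in> C" and "q \<le> s"
    and h: "\<And>i k. q \<le> i \<Longrightarrow> i < s \<Longrightarrow> k < s \<Longrightarrow> h i k \<in> I"
  shows "fdet s h \<in> ideal_power I (s - q)"
  unfolding fdet_leibniz
proof (intro ideal_sum[OF ideal_ideal_power[OF I]] ideal_mult_left[OF ideal_ideal_power[OF I]] of_int_closed)
  fix \<sigma> assume "\<sigma> \<in> {\<sigma>. \<sigma> permutes {0..<s}}"
  then have \<sigma>: "\<sigma> permutes {0..<s}" by simp
  have "{0..<s} = {0..<q} \<union> {q..<s}" "{0..<q} \<inter> {q..<s} = {}" using assms(3) by auto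
  then have eq: "(\<Prod>i=0..<s. h i (\<sigma> i)) = (\<Prod>i=0..<q. h i (\<sigma> i)) * (\<Prod>i=q..<s. h i (\<sigma> i))"
    by (metis finite_atLeastLessThan prod.union_disjoint)
  have "(\<Prod>i=q..<s. h i (\<sigma> i)) \<in> ideal_power I (card {q..<s})"
    using permutes_in_image[OF \<sigma>] by (intro ideal_power_prod[OF I] h) auto
  then show "(\<Prod>i=0..<s. h i (\<sigma> i)) \<in> ideal_power I (s - q)"
    unfolding eq by (intro ideal_mult_left[OF ideal_ideal_power[OF I]] prod_closed C) simp
qed

text \<open>After the rows below the leading \<open>q \<times> q\<close> block are replaced by their combinations with
  cofactor coefficients, their entries are bordered minors; this multiplies the determinant by
  a power of the leading minor.\<close>

lemma leading_minor_power_mult: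
  assumes I: "ideal I R" and C: "\<And>i k. f i k \<in> C" and qs: "q \<le> s"
    and b: "\<And>i \<beta>. q \<le> i \<Longrightarrow> i < s \<Longrightarrow> \<beta> < s \<Longrightarrow>
      fdet (Suc q) (\<lambda>x y. f (if x = q then i else x) (if y = q then \<beta> else y)) \<in> I"
  shows "fdet q f ^ (s - q) * fdet s f \<in> ideal_power I (s - q)"
proof -
  let ?D = "fdet q f"
  have "\<exists>l. (\<forall>g. fdet (Suc q) (\<lambda>x y. if y = q then g x else f (if x = q then i else x) y) =
      (\<Sum>x<Suc q. l x * g x)) \<and> l q = ?D \<and> (\<forall>x<Suc q. l x \<in> C)" for i
  proof -
    obtain l where l: "\<And>g. fdet (Suc q) (\<lambda>x y. if y = q then g x else f (if x = q then i else x) y) =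
          (\<Sum>x<Suc q. l x * g x)"
        "l q = fdet q (\<lambda>x y. f (if x = q then i else x) y)"
        "\<And>x. x < Suc q \<Longrightarrow> \<exists>g e. l x = (- 1) ^ e * fdet q g \<and>
          (\<forall>i' k. \<exists>x' k'. g i' k = f (if x' = q then i else x') k')"
      by (rule fdet_last_col[of q "\<lambda>x y. f (if x = q then i else x) y"]) blast
    have "l x \<in> C" if x: "x < Suc q" for x
    proof -
      obtain g e where g: "l x = (- 1) ^ e * fdet q g"
          "\<forall>i' k. \<exists>x' k'. g i' k = f (if x' = q then i else x') k'"
        using l(3)[OF x] by blast
      have "g i' k \<in> C" for i' k using g(2) C by metis
      then show ?thesis unfolding g(1) by (intro mult_closed minus_one_power_closed fdet_closed)
    qed
    moreover have "l q = ?D" unfolding l(2) by (rule fdet_cong) simp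
    ultimately show ?thesis using l(1) by blast
  qed
  then obtain l where l: "\<And>i g. fdet (Suc q) (\<lambda>x y. if y = q then g x else f (if x = q then i else x) y) =
      (\<Sum>x<Suc q. l i x * g x)" "\<And>i. l i q = ?D" "\<And>i x. x < Suc q \<Longrightarrow> l i x \<in> C"
    by metis
  define \<Lambda> where "\<Lambda> = (\<lambda>i x. if i < q then of_bool (x = i) else
    if x < q then l i x else if x = i then ?D else 0)"
  have \<Lambda>C: "\<Lambda> i x \<in> C" for i x
    using l(3)[of x i] fdet_closed[of f q] C by (auto simp: \<Lambda>_def)
  define h where "h = (\<lambda>i \<beta>. \<Sum>x<s. \<Lambda> i x * f x \<beta>)"
  let ?L = "mat s s (\<lambda>(i, x). \<Lambda> i x)" and ?A = "mat s s (\<lambda>(i, k). f i k)"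
  have "?L * ?A = mat s s (\<lambda>(i, k). h i k)"
    by (rule eq_matI) (auto simp: scalar_prod_def h_def atLeast0LessThan)
  then have "fdet s h = det ?L * fdet s f"
    unfolding fdet_def using det_mult[of ?L s ?A] by simp
  also have "det ?L = ?D ^ (s - q)"
  proof -
    have "det ?L = prod_list (diag_mat ?L)"
      by (rule det_lower_triangular[of s]) (auto simp: \<Lambda>_def)
    also have "\<dots> = (\<Prod>i=0..<s. if i < q then 1 else ?D)"
      unfolding prod_list_diag_prod by (intro prod.cong) (auto simp: \<Lambda>_def)
    also have "\<dots> = (\<Prod>i\<in>{q..<s}. ?D)"
      by (rule prod.mono_neutral_cong_right) auto
    finally show ?thesis by simp
  qed
  finally have eq: "?D ^ (s - q) * fdet s f = fdet s h" ..
  show ?thesis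
    unfolding eq
  proof (rule fdet_rows_in_ideal[OF I _ qs])
    show "h i k \<in> C" for i k unfolding h_def by (intro sum_closed mult_closed \<Lambda>C C)
    fix i \<beta> assume i: "q \<le> i" "i < s" and \<beta>: "\<beta> < s"
    have "h i \<beta> = (\<Sum>x\<in>insert i {..<q}. \<Lambda> i x * f x \<beta>)"
      unfolding h_def using i by (intro sum.mono_neutral_right) (auto simp: \<Lambda>_def)
    also have "\<dots> = (\<Sum>x<q. l i x * f x \<beta>) + ?D * f i \<beta>"
      using i by (simp add: \<Lambda>_def)
    also have "\<dots> = (\<Sum>x<Suc q. l i x * f (if x = q then i else x) \<beta>)"
      by (simp add: l(2))
    also have "\<dots> = fdet (Suc q) (\<lambda>x y. if y = q then f (if x = q then i else x) \<beta>
        else f (if x = q then i else x) y)"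
      by (rule l(1)[symmetric])
    also have "\<dots> = fdet (Suc q) (\<lambda>x y. f (if x = q then i else x) (if y = q then \<beta> else y))"
      by (rule fdet_cong) simp
    finally show "h i \<beta> \<in> I" using b[OF i \<beta>] by simp
  qed
qed

text \<open>The cofactors \<open>l\<close> of the border column combine the rows into bordered
  minors, which lie in \<open>K\<close>, and \<open>l q\<close> is the leading minor; the adjugate
  identity for \<open>\<mu> = l\<close> carries this over to any choice of columns.\<close>

lemma leading_minor_mult:
  assumes K: "ideal K R" and C: "\<And>i k. f i k \<in> C"
    and g: "\<And>\<beta>. \<beta> \<in> B \<Longrightarrow> fdet (Suc q) (\<lambda>i k. if k = q then f i \<beta> else f i k) \<in> K"
    and b: "\<And>k. k < Suc q \<Longrightarrow> b k \<in> B"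
  shows "fdet q f * fdet (Suc q) (\<lambda>i k. f i (b k)) \<in> K"
proof -
  obtain l where l: "\<And>g. fdet (Suc q) (\<lambda>i k. if k = q then g i else f i k) = (\<Sum>i<Suc q. l i * g i)"
      "l q = fdet q f"
    by (rule fdet_last_col[of q f]) blast
  obtain c where c: "\<And>\<mu>. \<mu> q * fdet (Suc q) (\<lambda>i k. f i (b k)) =
        (\<Sum>k<Suc q. (\<Sum>i<Suc q. \<mu> i * f i (b k)) * c k)"
      "\<And>k. k < Suc q \<Longrightarrow> \<exists>g e. c k = (- 1) ^ e * fdet (Suc q - 1) g \<and> (\<forall>i k'. \<exists>i' k''. g i k' = f i' (b k''))"
    by (rule fdet_adjugate[of q "Suc q" "\<lambda>i k. f i (b k)"]) (simp, blast)
  have cC: "c k \<in> C" if k: "k < Suc q" for k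
  proof -
    obtain g e where ge: "c k = (- 1) ^ e * fdet (Suc q - 1) g" "\<forall>i k'. \<exists>i' k''. g i k' = f i' (b k'')"
      using c(2)[OF k] by blast
    have "g i k' \<in> C" for i k' using ge(2) C by metis
    then show ?thesis unfolding ge(1) by (intro mult_closed minus_one_power_closed fdet_closed)
  qed
  have "fdet q f * fdet (Suc q) (\<lambda>i k. f i (b k)) = (\<Sum>k<Suc q. (\<Sum>i<Suc q. l i * f i (b k)) * c k)"
    using c(1)[of l] l(2) by simp
  also have "\<dots> \<in> K"
  proof (rule ideal_sum[OF K], rule ideal_mult_right[OF K])
    fix k assume k: "k \<in> {..<Suc q}"
    show "(\<Sum>i<Suc q. l i * f i (b k)) \<in> K" unfolding l(1)[symmetric] using g b k by simp
    show "c k \<in> C" using cC k by simp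
  qed
  finally show ?thesis .
qed

text \<open>Linear dependence of rows over the fraction field of \<open>R / P\<close>, with
  coefficients in \<open>R\<close>. If some minor of the first \<open>q\<close> rows is not in
  \<open>P\<close>, its bordering cofactors give the relation; otherwise these rows are already
  dependent and the last coefficient is 0.\<close>

lemma null_vector:
  assumes P: "primeideal P R" and C: "\<And>i k. f i k \<in> C"
    and "\<And>b. (\<forall>k<t. b k \<in> B) \<Longrightarrow> fdet t (\<lambda>i k. f i (b k)) \<in> P"
  shows "\<exists>l. (\<forall>i. l i \<in> C) \<and> (\<exists>i<t. l i \<notin> P) \<and> (\<forall>\<beta>\<in>B. (\<Sum>i<t. l i * f i \<beta>) \<in> P)"
  using assms(3)
proof (induction t)
  case 0
  then show ?case using P by (simp add: primeideal_iff)
next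
  case (Suc q)
  show ?case
  proof (cases "\<forall>b. (\<forall>k<q. b k \<in> B) \<longrightarrow> fdet q (\<lambda>i k. f i (b k)) \<in> P")
    case True
    then obtain l where l: "\<forall>i. l i \<in> C" "\<exists>i<q. l i \<notin> P" "\<forall>\<beta>\<in>B. (\<Sum>i<q. l i * f i \<beta>) \<in> P"
      using Suc.IH by blast
    have "(\<Sum>i<Suc q. (l(q := 0)) i * f i \<beta>) = (\<Sum>i<q. l i * f i \<beta>)" for \<beta>
      by (auto intro!: sum.cong)
    moreover have "\<exists>i<Suc q. (l(q := 0)) i \<notin> P"
    proof -
      obtain i where "i < q" "l i \<notin> P" using l(2) by blast
      then show ?thesis by (intro exI[of _ i]) auto
    qed
    moreover have "\<forall>i. (l(q := 0)) i \<in> C" using l(1) by simp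
    ultimately show ?thesis using l(3) by (intro exI[of _ "l(q := 0)"]) simp
  next
    case False
    then obtain b where b: "\<forall>k<q. b k \<in> B" "fdet q (\<lambda>i k. f i (b k)) \<notin> P" by blast
    obtain l where l: "\<And>g. fdet (Suc q) (\<lambda>i k. if k = q then g i else f i (b k)) = (\<Sum>i<Suc q. l i * g i)"
        "l q = fdet q (\<lambda>i k. f i (b k))"
        "\<And>i. i < Suc q \<Longrightarrow> \<exists>g e. l i = (- 1) ^ e * fdet q g \<and> (\<forall>i k. \<exists>i' k'. g i k = f i' (b k'))"
      by (rule fdet_last_col[of q "\<lambda>i k. f i (b k)"]) blast
    have lC: "l i \<in> C" if i: "i < Suc q" for i
    proof -
      obtain g e where ge: "l i = (- 1) ^ e * fdet q g" "\<forall>i k. \<exists>i' k'. g i k = f i' (b k')"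
        using l(3)[OF i] by blast
      have "g i k' \<in> C" for i k' using ge(2) C by metis
      then show ?thesis unfolding ge(1) by (intro mult_closed minus_one_power_closed fdet_closed)
    qed
    define l' where "l' = (\<lambda>i. if i < Suc q then l i else 0)"
    have "(\<Sum>i<Suc q. l' i * f i \<beta>) \<in> P" if "\<beta> \<in> B" for \<beta>
    proof -
      have "(\<Sum>i<Suc q. l' i * f i \<beta>) = (\<Sum>i<Suc q. l i * f i \<beta>)"
        by (intro sum.cong) (auto simp: l'_def)
      also have "\<dots> = fdet (Suc q) (\<lambda>i k. if k = q then f i \<beta> else f i (b k))"
        by (rule l(1)[symmetric])
      also have "\<dots> = fdet (Suc q) (\<lambda>i k. f i ((b(q := \<beta>)) k))"
        by (rule fdet_cong) simp
      also have "\<dots> \<in> P" by (rule Suc.prems) (use b(1) that in auto)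
      finally show ?thesis .
    qed
    moreover have "\<forall>i. l' i \<in> C" using lC by (simp add: l'_def)
    moreover have "l' q \<notin> P" using b(2) l(2) by (simp add: l'_def)
    ultimately show ?thesis by blast
  qed
qed

end


section \<open>Polynomials\<close>

definition mono_eval :: "(nat \<Rightarrow> 'b::comm_semiring_1) \<Rightarrow> (nat \<Rightarrow>\<^sub>0 nat) \<Rightarrow> 'b" where
  "mono_eval x m = (\<Prod>i\<in>Poly_Mapping.keys m. x i ^ Poly_Mapping.lookup m i)"

text \<open>Additive extension of a map on single terms; both the evaluation maps and the trace have
  this form.\<close>

definition mp_ext :: "('m \<Rightarrow> 'k::zero \<Rightarrow> 'b::comm_monoid_add) \<Rightarrow> ('m \<Rightarrow>\<^sub>0 'k) \<Rightarrow> 'b" where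
  "mp_ext g f = (\<Sum>m\<in>Poly_Mapping.keys f. g m (Poly_Mapping.lookup f m))"

definition mp_eval :: "('k::field \<Rightarrow> 'b::comm_ring_1) \<Rightarrow> (nat \<Rightarrow> 'b) \<Rightarrow> 'k mpol \<Rightarrow> 'b" where
  "mp_eval \<kappa> x = mp_ext (\<lambda>m a. \<kappa> a * mono_eval x m)"

abbreviation mp_const :: "'k::field \<Rightarrow> 'k mpol" where
  "mp_const a \<equiv> Poly_Mapping.single 0 a"

lemma mono_eval_superset:
  "finite A \<Longrightarrow> Poly_Mapping.keys m \<subseteq> A \<Longrightarrow> mono_eval x m = (\<Prod>i\<in>A. x i ^ Poly_Mapping.lookup m i)"
  unfolding mono_eval_def by (intro prod.mono_neutral_left) (auto simp: in_keys_iff)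

lemma mono_eval_add: "mono_eval x (m + n) = mono_eval x m * mono_eval x n"
proof -
  let ?A = "Poly_Mapping.keys m \<union> Poly_Mapping.keys n"
  have "mono_eval x (m + n) = (\<Prod>i\<in>?A. x i ^ Poly_Mapping.lookup (m + n) i)"
    by (rule mono_eval_superset) (auto dest: subsetD[OF Poly_Mapping.keys_add])
  also have "\<dots> = (\<Prod>i\<in>?A. x i ^ Poly_Mapping.lookup m i) * (\<Prod>i\<in>?A. x i ^ Poly_Mapping.lookup n i)"
    by (simp add: Poly_Mapping.lookup_add power_add prod.distrib)
  also have "\<dots> = mono_eval x m * mono_eval x n"
    by (simp add: mono_eval_superset[of ?A, symmetric])
  finally show ?thesis .
qed

lemma mono_eval_0 [simp]: "mono_eval x 0 = 1"
  by (simp add: mono_eval_def)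

lemma mp_ext_superset:
  assumes "\<And>m. g m 0 = 0" "finite A" "Poly_Mapping.keys f \<subseteq> A"
  shows "mp_ext g f = (\<Sum>m\<in>A. g m (Poly_Mapping.lookup f m))"
  unfolding mp_ext_def using assms by (intro sum.mono_neutral_left) (auto simp: in_keys_iff)

lemma mp_ext_0 [simp]: "mp_ext g 0 = 0"
  by (simp add: mp_ext_def)

lemma mp_ext_single: "(\<And>m. g m 0 = 0) \<Longrightarrow> mp_ext g (Poly_Mapping.single m a) = g m a"
  by (cases "a = 0") (simp_all add: mp_ext_def)

lemma mp_ext_add:
  assumes "\<And>m. g m 0 = 0" "\<And>m a b. g m (a + b) = g m a + g m b"
  shows "mp_ext g (f1 + f2) = mp_ext g f1 + mp_ext g f2"
proof -
  let ?A = "Poly_Mapping.keys f1 \<union> Poly_Mapping.keys f2"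
  have "mp_ext g (f1 + f2) = (\<Sum>m\<in>?A. g m (Poly_Mapping.lookup (f1 + f2) m))"
    by (rule mp_ext_superset[where g = g, OF assms(1)]) (auto dest: subsetD[OF Poly_Mapping.keys_add])
  also have "\<dots> = (\<Sum>m\<in>?A. g m (Poly_Mapping.lookup f1 m)) + (\<Sum>m\<in>?A. g m (Poly_Mapping.lookup f2 m))"
    by (simp add: Poly_Mapping.lookup_add assms(2) sum.distrib)
  also have "\<dots> = mp_ext g f1 + mp_ext g f2"
    using mp_ext_superset[where g = g, OF assms(1), of ?A f1]
      mp_ext_superset[where g = g, OF assms(1), of ?A f2] by simp
  finally show ?thesis .
qed

lemma poly_mapping_expansion:
  fixes f :: "'m \<Rightarrow>\<^sub>0 'k::comm_monoid_add"
  shows "f = (\<Sum>m\<in>Poly_Mapping.keys f. Poly_Mapping.single m (Poly_Mapping.lookup f m))"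
proof (rule poly_mapping_eqI)
  fix k
  have "Poly_Mapping.lookup (\<Sum>m\<in>Poly_Mapping.keys f. Poly_Mapping.single m (Poly_Mapping.lookup f m)) k =
      (\<Sum>m\<in>Poly_Mapping.keys f. if m = k then Poly_Mapping.lookup f k else 0)"
    unfolding Poly_Mapping.lookup_sum by (intro sum.cong) (auto simp: Poly_Mapping.lookup_single)
  also have "\<dots> = Poly_Mapping.lookup f k" by (auto simp: in_keys_iff)
  finally show "Poly_Mapping.lookup f k = Poly_Mapping.lookup (\<Sum>m\<in>Poly_Mapping.keys f.
      Poly_Mapping.single m (Poly_Mapping.lookup f m)) k" ..
qed

text \<open>The case \<open>single\<close> is restricted to keys of the given \<open>f\<close>, so
  bounds on the variables or weights of \<open>f\<close> are available for each term.\<close>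

lemma poly_mapping_induct_keys:
  fixes f :: "'m \<Rightarrow>\<^sub>0 'k::comm_monoid_add"
  assumes "P 0" and single: "\<And>m a. m \<in> Poly_Mapping.keys f \<Longrightarrow> P (Poly_Mapping.single m a)"
    and add: "\<And>g h. P g \<Longrightarrow> P h \<Longrightarrow> P (g + h)"
  shows "P f"
proof -
  have "P (\<Sum>m\<in>A. Poly_Mapping.single m (Poly_Mapping.lookup f m))"
    if "finite A" "A \<subseteq> Poly_Mapping.keys f" for A
    using that by (induction A rule: finite_induct) (auto intro: assms)
  from this[OF finite_keys subset_refl] show ?thesis
    by (simp only: poly_mapping_expansion[of f, symmetric])
qed

lemma indet_power: "indet i ^ n = Poly_Mapping.single (Poly_Mapping.single i n) (1 :: 'k::field)"
  by (induction n) (simp_all add: indet_def mult_single flip: single_add)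

lemma single_eq_mono: "Poly_Mapping.single m a = mp_const a * mono_eval indet m"
proof -
  have "(\<Prod>i\<in>A. indet i ^ Poly_Mapping.lookup m i) =
      Poly_Mapping.single (\<Sum>i\<in>A. Poly_Mapping.single i (Poly_Mapping.lookup m i)) (1 :: 'a)"
    if "finite A" for A
    using that by (induction A rule: finite_induct) (simp_all add: indet_power mult_single)
  then have "mono_eval indet m = Poly_Mapping.single m (1 :: 'a)"
    unfolding mono_eval_def by (simp only: finite_keys poly_mapping_expansion[of m, symmetric])
  then show ?thesis by (simp add: mult_single)
qed

context
  fixes \<kappa> :: "'k::field \<Rightarrow> 'b::comm_ring_1"
  assumes \<kappa>: "comm_ring_hom \<kappa>"
begin

interpretation \<kappa>: comm_ring_hom \<kappa> by (rule \<kappa>)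

lemma mp_eval_single: "mp_eval \<kappa> x (Poly_Mapping.single m a) = \<kappa> a * mono_eval x m"
  unfolding mp_eval_def by (rule mp_ext_single) simp

lemma mp_eval_add: "mp_eval \<kappa> x (f + g) = mp_eval \<kappa> x f + mp_eval \<kappa> x g"
  unfolding mp_eval_def by (rule mp_ext_add) (simp_all add: \<kappa>.hom_add distrib_right)

lemma mp_eval_0 [simp]: "mp_eval \<kappa> x 0 = 0"
  by (simp add: mp_eval_def)

lemma mp_eval_mult: "mp_eval \<kappa> x (f * g) = mp_eval \<kappa> x f * mp_eval \<kappa> x g"
proof (induction f rule: poly_mapping_induct_keys)
  case (2 m a)
  show ?case
  proof (induction g rule: poly_mapping_induct_keys)
    case (2 n b)
    show ?case
      by (simp add: mult_single mp_eval_single \<kappa>.hom_mult mono_eval_add mult_ac)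
  qed (simp_all add: mp_eval_add distrib_left)
qed (simp_all add: mp_eval_add distrib_right)

lemma mp_eval_hom: "comm_ring_hom (mp_eval \<kappa> x)"
proof
  show "mp_eval \<kappa> x 1 = 1"
    using mp_eval_single[of x 0 1] by simp
qed (simp_all add: mp_eval_add mp_eval_mult)

lemma mp_eval_indet [simp]: "mp_eval \<kappa> x (indet i) = x i"
  unfolding indet_def by (simp add: mp_eval_single mono_eval_def)

lemma mp_eval_const [simp]: "mp_eval \<kappa> x (mp_const a) = \<kappa> a"
  by (simp add: mp_eval_single)

end

definition mpoly_carrier :: "nat \<Rightarrow> 'k::field mpol set" where
  "mpoly_carrier c = {f. \<forall>m \<in> Poly_Mapping.keys f. Poly_Mapping.keys m \<subseteq> {1..c}}"

lemma mpoly_ring_eq: "mpoly_ring c = subring_algebra (mpoly_carrier c)"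
  by (simp add: mpoly_ring_def mpoly_carrier_def)

global_interpretation mp: type_subring "mpoly_carrier c :: 'k::field mpol set" for c
proof
  fix f g :: "'k mpol"
  assume f: "f \<in> mpoly_carrier c"
  have "Poly_Mapping.keys (- f) = Poly_Mapping.keys f" by (auto simp: in_keys_iff)
  then show "- f \<in> mpoly_carrier c" using f by (simp add: mpoly_carrier_def)
  assume g: "g \<in> mpoly_carrier c"
  show "f + g \<in> mpoly_carrier c"
    using f g Poly_Mapping.keys_add[of f g] by (auto simp: mpoly_carrier_def)
  show "f * g \<in> mpoly_carrier c"
    unfolding mpoly_carrier_def
  proof (intro CollectI ballI)
    fix m assume "m \<in> Poly_Mapping.keys (f * g)"
    then obtain a b where "m = a + b" "a \<in> Poly_Mapping.keys f" "b \<in> Poly_Mapping.keys g"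
      using keys_mult[of f g] by blast
    then show "Poly_Mapping.keys m \<subseteq> {1..c}"
      using f g Poly_Mapping.keys_add[of a b] unfolding mpoly_carrier_def by blast
  qed
qed (simp_all add: mpoly_carrier_def)

lemma mp_const_closed [simp]: "mp_const a \<in> mpoly_carrier c"
  by (simp add: mpoly_carrier_def)

lemma indet_closed [simp]: "1 \<le> i \<Longrightarrow> i \<le> c \<Longrightarrow> indet i \<in> mpoly_carrier c"
  by (simp add: mpoly_carrier_def indet_def)

lemma mpoly_generators_induct [consumes 1, case_names const indet add mult]:
  assumes f: "f \<in> mpoly_carrier c"
    and const: "\<And>a. P (mp_const a)" and indet: "\<And>i. 1 \<le> i \<Longrightarrow> i \<le> c \<Longrightarrow> P (indet i)"
    and add: "\<And>f g. f \<in> mpoly_carrier c \<Longrightarrow> g \<in> mpoly_carrier c \<Longrightarrow> P f \<Longrightarrow> P g \<Longrightarrow> P (f + g)"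
    and mult: "\<And>f g. f \<in> mpoly_carrier c \<Longrightarrow> g \<in> mpoly_carrier c \<Longrightarrow> P f \<Longrightarrow> P g \<Longrightarrow> P (f * g)"
  shows "P f"
proof -
  let ?P = "\<lambda>f. f \<in> mpoly_carrier c \<and> P f"
  have one: "?P 1" using const[of 1] by simp
  have pow: "?P (g ^ n)" if g: "?P g" for g n
  proof (induction n)
    case (Suc n)
    then show ?case using mult[of g "g ^ n"] g by simp
  qed (use one in simp)
  have prod: "?P (prod g A)" if g: "\<And>i. i \<in> A \<Longrightarrow> ?P (g i)" for g and A :: "nat set"
    using g
  proof (induction A rule: infinite_finite_induct)
    case (insert i A)
    then have "?P (g i)" "?P (prod g A)" by blast+
    then show ?case using mult[of "g i" "prod g A"] insert.hyps by simp
  qed (use one in simp_all)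
  have "?P f"
  proof (rule poly_mapping_induct_keys[of ?P f])
    show "?P 0" using const[of 0] by simp
    fix m a assume "m \<in> Poly_Mapping.keys f"
    then have m: "Poly_Mapping.keys m \<subseteq> {1..c}" using f by (auto simp: mpoly_carrier_def)
    have "?P (mono_eval indet m)"
      unfolding mono_eval_def
    proof (rule prod, rule pow)
      fix i assume "i \<in> Poly_Mapping.keys m"
      then have "1 \<le> i" "i \<le> c" using m by auto
      then show "?P (indet i)" using indet by simp
    qed
    then show "?P (Poly_Mapping.single m a)"
      unfolding single_eq_mono[of m a] using mult[of "mp_const a" "mono_eval indet m"] const by simp
  next
    fix g h assume "?P g" "?P h"
    then show "?P (g + h)" using add[of g h] by simp
  qed
  then show ?thesis by simp
qed

section \<open>The ideal of relations between the terms of a linear recurrence\<close>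

text \<open>The generic recurrence: \<open>indet 0\<close> to \<open>indet (q - 1)\<close> are the
  initial values and the next \<open>q\<close> indeterminates the coefficients. The shift
  \<open>i - 1\<close> appears because the variables start at index 1 and sequences at 0.\<close>

definition recurrence_param :: "nat \<Rightarrow> 'k::field mpol \<Rightarrow> 'k mpol" where
  "recurrence_param q = mp_eval mp_const (\<lambda>i. recseq q indet (\<lambda>k. indet (q + k)) (i - 1))"

definition recurrence_ideal :: "nat \<Rightarrow> nat \<Rightarrow> 'k::field mpol set" where
  "recurrence_ideal q c = {f \<in> mpoly_carrier c. recurrence_param q f = 0}"

lemma mp_const_hom: "comm_ring_hom (mp_const :: 'k::field \<Rightarrow> 'k mpol)"
  by standard (simp_all add: single_add mult_single)

lemma recurrence_param_hom: "comm_ring_hom (recurrence_param q)"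
  unfolding recurrence_param_def by (rule mp_eval_hom[OF mp_const_hom])

lemma primeideal_recurrence_ideal: "primeideal (recurrence_ideal q c) (mp.R c)"
proof -
  interpret h: comm_ring_hom "recurrence_param q" by (rule recurrence_param_hom)
  show ?thesis
    unfolding mp.primeideal_iff mp.ideal_iff
    by (auto simp: recurrence_ideal_def h.hom_add h.hom_mult)
qed

lemma recseq_cong:
  assumes "\<And>i. i < q \<Longrightarrow> u i = u' i"
  shows "recseq q u l n = recseq q u' l n"
proof (induction n rule: less_induct)
  case (less n)
  show ?case
  proof (cases "n < q")
    case False
    then obtain m where m: "n = m + q" by (metis add.commute le_Suc_ex not_less)
    show ?thesis unfolding m recseq_rec by (intro sum.cong refl) (use less m in simp)
  qed (simp add: recseq_init assms)
qed

text \<open>Any recurrent sequence is a specialization of the generic one, at the point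
  \<open>?y\<close> made of its own initial values and coefficients. So evaluation at it factors
  through \<open>recurrence_param\<close>.\<close>

lemma recurrence_ideal_vanish:
  assumes \<kappa>: "comm_ring_hom \<kappa>" and x: "\<And>n. n < c \<Longrightarrow> x (Suc n) = recseq q u l n"
    and f: "f \<in> recurrence_ideal q c"
  shows "mp_eval \<kappa> x f = 0"
proof -
  let ?y = "\<lambda>k. if k < q then u k else l (k - q)"
  interpret h: comm_ring_hom "mp_eval \<kappa> x" by (rule mp_eval_hom[OF \<kappa>])
  interpret g: comm_ring_hom "mp_eval \<kappa> ?y" by (rule mp_eval_hom[OF \<kappa>])
  interpret p: comm_ring_hom "recurrence_param q" by (rule recurrence_param_hom)
  have "f \<in> mpoly_carrier c" using f by (simp add: recurrence_ideal_def)
  then have "mp_eval \<kappa> x f = mp_eval \<kappa> ?y (recurrence_param q f)"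
  proof (induction rule: mpoly_generators_induct)
    case (const a)
    then show ?case
      by (simp add: recurrence_param_def mp_eval_const[OF \<kappa>] mp_eval_const[OF mp_const_hom])
  next
    case (indet i)
    have "mp_eval \<kappa> ?y (recurrence_param q (indet i)) =
        mp_eval \<kappa> ?y (recseq q indet (\<lambda>k. indet (q + k)) (i - 1))"
      by (simp add: recurrence_param_def mp_eval_indet[OF mp_const_hom])
    also have "\<dots> = recseq q ?y (\<lambda>k. l k) (i - 1)"
      by (simp add: recseq_hom[OF mp_eval_hom[OF \<kappa>]] mp_eval_indet[OF \<kappa>])
    also have "\<dots> = recseq q u l (i - 1)" by (rule recseq_cong) simp
    also have "\<dots> = x i" using x[of "i - 1"] indet by simp
    finally show ?case by (simp add: mp_eval_indet[OF \<kappa>])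
  qed (simp_all add: h.hom_add h.hom_mult g.hom_add g.hom_mult p.hom_add p.hom_mult)
  then show ?thesis using f by (simp add: recurrence_ideal_def)
qed


text \<open>A recurrence that holds up to errors in \<open>M\<close> holds exactly after changing the terms by elements
  of \<open>M\<close>.  With \<open>r\<close> the first index with a nonzero coefficient, the equations are solved from the
  last to the first, the \<open>n\<close>-th one by adjusting the term \<open>n + r\<close>, which does not occur in later
  equations.\<close>

lemma recurrence_correction:
  fixes v m :: "nat \<Rightarrow> 'b::field"
  assumes M: "0 \<in> M" "\<And>x y. x \<in> M \<Longrightarrow> y \<in> M \<Longrightarrow> x + y \<in> M" "\<And>x. x \<in> M \<Longrightarrow> - x \<in> M"
      "\<And>i x. x \<in> M \<Longrightarrow> m i * x \<in> M" "\<And>x. x \<in> M \<Longrightarrow> x / m r \<in> M"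
    and m: "\<And>i. i < r \<Longrightarrow> m i = 0" "m r \<noteq> 0" "r \<le> q"
    and rel: "\<And>n. n + q < c \<Longrightarrow> (\<Sum>i<Suc q. m i * v (n + i)) \<in> M"
  shows "\<exists>v'. (\<forall>n. n + q < c \<longrightarrow> (\<Sum>i<Suc q. m i * v' (n + i)) = 0) \<and> (\<forall>n. v' n - v n \<in> M)"
proof -
  have M_sum: "sum f A \<in> M" if "\<And>i. i \<in> A \<Longrightarrow> f i \<in> M" for f and A :: "nat set"
    using that by (induction A rule: infinite_finite_induct) (simp_all add: M)
  have "\<exists>v'. (\<forall>n. n + q < c \<longrightarrow> c - q \<le> n + d \<longrightarrow> (\<Sum>i<Suc q. m i * v' (n + i)) = 0) \<and>
      (\<forall>n. v' n - v n \<in> M)" for d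
  proof (induction d)
    case 0
    show ?case by (rule exI[of _ v]) (use M in auto)
  next
    case (Suc d)
    then obtain v' where v': "\<forall>n. n + q < c \<longrightarrow> c - q \<le> n + d \<longrightarrow> (\<Sum>i<Suc q. m i * v' (n + i)) = 0"
        "\<forall>n. v' n - v n \<in> M" by (elim exE conjE)
    show ?case
    proof (cases "c - q \<ge> Suc d")
      case False
      then have "(\<Sum>i<Suc q. m i * v' (n + i)) = 0" if "n + q < c" "c - q \<le> n + Suc d" for n
        using that by (intro v'(1)[rule_format]) simp_all
      then show ?thesis using v'(2) by (intro exI[of _ v'] conjI allI impI) blast+
    next
      case True
      define n0 where "n0 = c - q - Suc d"
      have n0: "n0 + q < c" "c - q = n0 + Suc d" using True by (auto simp: n0_def)
      define E where "E = (\<Sum>i<Suc q. m i * v' (n0 + i))"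
      have "E = (\<Sum>i<Suc q. m i * v (n0 + i)) + (\<Sum>i<Suc q. m i * (v' (n0 + i) - v (n0 + i)))"
        unfolding E_def sum.distrib[symmetric] by (intro sum.cong refl) (simp add: algebra_simps)
      also have "\<dots> \<in> M"
        by (rule M(2)[OF rel[OF n0(1)] M_sum]) (rule M(4)[OF v'(2)[rule_format]])
      finally have D: "- (E / m r) \<in> M" by (intro M(3,5))
      define v'' where "v'' = v'(n0 + r := v' (n0 + r) - E / m r)"
      have cong: "v'' n - v n \<in> M" for n
      proof (cases "n = n0 + r")
        case True
        then have "v'' n - v n = (v' n - v n) + - (E / m r)" by (simp add: v''_def algebra_simps)
        then show ?thesis using M(2)[OF v'(2)[rule_format, of n] D] by (simp only:)
      qed (use v'(2) in \<open>simp add: v''_def\<close>)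
      have eqs: "(\<Sum>i<Suc q. m i * v'' (n + i)) = 0" if n: "n + q < c" "c - q \<le> n + Suc d" for n
      proof (cases "n = n0")
        case True
        have "(\<Sum>i<Suc q. m i * v'' (n0 + i)) =
            (\<Sum>i<Suc q. m i * v' (n0 + i) - (if i = r then E else 0))"
          by (intro sum.cong refl) (use m(2) in \<open>simp add: v''_def right_diff_distrib\<close>)
        also have "\<dots> = E - (\<Sum>i<Suc q. if i = r then E else 0)"
          unfolding sum_subtractf E_def[symmetric] ..
        also have "(\<Sum>i<Suc q. if i = r then E else 0) = E" using m(3) by (subst sum.delta) auto
        finally show ?thesis unfolding True by simp
      next
        case False
        then have gt: "n0 < n" "c - q \<le> n + d" using n n0 by linarith+
        have "(\<Sum>i<Suc q. m i * v'' (n + i)) = (\<Sum>i<Suc q. m i * v' (n + i))"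
        proof (intro sum.cong refl)
          fix i
          show "m i * v'' (n + i) = m i * v' (n + i)"
          proof (cases "n + i = n0 + r")
            case True
            then have "i < r" using gt by linarith
            then show ?thesis using m(1) by simp
          qed (simp add: v''_def)
        qed
        then show ?thesis using v'(1)[rule_format, OF n(1) gt(2)] by simp
      qed
      show ?thesis
        by (intro exI[of _ v''] conjI allI impI cong eqs)
    qed
  qed
  from this[of "c - q"] show ?thesis
    by (elim exE conjE, intro exI conjI) (auto simp only: le_add2)
qed

lemma recurrence_normalize:
  fixes v m :: "nat \<Rightarrow> 'b::field"
  assumes m: "m q \<noteq> 0" and rel: "\<And>n. n + q < c \<Longrightarrow> (\<Sum>i<Suc q. m i * v (n + i)) = 0"
  shows "\<exists>u. \<forall>n<c. v n = recseq q v u n"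
proof -
  define u where "u = (\<lambda>i. - (m i / m q))"
  have "v (n + q) = (\<Sum>i<q. u i * v (n + i))" if "n + q < c" for n
  proof -
    have "m q * v (n + q) + (\<Sum>i<q. m i * v (n + i)) = 0"
      using rel[OF that] by (simp add: add.commute)
    then have "v (n + q) = - (\<Sum>i<q. m i * v (n + i)) / m q"
      using m by (simp add: field_simps add_eq_0_iff)
    also have "\<dots> = (\<Sum>i<q. - (m i * v (n + i)) / m q)"
      by (simp only: sum_negf[symmetric] sum_divide_distrib)
    also have "\<dots> = (\<Sum>i<q. u i * v (n + i))"
      by (intro sum.cong refl) (simp add: u_def)
    finally show ?thesis .
  qed
  then have "\<forall>n<c. v n = recseq q v u n"
    using recseq_unique[of q c v u] by simp
  then show ?thesis by (rule exI[of _ u])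
qed


section \<open>Lifting a recurrence from a prime to the local ring\<close>

abbreviation fract_embed :: "'a::idom \<Rightarrow> 'a fract" where
  "fract_embed x \<equiv> Fraction_Field.Fract x 1"

lemma fract_embed_hom: "comm_ring_hom (fract_embed :: 'a::idom \<Rightarrow> 'a fract)"
  by standard (simp_all add: Zero_fract_def One_fract_def)

lemma comm_ring_hom_compose:
  assumes "comm_ring_hom g" "comm_ring_hom h"
  shows "comm_ring_hom (\<lambda>x. g (h x))"
proof -
  interpret g: comm_ring_hom g by fact
  interpret h: comm_ring_hom h by fact
  show ?thesis
    by standard (simp_all only: g.hom_add g.hom_mult g.hom_zero g.hom_one h.hom_add h.hom_mult h.hom_zero h.hom_one)
qed

lemma fract_embed_eq_0_iff: "fract_embed x = 0 \<longleftrightarrow> x = 0"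
  by (simp add: Zero_fract_def eq_fract)

context type_subring
begin

context
  fixes P assumes P: "primeideal P R"
begin

lemma ideal_P: "ideal P R"
  using P by (simp add: primeideal_iff)

abbreviation "loc_max \<equiv> fracs P (C - P)"

lemmas mult_set_P = mult_set_compl_prime[OF P]

lemma one_denom: "1 \<in> C - P"
  using mult_set_P unfolding mult_set_def by (elim conjE)

lemma loc_max_add: "x \<in> loc_max \<Longrightarrow> y \<in> loc_max \<Longrightarrow> x + y \<in> loc_max"
  by (rule fracs_closed(1)[OF mult_set_P ideal_P])

lemma loc_max_mult: "x \<in> fracs C (C - P) \<Longrightarrow> y \<in> loc_max \<Longrightarrow> x * y \<in> loc_max"
  by (rule fracs_closed(2)[OF mult_set_P ideal_P])

lemma fract_embed_loc: "x \<in> C \<Longrightarrow> fract_embed x \<in> fracs C (C - P)"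
  by (rule fracsI[OF _ one_denom])

lemma fract_embed_loc_max: "x \<in> P \<Longrightarrow> fract_embed x \<in> loc_max"
  by (rule fracsI[OF _ one_denom])

lemma loc_max_embedD:
  assumes x: "x \<in> C" "fract_embed x \<in> loc_max"
  shows "x \<in> P"
proof -
  obtain a s where as: "fract_embed x = Fraction_Field.Fract a s" "a \<in> P" "s \<in> C - P"
    using x(2) unfolding fracs_def by blast
  have "s \<noteq> 0" using as(3) ideal_P by (auto simp: ideal_iff)
  then have "x * s = a" using as(1) by (simp add: eq_fract)
  then show ?thesis using P x(1) as(2,3) unfolding primeideal_iff by blast
qed

text \<open>\<open>loc_max\<close> is the maximal ideal of the localization at \<open>P\<close>. The
  first coefficient outside \<open>P\<close> is a unit there, which is what
  \<open>recurrence_correction\<close> has to divide by; the last coefficient only has to be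
  nonzero, since the recurrence is normalized in the fraction field.\<close>

lemma lift_recurrence:
  fixes v l :: "nat \<Rightarrow> 'a"
  assumes v: "\<And>n. v n \<in> C" and l: "\<And>i. l i \<in> C" "\<exists>i<Suc q. l i \<notin> P"
    and rel: "\<And>n. n + q < c \<Longrightarrow> (\<Sum>i<Suc q. l i * v (n + i)) \<in> P"
    and z: "z \<in> P" "z \<noteq> 0"
  shows "\<exists>v' u. (\<forall>n<c. v' n = recseq q v' u n) \<and> (\<forall>n. v' n - fract_embed (v n) \<in> loc_max)"
proof -
  interpret \<iota>: comm_ring_hom "fract_embed :: 'a \<Rightarrow> 'a fract" by (rule fract_embed_hom)
  have P0: "0 \<in> P" using ideal_P by (simp add: ideal_iff)
  define r where "r = (LEAST i. i < Suc q \<and> l i \<notin> P)"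
  have r: "r < Suc q" "l r \<notin> P"
    using LeastI_ex[OF l(2)] unfolding r_def by blast+
  have r_least: "l i \<in> P" if "i < r" for i
    using not_less_Least[of i "\<lambda>i. i < Suc q \<and> l i \<notin> P"] that r(1) unfolding r_def[symmetric] by auto
  \<comment> \<open>The relation is changed by elements of \<open>P\<close> only: coefficients
    before the unit \<open>l r\<close> become 0, and a zero last coefficient becomes
    \<open>z\<close>.\<close>
  define m where "m = (\<lambda>i. if i < r then 0 else if i = q \<and> l q = 0 then z else l i)"
  have mC: "m i \<in> C" for i using l(1) z(1) ideal_subset[OF ideal_P] by (simp add: m_def)
  have m_lt: "m i = 0" if "i < r" for i using that by (simp add: m_def)
  have mq: "m q \<noteq> 0" using r z P0 by (auto simp: m_def)
  have mr: "m r = l r" using r P0 by (auto simp: m_def)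
  have ml: "m i - l i \<in> P" for i
    using r_least[of i] z(1) ideal_uminus[OF ideal_P] P0 by (auto simp: m_def)
  have lr: "l r \<noteq> 0" using r(2) P0 by auto
  have rel': "(\<Sum>i<Suc q. m i * v (n + i)) \<in> P" if "n + q < c" for n
  proof -
    have "(\<Sum>i<Suc q. m i * v (n + i)) = (\<Sum>i<Suc q. l i * v (n + i)) + (\<Sum>i<Suc q. (m i - l i) * v (n + i))"
      by (simp only: sum.distrib[symmetric]) (simp add: algebra_simps)
    moreover have "(\<Sum>i<Suc q. (m i - l i) * v (n + i)) \<in> P"
      by (intro ideal_sum[OF ideal_P] ideal_mult_right[OF ideal_P] ml v)
    ultimately show ?thesis using rel[OF that] ideal_P[unfolded ideal_iff] by simp
  qed
  have "\<exists>v'. (\<forall>n. n + q < c \<longrightarrow> (\<Sum>i<Suc q. fract_embed (m i) * v' (n + i)) = 0) \<and>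
      (\<forall>n. v' n - fract_embed (v n) \<in> loc_max)"
  proof (rule recurrence_correction[where r = r])
    show "0 \<in> loc_max" using fract_embed_loc_max[OF P0] \<iota>.hom_zero by (simp only:)
    show "- x \<in> loc_max" if "x \<in> loc_max" for x
    proof -
      have "fract_embed (- 1) * x \<in> loc_max" by (rule loc_max_mult[OF fract_embed_loc that]) simp
      then show ?thesis unfolding \<iota>.hom_uminus \<iota>.hom_one by (simp only: mult_minus1)
    qed
    show "x / fract_embed (m r) \<in> loc_max" if "x \<in> loc_max" for x
    proof -
      have "Fraction_Field.Fract 1 (l r) \<in> fracs C (C - P)"
        using r(2) l(1) by (intro fracsI) auto
      then have "Fraction_Field.Fract 1 (l r) * x \<in> loc_max" by (rule loc_max_mult[OF _ that])
      moreover have "inverse (fract_embed (m r)) = Fraction_Field.Fract 1 (l r)"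
        unfolding mr by (rule inverse_fract)
      ultimately show ?thesis by (simp only: divide_inverse mult.commute[of x])
    qed
    show "fract_embed (m i) = 0" if "i < r" for i unfolding m_lt[OF that] by (rule \<iota>.hom_zero)
    show "fract_embed (m r) \<noteq> 0" unfolding mr fract_embed_eq_0_iff by (rule lr)
    show "r \<le> q" using r(1) by simp
    show "(\<Sum>i<Suc q. fract_embed (m i) * fract_embed (v (n + i))) \<in> loc_max" if "n + q < c" for n
      using fract_embed_loc_max[OF rel'[OF that]] unfolding \<iota>.hom_sum \<iota>.hom_mult .
  qed (rule loc_max_add loc_max_mult fract_embed_loc mC; assumption?)+
  then obtain v' where v': "\<forall>n. n + q < c \<longrightarrow> (\<Sum>i<Suc q. fract_embed (m i) * v' (n + i)) = 0"
      "\<forall>n. v' n - fract_embed (v n) \<in> loc_max" by (elim exE conjE)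
  have "\<exists>u. \<forall>n<c. v' n = recseq q v' u n"
  proof (rule recurrence_normalize[where m = "\<lambda>i. fract_embed (m i)"])
    show "fract_embed (m q) \<noteq> 0" unfolding fract_embed_eq_0_iff by (rule mq)
  qed (use v'(1) in blast)
  then obtain u where "\<forall>n<c. v' n = recseq q v' u n" by (elim exE)
  then show ?thesis using v'(2) by (rule_tac exI[of _ v'], rule_tac exI[of _ u], rule_tac conjI)
qed

end

end

text \<open>The indeterminate \<open>w\<^sub>n\<^sub>+\<^sub>1\<close>, cut off at the last one so that all terms lie in the ring.\<close>

definition hvar :: "nat \<Rightarrow> nat \<Rightarrow> 'k::field mpol" where
  "hvar c n = (if n < c then indet (Suc n) else 0)"

lemma hvar_closed [simp]: "hvar c n \<in> mpoly_carrier c"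
  by (simp add: hvar_def)

lemma mp_eval_hvar:
  "comm_ring_hom \<kappa> \<Longrightarrow> n < c \<Longrightarrow> mp_eval \<kappa> x (hvar c n) = x (Suc n)"
  by (simp add: hvar_def mp_eval_indet)

lemma mp_eval_hdet_hvar:
  assumes \<kappa>: "comm_ring_hom \<kappa>" and "\<And>i k. i < n \<Longrightarrow> k < n \<Longrightarrow> a i + b k < c"
    and x: "\<And>n. n < c \<Longrightarrow> x (Suc n) = v n"
  shows "mp_eval \<kappa> x (hdet (hvar c) n a b) = hdet v n a b"
  unfolding fdet_hom[OF mp_eval_hom[OF \<kappa>]]
  by (rule fdet_cong) (simp add: mp_eval_hvar[OF \<kappa>] assms)

text \<open>An \<open>f\<close> in the recurrence ideal vanishes at the corrected sequence. This
  sequence is congruent to the variables modulo the maximal ideal of the local ring, so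
  \<open>f\<close> itself lies in that maximal ideal, hence in \<open>P\<close>.\<close>

lemma recurrence_ideal_least:
  fixes P :: "'k::field mpol set"
  assumes P: "primeideal P (mp.R c)" and gen: "hgen (hvar c) (Suc q) (Suc q) (c - q) \<subseteq> P"
    and q: "2 * q < c"
  shows "recurrence_ideal q c \<subseteq> P"
proof
  fix f assume f: "f \<in> (recurrence_ideal q c :: 'k mpol set)"
  interpret \<iota>: comm_ring_hom "fract_embed :: 'k mpol \<Rightarrow> 'k mpol fract" by (rule fract_embed_hom)
  have "\<exists>l. (\<forall>i. l i \<in> mpoly_carrier c) \<and> (\<exists>i<Suc q. l i \<notin> P) \<and>
      (\<forall>\<beta>\<in>{..<c - q}. (\<Sum>i<Suc q. l i * hvar c (i + \<beta>)) \<in> P)"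
  proof (rule mp.null_vector[OF P, of "\<lambda>i \<beta>. hvar c (i + \<beta>)"])
    fix b :: "nat \<Rightarrow> nat" assume "\<forall>k<Suc q. b k \<in> {..<c - q}"
    then have "hdet (hvar c) (Suc q) (\<lambda>i. i) b \<in> hgen (hvar c :: nat \<Rightarrow> 'k mpol) (Suc q) (Suc q) (c - q)"
      unfolding hgen_def
      by (intro CollectI exI[of _ "\<lambda>i. i"] exI[of _ b]) simp
    then show "hdet (hvar c) (Suc q) (\<lambda>i. i) b \<in> P" by (rule subsetD[OF gen])
  qed simp
  then obtain l where l: "(\<forall>i. l i \<in> mpoly_carrier c) \<and> (\<exists>i<Suc q. l i \<notin> P) \<and>
      (\<forall>\<beta>\<in>{..<c - q}. (\<Sum>i<Suc q. l i * hvar c (i + \<beta>)) \<in> P)" by (rule exE)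
  note l2 = l[THEN conjunct2, THEN conjunct1]
  from l have l1: "l i \<in> mpoly_carrier c"
      and l3: "\<beta> < c - q \<Longrightarrow> (\<Sum>i<Suc q. l i * hvar c (i + \<beta>)) \<in> P" for i \<beta>
    using lessThan_iff by blast+
  \<comment> \<open>A nonzero element of \<open>P\<close> for \<open>lift_recurrence\<close>: a
    generator, shown to be nonzero by evaluation at a periodic sequence.\<close>
  let ?z = "hdet (hvar c) (Suc q) (\<lambda>i. 0 + i) (\<lambda>i. i) :: 'k mpol"
  have "?z \<in> hgen (hvar c) (Suc q) (Suc q) (c - q)"
    unfolding hgen_def
    by (rule CollectI, rule exI[of _ "\<lambda>i. 0 + i"], rule exI[of _ "\<lambda>i. i"]) (use q in auto)
  then have zP: "?z \<in> P" by (rule subsetD[OF gen])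
  have "?z \<noteq> 0"
  proof
    let ?v = "recseq (Suc q) (\<lambda>i. of_bool (i = Suc q - 1)) (\<lambda>i. of_bool (i = 0)) :: nat \<Rightarrow> 'k"
    have id: "comm_ring_hom (\<lambda>x :: 'k. x)" by standard auto
    have "mp_eval (\<lambda>x. x) (\<lambda>i. ?v (i - 1)) ?z = hdet ?v (Suc q) (\<lambda>i. 0 + i) (\<lambda>i. i)"
      by (rule mp_eval_hdet_hvar[OF id]) (use q in auto)
    moreover assume "?z = 0"
    ultimately have "hdet ?v (Suc q) (\<lambda>i. 0 + i) (\<lambda>i. i) = 0"
      using mp_eval_0[OF id] by (simp only:)
    then show False by (rule notE[OF hdet_periodic_neq_0])
  qed
  moreover have "(\<Sum>i<Suc q. l i * hvar c (n + i)) \<in> P" if "n + q < c" for n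
    using l3[of n] that unfolding add.commute[of n] by simp
  ultimately have "\<exists>v' u. (\<forall>n<c. v' n = recseq q v' u n) \<and>
      (\<forall>n. v' n - fract_embed (hvar c n) \<in> mp.fracs P (mpoly_carrier c - P))"
    by (intro mp.lift_recurrence[OF P hvar_closed l1 l2 _ zP])
  then obtain v' u where v': "\<forall>n<c. v' n = recseq q v' u n"
      "\<forall>n. v' n - fract_embed (hvar c n) \<in> mp.fracs P (mpoly_carrier c - P)" by (elim exE conjE)
  have \<kappa>: "comm_ring_hom (\<lambda>a :: 'k. fract_embed (mp_const a))"
    by (rule comm_ring_hom_compose[of fract_embed mp_const, OF fract_embed_hom mp_const_hom])
  let ?e = "mp_eval (\<lambda>a. fract_embed (mp_const a)) (\<lambda>i. v' (i - 1))"
  interpret e: comm_ring_hom ?e using \<kappa> by (rule mp_eval_hom)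
  let ?M = "mp.fracs P (mpoly_carrier c - P)" and ?O = "mp.fracs (mpoly_carrier c) (mpoly_carrier c - P)"
  have 0: "0 \<in> ?M" using mp.fract_embed_loc_max[OF P, of 0] mp.ideal_P[OF P] by (simp add: mp.ideal_iff)
  have MO: "?M \<subseteq> ?O" using mp.ideal_P[OF P] unfolding mp.fracs_def mp.ideal_iff by blast
  have fC: "f \<in> mpoly_carrier c" using f by (simp add: recurrence_ideal_def)
  \<comment> \<open>Congruence on the generators extends to all polynomials; for products both
    evaluations must have values in the local ring \<open>?O\<close>.\<close>
  then have "?e f - fract_embed f \<in> ?M"
  proof (induction rule: mpoly_generators_induct)
    case (const a)
    then show ?case using 0 by (simp add: mp_eval_const[OF \<kappa>])
  next
    case (indet i)
    then obtain n where "i = Suc n" "n < c" by (cases i) auto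
    then show ?case using v'(2)[rule_format, of n] by (simp add: mp_eval_indet[OF \<kappa>] hvar_def)
  next
    case (add f g)
    have "?e (f + g) - fract_embed (f + g) = (?e f - fract_embed f) + (?e g - fract_embed g)"
      by (simp only: e.hom_add \<iota>.hom_add) (simp only: algebra_simps)
    then show ?case using mp.loc_max_add[OF P add.IH] by simp
  next
    case (mult f g)
    have eq: "?e (f * g) - fract_embed (f * g) =
        ?e f * (?e g - fract_embed g) + fract_embed g * (?e f - fract_embed f)"
      by (simp only: e.hom_mult \<iota>.hom_mult) (simp only: algebra_simps)
    have "(?e f - fract_embed f) + fract_embed f \<in> ?O"
      using MO mult.IH(1) mp.fract_embed_loc[OF P mult.hyps(1)]
      by (intro mp.fracs_closed(1)[OF mp.mult_set_P[OF P] mp.ideal_C[OF mp.mult_set_P[OF P]]]) auto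
    then have "?e f \<in> ?O" by simp
    then show ?case
      unfolding eq by (intro mp.loc_max_add[OF P] mp.loc_max_mult[OF P] mult.IH mp.fract_embed_loc[OF P] mult.hyps)
  qed
  moreover have "?e f = 0"
    by (rule recurrence_ideal_vanish[OF \<kappa> _ f, of _ v' u]) (use v'(1) in simp)
  ultimately have "- fract_embed f \<in> ?M" by simp
  then have "fract_embed (- 1) * - fract_embed f \<in> ?M"
    by (intro mp.loc_max_mult[OF P] mp.fract_embed_loc[OF P]) simp_all
  then have "fract_embed f \<in> ?M" by simp
  then show "f \<in> P" by (rule mp.loc_max_embedD[OF P fC])
qed


section \<open>Hankel ideals\<close>

lemma incr_bounded_id:
  assumes a: "incr t a" "\<forall>i<t. a i < t" and i: "i < t"
  shows "a i = i"
proof -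
  have "a 0 + i \<le> a i" using incr_gap[OF a(1), of 0 i] i by simp
  moreover have "a i + (t - 1 - i) \<le> a (t - 1)" using incr_gap[OF a(1), of i "t - 1 - i"] i by simp
  moreover have "a (t - 1) < t" using a(2) i by simp
  ultimately show ?thesis using i by linarith
qed

context type_subring
begin

text \<open>Sorting the rows and, after a transposition, the columns costs only signs; a repeated
  index makes the determinant 0.\<close>

lemma hgen_subset_ideal:
  assumes K: "ideal K R" and gen: "minors t (mat m n (\<lambda>(a, b). w (a + b))) \<subseteq> K"
  shows "hgen w t m n \<subseteq> K"
proof
  have 0: "0 \<in> K" using K by (simp add: ideal_iff)
  have signK: "(- 1) ^ (e :: nat) * x \<in> K" if "x \<in> K" for e x
    by (rule ideal_mult_left[OF K that minus_one_power_closed])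
  have strict: "hdet w t a b \<in> K"
    if "incr t a" "incr t b" "\<forall>i<t. a i < m" "\<forall>k<t. b k < n" for a b
    using gen that unfolding minors_hankel by blast
  have sorted: "\<exists>s (e :: nat). incr t s \<and> (\<forall>i<t. s i < l) \<and>
      (\<forall>f :: nat \<Rightarrow> nat \<Rightarrow> 'a. fdet t (\<lambda>i k. f (a i) k) = (- 1) ^ e * fdet t (\<lambda>i k. f (s i) k))"
    if inj: "inj_on a {..<t}" and lt: "\<forall>i<t. a i < l" for a l
  proof -
    obtain s and e :: nat where s: "\<forall>i j. i < j \<longrightarrow> j < t \<longrightarrow> s i < s j" "\<forall>i<t. s i \<in> a ` {..<t}"
        "\<forall>f :: nat \<Rightarrow> nat \<Rightarrow> 'a. fdet t (\<lambda>i k. f (a i) k) = (- 1) ^ e * fdet t (\<lambda>i k. f (s i) k)"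
      using fdet_sort[OF inj] by (elim exE conjE)
    moreover have "\<forall>i<t. s i < l" using s(2) lt by fastforce
    ultimately show ?thesis unfolding incr_def by (intro exI[of _ s] exI[of _ e] conjI)
  qed
  fix x assume "x \<in> hgen w t m n"
  then obtain a b where ab: "\<forall>i<t. a i < m" "\<forall>k<t. b k < n" "x = hdet w t a b"
    unfolding hgen_def by blast
  show "x \<in> K"
  proof (cases "inj_on a {..<t} \<and> inj_on b {..<t}")
    case True
    obtain s and e :: nat where s: "incr t s" "\<forall>i<t. s i < m"
        "\<forall>f :: nat \<Rightarrow> nat \<Rightarrow> 'a. fdet t (\<lambda>i k. f (a i) k) = (- 1) ^ e * fdet t (\<lambda>i k. f (s i) k)"
      using sorted[OF conjunct1[OF True] ab(1)] by (elim exE conjE)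
    obtain s' and e' :: nat where s': "incr t s'" "\<forall>i<t. s' i < n"
        "\<forall>f :: nat \<Rightarrow> nat \<Rightarrow> 'a. fdet t (\<lambda>i k. f (b i) k) = (- 1) ^ e' * fdet t (\<lambda>i k. f (s' i) k)"
      using sorted[OF conjunct2[OF True] ab(2)] by (elim exE conjE)
    have "x = (- 1) ^ e * hdet w t s b"
      unfolding ab(3) by (rule s(3)[rule_format, of "\<lambda>a k. w (a + b k)"])
    also have "hdet w t s b = hdet w t b s" by (rule hdet_swap)
    also have "hdet w t b s = (- 1) ^ e' * hdet w t s' s"
      by (rule s'(3)[rule_format, of "\<lambda>a k. w (a + s k)"])
    also have "hdet w t s' s = hdet w t s s'" by (rule hdet_swap)
    finally show ?thesis using signK[OF signK[OF strict[OF s(1) s'(1) s(2) s'(2)]]] by (simp only:)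
  next
    case False
    then consider "\<not> inj_on a {..<t}" | "\<not> inj_on b {..<t}" by blast
    then have "x = 0"
    proof cases
      case 1
      then obtain i j where "i < t" "j < t" "i \<noteq> j" "a i = a j" by (auto simp: inj_on_def)
      then show ?thesis unfolding ab(3) by (intro fdet_identical_rows[of i t j]) auto
    next
      case 2
      then obtain i j where "i < t" "j < t" "i \<noteq> j" "b i = b j" by (auto simp: inj_on_def)
      then show ?thesis unfolding ab(3) by (intro fdet_identical_cols[of i t j]) auto
    qed
    then show ?thesis using 0 by simp
  qed
qed

lemma minors_subset_hgen: "minors t (mat m n (\<lambda>(a, b). w (a + b))) \<subseteq> hgen w t m n"
  unfolding minors_hankel hgen_def by blast

text \<open>Families of generators that lie in the same ideals generate the same ideal, so the ideal of
  minors depends on \<open>m + n\<close> only.\<close>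

lemma minors_ideal_iff_square_rows:
  assumes K: "ideal K R" and mn: "t \<le> m" "t \<le> n"
  shows "minors t (mat m n (\<lambda>(a, b). w (a + b))) \<subseteq> K \<longleftrightarrow> hgen w t t (m + n - t) \<subseteq> K"
proof -
  obtain d where d: "m = t + d" using mn(1) le_Suc_ex by blast
  then have eq: "m + n - t = n + d" by simp
  show ?thesis
    unfolding eq
  proof
    assume "minors t (mat m n (\<lambda>(a, b). w (a + b))) \<subseteq> K"
    then have "hgen w t (t + d) n \<subseteq> K" using hgen_subset_ideal[OF K] d by blast
    then show "hgen w t t (n + d) \<subseteq> K" by (rule hgen_unshift_ideal[OF K _ mn(2)])
  next
    assume "hgen w t t (n + d) \<subseteq> K"
    then have "hgen w t m n \<subseteq> K" unfolding d by (rule hgen_shift_ideal[OF K])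
    then show "minors t (mat m n (\<lambda>(a, b). w (a + b))) \<subseteq> K" using minors_subset_hgen by blast
  qed
qed

end

definition hankel_gens :: "nat \<Rightarrow> nat \<Rightarrow> 'k::field mpol set" where
  "hankel_gens q c = hgen (hvar c) (Suc q) (Suc q) (c - q)"

lemma hankel_ideal_eq:
  assumes "1 \<le> j" "j \<le> c" "Suc q \<le> min j (c + 1 - j)"
  shows "(hankel_ideal (Suc q) j c :: 'k::field mpol set) = genideal (mp.R c) (hankel_gens q c)"
proof -
  have "hankel_matrix j c = mat j (c + 1 - j) (\<lambda>(a, b). hvar c (a + b) :: 'k mpol)"
    unfolding hankel_matrix_def by (intro eq_matI) (auto simp: hvar_def)
  \<comment> \<open>Rows and columns together number \<open>c + 1\<close> for every
    \<open>j\<close>, which is how \<open>j\<close> disappears.\<close>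
  moreover have "j + (c + 1 - j) - Suc q = c - q" using assms by simp
  moreover have le: "Suc q \<le> j" "Suc q \<le> c + 1 - j" using assms(3) by simp_all
  ultimately have "minors (Suc q) (hankel_matrix j c) \<subseteq> K \<longleftrightarrow> hankel_gens q c \<subseteq> K"
    if "ideal K (mp.R c)" for K :: "'k mpol set"
    using mp.minors_ideal_iff_square_rows[OF that le, of "hvar c"]
    unfolding hankel_gens_def by (simp only:)
  then show ?thesis
    unfolding hankel_ideal_def mpoly_ring_eq genideal_def by blast
qed

text \<open>The minors have size \<open>q + 1\<close>; the parameter \<open>T\<close> only fixes the coefficient field.\<close>

locale hankel_setup =
  fixes q c :: nat and T :: "'k::field itself"
  assumes qc: "2 * q < c"
begin

abbreviation w :: "nat \<Rightarrow> 'k mpol" where "w \<equiv> hvar c"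

abbreviation gens :: "'k mpol set" where "gens \<equiv> hankel_gens q c"

abbreviation carr :: "'k mpol set" where "carr \<equiv> mpoly_carrier c"

definition I :: "'k mpol set" where
  "I = genideal (mp.R c) (hankel_gens q c)"

abbreviation Q :: "'k mpol set" where "Q \<equiv> recurrence_ideal q c"

abbreviation corner :: "nat \<Rightarrow> 'k mpol" where
  "corner m \<equiv> hdet w q (\<lambda>i. m + i) (\<lambda>i. i)"

abbreviation h :: nat where "h \<equiv> c - 2 * q"

lemma hankel_gens_closed: "gens \<subseteq> carr"
proof
  fix x :: "'k mpol" assume "x \<in> gens"
  then obtain a b where x: "x = hdet w (Suc q) a b"
    unfolding hankel_gens_def hgen_def by blast
  show "x \<in> carr" unfolding x by (rule mp.fdet_closed) (rule hvar_closed)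
qed

lemma ideal_I: "ideal I (mp.R c)"
  unfolding I_def by (rule mp.R.genideal_ideal) (use hankel_gens_closed in simp)

lemma gens_subset_I: "gens \<subseteq> I"
  unfolding I_def genideal_def by blast

lemma I_least: "ideal K (mp.R c) \<Longrightarrow> gens \<subseteq> K \<Longrightarrow> I \<subseteq> K"
  unfolding I_def genideal_def by blast

text \<open>A matrix with \<open>q + 1\<close> rows leaves no choice of rows, so only the columns
  \<open>b\<close> vary.\<close>

lemma I_least_square_rows:
  assumes K: "ideal K (mp.R c)"
    and gen: "\<And>b. (\<forall>k<Suc q. b k < c - q) \<Longrightarrow> fdet (Suc q) (\<lambda>i k. w (i + b k)) \<in> K"
  shows "I \<subseteq> K"
proof (rule I_least[OF K], unfold hankel_gens_def, rule mp.hgen_subset_ideal[OF K], rule subsetI)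
  fix x :: "'k mpol"
  assume "x \<in> minors (Suc q) (mat (Suc q) (c - q) (\<lambda>(a, b). w (a + b)))"
  then obtain a b where ab: "incr (Suc q) a" "\<forall>i<Suc q. a i < Suc q" "\<forall>k<Suc q. b k < c - q"
      "x = hdet w (Suc q) a b"
    unfolding minors_hankel by blast
  have "x = fdet (Suc q) (\<lambda>i k. w (i + b k))"
    unfolding ab(4) by (rule fdet_cong) (simp only: incr_bounded_id[OF ab(1,2)])
  then show "x \<in> K" using gen[OF ab(3)] by (simp only:)
qed

lemma I_subset_Q: "I \<subseteq> Q"
proof (rule I_least_square_rows)
  show "ideal Q (mp.R c)" using primeideal_recurrence_ideal mp.primeideal_iff by blast
  fix b :: "nat \<Rightarrow> nat" assume b: "\<forall>k<Suc q. b k < c - q"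
  have "i + b k < c" if ik: "i < Suc q" "k < Suc q" for i k
  proof -
    have "b k < c - q" using b ik(2) by blast
    then show ?thesis using ik(1) by linarith
  qed
  then have "recurrence_param q (fdet (Suc q) (\<lambda>i k. w (i + b k))) =
      fdet (Suc q) (\<lambda>i k. recseq q indet (\<lambda>k. indet (q + k)) (i + b k))"
    unfolding recurrence_param_def by (intro mp_eval_hdet_hvar[OF mp_const_hom]) simp_all
  also have "\<dots> = 0" by (rule hdet_recseq_eq_0)
  finally show "fdet (Suc q) (\<lambda>i k. w (i + b k)) \<in> Q"
    unfolding recurrence_ideal_def using mp.fdet_closed[of "\<lambda>i k. w (i + b k)"] hvar_closed by blast
qed

lemma minimal_primes_I: "minimal_primes (mp.R c) I = {Q}"
proof -
  have "Q \<subseteq> P" if "primeideal P (mp.R c)" "I \<subseteq> P" for P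
    by (rule recurrence_ideal_least[OF that(1) _ qc])
      (use gens_subset_I that(2) in \<open>unfold hankel_gens_def, blast\<close>)
  then show ?thesis
    unfolding minimal_primes_def using primeideal_recurrence_ideal I_subset_Q by blast
qed

lemma corner_closed: "corner m \<in> carr"
  by (rule mp.fdet_closed) (rule hvar_closed)

text \<open>The periodic sequence satisfies a recurrence of order \<open>q\<close>, so evaluation at
  it kills \<open>Q\<close>, but not the corner. The bound says that the largest index
  \<open>m + 2 * q - 2\<close> is below \<open>c\<close>.\<close>

lemma corner_notin_Q:
  assumes "m + 2 * q < c + 2"
  shows "corner m \<notin> Q"
proof
  let ?v = "recseq q (\<lambda>i. of_bool (i = q - 1)) (\<lambda>i. of_bool (i = 0)) :: nat \<Rightarrow> 'k"
  have id: "comm_ring_hom (\<lambda>x :: 'k. x)" by standard auto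
  assume "corner m \<in> Q"
  then have "mp_eval (\<lambda>x. x) (\<lambda>i. ?v (i - 1)) (corner m) = 0"
    by (rule recurrence_ideal_vanish[OF id, rotated, where q = q and c = c]) simp
  also have "mp_eval (\<lambda>x. x) (\<lambda>i. ?v (i - 1)) (corner m) = hdet ?v q (\<lambda>i. m + i) (\<lambda>i. i)"
    by (rule mp_eval_hdet_hvar[OF id]) (use assms in auto)
  finally show False by (rule notE[OF hdet_periodic_neq_0])
qed

text \<open>The \<open>m\<close> by \<open>n\<close> window fits into the Hankel matrix with
  \<open>c + 1 - n\<close> rows and \<open>n\<close> columns, whose minors lie in \<open>I\<close>
  by exchanging columns for rows.\<close>

lemma minor_in_I:
  assumes "\<And>x. x < Suc q \<Longrightarrow> a x < m" "\<And>x. x < Suc q \<Longrightarrow> b x < n" "Suc q \<le> m" "Suc q \<le> n" "m + n \<le> c + 1"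
  shows "hdet w (Suc q) a b \<in> I"
proof -
  define d where "d = c + 1 - n - Suc q"
  then have d: "c + 1 - n = Suc q + d" using assms(3,5) by linarith
  then have "n + d = c - q" using assms(5) by simp
  then have "hgen w (Suc q) (Suc q) (n + d) \<subseteq> I" using gens_subset_I unfolding hankel_gens_def by simp
  then have "hgen w (Suc q) (Suc q + d) n \<subseteq> I" by (rule mp.hgen_shift_ideal[OF ideal_I])
  moreover have "a x < Suc q + d" if "x < Suc q" for x using assms(1)[OF that] assms(5) d by linarith
  then have "hdet w (Suc q) a b \<in> hgen w (Suc q) (Suc q + d) n"
    unfolding hgen_def using assms(2) by (intro CollectI exI[of _ a] exI[of _ b]) simp
  ultimately show ?thesis by blast
qed

abbreviation big_minor :: "nat \<Rightarrow> nat \<Rightarrow> 'k mpol" where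
  "big_minor s m \<equiv> hdet w s (\<lambda>i. m + i) (\<lambda>i. i)"

lemma big_minor_local:
  assumes "q \<le> s" "m + 2 * s \<le> c + 1"
  shows "corner m ^ (s - q) * big_minor s m \<in> mp.ideal_power c I (s - q)"
proof (rule mp.leading_minor_power_mult[OF ideal_I hvar_closed assms(1)])
  fix i \<beta> assume "q \<le> i" "i < s" "\<beta> < s"
  then show "fdet (Suc q) (\<lambda>x y. w (m + (if x = q then i else x) + (if y = q then \<beta> else y))) \<in> I"
    using assms by (intro minor_in_I[of _ "m + s" _ s]) auto
qed

text \<open>The diagonals of the two matrices run through the variables of odd and of even
  index.\<close>

definition f0 :: "'k mpol" where
  "f0 = big_minor ((c + 1) div 2) 0 * big_minor (c div 2) 1"

definition f0_denom :: "'k mpol" where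
  "f0_denom = corner 0 ^ ((c + 1) div 2 - q) * corner 1 ^ (c div 2 - q)"

text \<open>The exponents add up to \<open>h\<close> because the two halves of \<open>c\<close> do
  to \<open>c\<close>, and \<open>2 * q < c\<close> keeps either difference from being
  truncated.\<close>

lemma f0_local: "f0_denom * f0 \<in> mp.ideal_power c I h"
proof -
  have "corner 0 ^ ((c + 1) div 2 - q) * big_minor ((c + 1) div 2) 0 \<in>
      mp.ideal_power c I ((c + 1) div 2 - q)"
    by (rule big_minor_local) (use qc in linarith)+
  moreover have "corner 1 ^ (c div 2 - q) * big_minor (c div 2) 1 \<in>
      mp.ideal_power c I (c div 2 - q)"
    by (rule big_minor_local) (use qc in linarith)+
  ultimately have "(corner 0 ^ ((c + 1) div 2 - q) * big_minor ((c + 1) div 2) 0) *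
      (corner 1 ^ (c div 2 - q) * big_minor (c div 2) 1) \<in>
      mp.ideal_power c I (((c + 1) div 2 - q) + (c div 2 - q))"
    by (rule mp.ideal_power_mult[OF ideal_I])
  moreover have "((c + 1) div 2 - q) + (c div 2 - q) = h" using qc by linarith
  ultimately show ?thesis unfolding f0_denom_def f0_def by (simp only: mult_ac)
qed

lemma f0_closed: "f0 \<in> carr"
  unfolding f0_def by (intro mp.mult_closed mp.fdet_closed hvar_closed)

lemma f0_denom_in: "f0_denom \<in> carr - Q"
proof -
  have S: "mp.mult_set c (carr - Q)"
    by (rule mp.mult_set_compl_prime[OF primeideal_recurrence_ideal])
  have pow: "corner m ^ e \<in> carr - Q" if "m \<le> 1" for m e
    using mp.prime_power[OF primeideal_recurrence_ideal corner_closed corner_notin_Q, of m e]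
      mp.power_closed[OF corner_closed, of m e] that qc by auto
  show ?thesis
    unfolding f0_denom_def by (rule mp.denom(4)[OF S pow pow]) auto
qed

text \<open>The bordered minors of the upper left corner of the matrix with \<open>q + 1\<close> rows.  Away from the
  zero set of the corner they generate \<open>I\<close>, and their number is the height of \<open>I\<close>.\<close>

definition border :: "nat \<Rightarrow> 'k mpol" where
  "border k = fdet (Suc q) (\<lambda>i y. if y = q then w (i + (q + k)) else w (i + y))"

lemma border_in_I: "k < h \<Longrightarrow> border k \<in> I"
proof -
  assume k: "k < h"
  have "border k = hdet w (Suc q) (\<lambda>i. i) (\<lambda>y. if y = q then q + k else y)"
    unfolding border_def by (rule fdet_cong) simp
  also have "\<dots> \<in> I" by (rule minor_in_I[of _ "Suc q" _ "c - q"]) (use k qc in auto)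
  finally show ?thesis .
qed

text \<open>The elements that \<open>corner 0\<close> multiplies into \<open>K\<close> form an
  ideal, so generators of \<open>I\<close> suffice, and \<open>leading_minor_mult\<close> reduces
  these to bordered minors.\<close>

lemma corner_mult_I:
  assumes K: "ideal K (mp.R c)" and g: "\<And>k. k < h \<Longrightarrow> border k \<in> K" and x: "x \<in> I"
  shows "corner 0 * x \<in> K"
proof -
  let ?L = "{x \<in> carr. corner 0 * x \<in> K}"
  have "I \<subseteq> ?L"
  proof (rule I_least_square_rows)
    show "ideal ?L (mp.R c)"
      unfolding mp.ideal_iff
    proof (intro conjI ballI subsetI)
      show "0 \<in> ?L" using K unfolding mp.ideal_iff by simp
      show "x + y \<in> ?L" if "x \<in> ?L" "y \<in> ?L" for x y
        using that K unfolding mp.ideal_iff by (simp add: distrib_left)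
      show "a * x \<in> ?L" if "a \<in> carr" "x \<in> ?L" for a x
        using that mp.ideal_mult_left[OF K, of "corner 0 * x" a] by (simp add: mult.left_commute)
    qed simp
    fix b :: "nat \<Rightarrow> nat" assume b: "\<forall>k<Suc q. b k < c - q"
    have "fdet q (\<lambda>i k. w (i + k)) * fdet (Suc q) (\<lambda>i k. w (i + b k)) \<in> K"
    proof (rule mp.leading_minor_mult[OF K, where B = "{..<c - q}" and f = "\<lambda>i k. w (i + k)"])
      fix \<beta> assume \<beta>: "\<beta> \<in> {..<c - q}"
      show "fdet (Suc q) (\<lambda>i k. if k = q then w (i + \<beta>) else w (i + k)) \<in> K"
      \<comment> \<open>A border column already present in the corner gives two equal columns; the
        others are the \<open>h\<close> columns counted by \<open>border\<close>.\<close>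
      proof (cases "\<beta> < q")
        case True
        then have "fdet (Suc q) (\<lambda>i k. if k = q then w (i + \<beta>) else w (i + k)) = 0"
          by (intro fdet_identical_cols[of \<beta> "Suc q" q]) auto
        then show ?thesis using K unfolding mp.ideal_iff by (simp only:)
      next
        case False
        then obtain k where k: "\<beta> = q + k" using le_Suc_ex not_less by blast
        then have "k < h" using \<beta> by simp
        then show ?thesis using g[of k] unfolding border_def k by (simp only:)
      qed
    qed (use b in simp_all)
    then show "fdet (Suc q) (\<lambda>i k. w (i + b k)) \<in> ?L"
      using mp.fdet_closed[of "\<lambda>i k. w (i + b k)"] by simp
  qed
  then show ?thesis using x by blast
qed

end


section \<open>A splitting of Frobenius on polynomials\<close>

lemma CHAR_mpol: "CHAR('k::field mpol) = CHAR('k)"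
proof (rule CHAR_eqI)
  have of_nat: "(of_nat n :: 'k mpol) = mp_const (of_nat n)" for n
    by (rule single_of_nat[symmetric])
  show "of_nat CHAR('k) = (0 :: 'k mpol)" unfolding of_nat by simp
  fix n assume "of_nat n = (0 :: 'k mpol)"
  then have "(of_nat n :: 'k) = 0" unfolding of_nat by (metis lookup_single_eq lookup_zero)
  then show "CHAR('k) dvd n" by (simp add: of_nat_eq_0_iff_char_dvd)
qed

lemma prime_CHAR: "CHAR('k::field) > 0 \<Longrightarrow> prime CHAR('k)"
  using prime_CHAR_semidom by blast

text \<open>The map is obtained by extending the functional \<open>K\<^sup>p \<rightarrow> K\<close>, \<open>a\<^sup>p \<mapsto> a\<close>, linearly to \<open>K\<close>.\<close>

lemma field_frobenius_splitting:
  assumes p: "p = CHAR('k::field)" "p > 0"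
  shows "\<exists>\<theta> :: 'k \<Rightarrow> 'k. (\<forall>a b. \<theta> (a + b) = \<theta> a + \<theta> b) \<and> (\<forall>a b. \<theta> (a ^ p * b) = a * \<theta> b) \<and> \<theta> 1 = 1"
proof -
  have pr: "prime CHAR('k)" using prime_CHAR p by simp
  interpret V: vector_space "\<lambda>a x :: 'k. a ^ p * x"
    by standard (simp_all add: algebra_simps freshmans_dream[OF pr p(1)])
  interpret W: vector_space "\<lambda>a x :: 'k. a * x"
    by standard (simp_all add: algebra_simps)
  interpret VW: vector_space_pair "\<lambda>a x :: 'k. a ^ p * x" "\<lambda>a x :: 'k. a * x" ..
  have "\<not> V.dependent {1}" by simp
  then obtain g where g: "Vector_Spaces.linear (\<lambda>a x :: 'k. a ^ p * x) (\<lambda>a x. a * x) g" "g 1 = 1"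
    using VW.linear_independent_extend[of "{1}" "\<lambda>x. x"] by auto
  interpret g: Vector_Spaces.linear "\<lambda>a x :: 'k. a ^ p * x" "\<lambda>a x. a * x" g by (rule g(1))
  show ?thesis using g.add g.scale g(2) by (intro exI[of _ g]) blast
qed

definition mono_times :: "nat \<Rightarrow> (nat \<Rightarrow>\<^sub>0 nat) \<Rightarrow> (nat \<Rightarrow>\<^sub>0 nat)" where
  "mono_times k m = Poly_Mapping.map ((*) k) m"

definition mono_div :: "nat \<Rightarrow> (nat \<Rightarrow>\<^sub>0 nat) \<Rightarrow> (nat \<Rightarrow>\<^sub>0 nat)" where
  "mono_div k m = Poly_Mapping.map (\<lambda>x. x div k) m"

lemma lookup_mono_times [simp]: "Poly_Mapping.lookup (mono_times k m) i = k * Poly_Mapping.lookup m i"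
  by (simp add: mono_times_def Poly_Mapping.map.rep_eq when_def)

lemma lookup_mono_div [simp]: "Poly_Mapping.lookup (mono_div k m) i = Poly_Mapping.lookup m i div k"
  by (simp add: mono_div_def Poly_Mapping.map.rep_eq when_def)

lemma single_power: "Poly_Mapping.single m (a :: 'k::field) ^ k = Poly_Mapping.single (mono_times k m) (a ^ k)"
proof (induction k)
  case 0
  have "mono_times 0 m = 0" by (rule poly_mapping_eqI) simp
  then show ?case by simp
next
  case (Suc k)
  have "m + mono_times k m = mono_times (Suc k) m"
    by (rule poly_mapping_eqI) (simp add: Poly_Mapping.lookup_add)
  then show ?case by (simp add: Suc mult_single)
qed

locale frobenius_trace =
  fixes p c :: nat and \<theta> :: "'k::field \<Rightarrow> 'k"
  assumes p: "p = CHAR('k)" "p > 0"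
    and \<theta>_add: "\<theta> (a + b) = \<theta> a + \<theta> b" and \<theta>_mult: "\<theta> (a ^ p * b) = a * \<theta> b" and \<theta>_one: "\<theta> 1 = 1"
begin

text \<open>The trace dual to the monomial \<open>(w\<^sub>1 \<dots> w\<^sub>c)\<^sup>p\<^sup>-\<^sup>1\<close>.\<close>

definition full :: "(nat \<Rightarrow>\<^sub>0 nat) \<Rightarrow> bool" where
  "full m \<longleftrightarrow> (\<forall>i\<in>{1..c}. Poly_Mapping.lookup m i mod p = p - 1)"

text \<open>In a full exponent vector the remainders modulo \<open>p\<close> are
  \<open>p - 1\<close> at all of the \<open>c\<close> variables, so \<open>mono_div\<close> both
  removes that factor and takes the \<open>p\<close>-th root; \<open>\<theta>\<close> does the same
  for coefficients.\<close>

definition trace_term :: "(nat \<Rightarrow>\<^sub>0 nat) \<Rightarrow> 'k \<Rightarrow> 'k mpol" where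
  "trace_term m a = (if full m then Poly_Mapping.single (mono_div p m) (\<theta> a) else 0)"

definition trace :: "'k mpol \<Rightarrow> 'k mpol" where
  "trace = mp_ext trace_term"

lemma \<theta>_0 [simp]: "\<theta> 0 = 0"
  using \<theta>_add[of 0 0] by (metis add_0_right add_left_imp_eq)

lemma trace_add: "trace (f + g) = trace f + trace g"
  unfolding trace_def by (rule mp_ext_add) (simp_all add: trace_term_def \<theta>_add single_add)

lemma trace_0 [simp]: "trace 0 = 0"
  by (simp add: trace_def)

lemma trace_single: "trace (Poly_Mapping.single m a) = trace_term m a"
  unfolding trace_def by (rule mp_ext_single) (simp add: trace_term_def)

lemma trace_term_mult:
  "trace_term (mono_times p n + m) (b ^ p * a) = Poly_Mapping.single n b * trace_term m a"
proof -
  have "full (mono_times p n + m) \<longleftrightarrow> full m"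
    by (simp add: full_def Poly_Mapping.lookup_add)
  moreover have "mono_div p (mono_times p n + m) = n + mono_div p m"
    using p by (intro poly_mapping_eqI) (simp add: Poly_Mapping.lookup_add)
  ultimately show ?thesis by (simp add: trace_term_def \<theta>_mult mult_single)
qed

text \<open>Both sides are additive in \<open>f\<close> and, by the freshman's dream, in
  \<open>b\<close>, so single terms suffice.\<close>

lemma trace_power_mult: "trace (b ^ p * f) = b * trace f"
proof (induction b rule: poly_mapping_induct_keys)
  case 1
  then show ?case using p(2) by (simp add: zero_power)
next
  case (2 n b)
  show ?case
  proof (induction f rule: poly_mapping_induct_keys)
    case (2 m a)
    show ?case by (simp add: single_power mult_single trace_single trace_term_mult)
  qed (simp_all add: distrib_left trace_add)
next
  case (3 g h)
  have "prime CHAR('k mpol)" "p = CHAR('k mpol)" using prime_CHAR p by (simp_all add: CHAR_mpol)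
  then have "(g + h) ^ p = g ^ p + h ^ p" by (rule freshmans_dream)
  then show ?case using 3 by (simp add: distrib_right trace_add)
qed

lemma trace_closed:
  assumes "f \<in> mpoly_carrier c"
  shows "trace f \<in> mpoly_carrier c"
proof (rule poly_mapping_induct_keys[of "\<lambda>f. trace f \<in> mpoly_carrier c"])
  fix m a assume "m \<in> Poly_Mapping.keys f"
  then have m: "Poly_Mapping.keys m \<subseteq> {1..c}" using assms by (auto simp: mpoly_carrier_def)
  have "Poly_Mapping.keys (mono_div p m) \<subseteq> Poly_Mapping.keys m"
    unfolding subset_iff in_keys_iff lookup_mono_div by (metis div_0)
  from order_trans[OF this m] have "Poly_Mapping.single (mono_div p m) (\<theta> a) \<in> mpoly_carrier c"
    by (simp add: mpoly_carrier_def)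
  then show "trace (Poly_Mapping.single m a) \<in> mpoly_carrier c"
    by (simp add: trace_single trace_term_def)
qed (simp_all add: trace_add)

end

section \<open>Leading monomials\<close>

text \<open>With the weight \<open>i\<^sup>2\<close> on \<open>w\<^sub>i\<close>, the strict rearrangement inequality makes the diagonal term of
  a Hankel determinant the only one of largest weight.\<close>

definition weight :: "(nat \<Rightarrow>\<^sub>0 nat) \<Rightarrow> nat" where
  "weight m = (\<Sum>i\<in>Poly_Mapping.keys m. i ^ 2 * Poly_Mapping.lookup m i)"

lemma weight_superset:
  "finite A \<Longrightarrow> Poly_Mapping.keys m \<subseteq> A \<Longrightarrow> weight m = (\<Sum>i\<in>A. i ^ 2 * Poly_Mapping.lookup m i)"
  unfolding weight_def by (intro sum.mono_neutral_left) (auto simp: in_keys_iff)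

lemma weight_add: "weight (m + n) = weight m + weight n"
proof -
  let ?A = "Poly_Mapping.keys m \<union> Poly_Mapping.keys n"
  have "weight (m + n) = (\<Sum>i\<in>?A. i ^ 2 * Poly_Mapping.lookup (m + n) i)"
    by (rule weight_superset) (auto dest: subsetD[OF Poly_Mapping.keys_add])
  also have "\<dots> = (\<Sum>i\<in>?A. i ^ 2 * Poly_Mapping.lookup m i) + (\<Sum>i\<in>?A. i ^ 2 * Poly_Mapping.lookup n i)"
    by (simp add: Poly_Mapping.lookup_add distrib_left sum.distrib)
  also have "\<dots> = weight m + weight n"
    by (simp add: weight_superset[of ?A m] weight_superset[of ?A n])
  finally show ?thesis .
qed

lemma weight_0 [simp]: "weight 0 = 0"
  by (simp add: weight_def)

lemma weight_single [simp]: "weight (Poly_Mapping.single i n) = i ^ 2 * n"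
  by (cases "n = 0") (simp_all add: weight_def)

lemma weight_sum: "weight (sum f A) = (\<Sum>i\<in>A. weight (f i))"
  by (induction A rule: infinite_finite_induct) (simp_all add: weight_add)

definition below :: "nat \<Rightarrow> 'k::field mpol set" where
  "below W = {f. \<forall>m\<in>Poly_Mapping.keys f. weight m < W}"

text \<open>Weights do not order monomials totally; the requirement is that \<open>m\<close> has
  coefficient 1 and every other term is strictly lighter.\<close>

definition has_lead :: "'k::field mpol \<Rightarrow> (nat \<Rightarrow>\<^sub>0 nat) \<Rightarrow> bool" where
  "has_lead f m \<longleftrightarrow> f - Poly_Mapping.single m 1 \<in> below (weight m)"

lemma below_0 [simp]: "0 \<in> below W"
  by (simp add: below_def)

lemma below_add: "f \<in> below W \<Longrightarrow> g \<in> below W \<Longrightarrow> f + g \<in> below W"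
  unfolding below_def using Poly_Mapping.keys_add[of f g] by blast

lemma below_sum: "(\<And>i. i \<in> A \<Longrightarrow> f i \<in> below W) \<Longrightarrow> sum f A \<in> below W"
  by (induction A rule: infinite_finite_induct) (simp_all add: below_add)

lemma below_mono: "V \<le> W \<Longrightarrow> below V \<subseteq> below W"
  unfolding below_def by fastforce

lemma below_mult:
  assumes f: "f \<in> below V" and g: "g \<in> below (Suc W)"
  shows "f * g \<in> below (V + W)"
  unfolding below_def
proof (intro CollectI ballI)
  fix m assume "m \<in> Poly_Mapping.keys (f * g)"
  then obtain a b where ab: "m = a + b" "a \<in> Poly_Mapping.keys f" "b \<in> Poly_Mapping.keys g"
    using keys_mult[of f g] by blast
  then have "weight a < V" "weight b < Suc W" using f g by (auto simp: below_def)
  then show "weight m < V + W" unfolding ab(1) weight_add by linarith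
qed

lemma single_below: "weight m < W \<Longrightarrow> Poly_Mapping.single m a \<in> below W"
  by (simp add: below_def)

lemma has_lead_mult:
  assumes f: "has_lead f m" and g: "has_lead g n"
  shows "has_lead (f * g) (m + n)"
proof -
  let ?s = "\<lambda>m. Poly_Mapping.single m 1 :: 'a mpol"
  have "(g - ?s n) + ?s n \<in> below (Suc (weight n))"
  proof (rule below_add)
    show "g - ?s n \<in> below (Suc (weight n))"
      using g below_mono[of "weight n" "Suc (weight n)"] unfolding has_lead_def by auto
  qed (simp add: single_below)
  then have g': "g \<in> below (Suc (weight n))" by simp
  have "f * g - ?s (m + n) = (f - ?s m) * g + (g - ?s n) * ?s m"
    by (simp add: algebra_simps mult_single)
  also have "\<dots> \<in> below (weight m + weight n)"
  proof (rule below_add)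
    show "(f - ?s m) * g \<in> below (weight m + weight n)"
      using f g' unfolding has_lead_def by (rule below_mult)
    have "(g - ?s n) * ?s m \<in> below (weight n + weight m)"
      using g unfolding has_lead_def by (rule below_mult) (simp add: single_below)
    then show "(g - ?s n) * ?s m \<in> below (weight m + weight n)" by (simp add: add.commute)
  qed
  finally show ?thesis unfolding has_lead_def weight_add .
qed

lemma has_lead_power: "has_lead f m \<Longrightarrow> has_lead (f ^ k) (mono_times k m)"
proof (induction k)
  case 0
  have "mono_times 0 m = 0" by (rule poly_mapping_eqI) simp
  then show ?case by (simp add: has_lead_def)
next
  case (Suc k)
  have "m + mono_times k m = mono_times (Suc k) m"
    by (rule poly_mapping_eqI) (simp add: Poly_Mapping.lookup_add)
  then show ?case using has_lead_mult[OF Suc.prems Suc.IH[OF Suc.prems]] by simp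
qed

text \<open>Sum the parallelogram identity for \<open>A + 2 * i\<close> and
  \<open>A + 2 * \<sigma> i\<close>. Since \<open>\<sigma>\<close> permutes the summands, the two
  sums of the claim differ by the sum of the squares of \<open>i - \<sigma> i\<close>. Integers are
  used for this subtraction.\<close>

lemma sum_rearrangement:
  fixes \<sigma> :: "nat \<Rightarrow> nat"
  assumes \<sigma>: "\<sigma> permutes {0..<s}" "\<sigma> \<noteq> id"
  shows "(\<Sum>i=0..<s. (A + i + \<sigma> i)\<^sup>2) < (\<Sum>i=0..<s. (A + i + i)\<^sup>2)"
proof -
  have re: "(\<Sum>i=0..<s. (int A + 2 * int (\<sigma> i))\<^sup>2) = (\<Sum>i=0..<s. (int A + 2 * int i)\<^sup>2)"
    using sum.permute[OF \<sigma>(1), of "\<lambda>i. (int A + 2 * int i)\<^sup>2"] by (simp add: o_def)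
  have pos: "(\<Sum>i=0..<s. (int i - int (\<sigma> i))\<^sup>2) > 0"
  proof -
    obtain i where i: "\<sigma> i \<noteq> i" using \<sigma>(2) by (auto simp: fun_eq_iff)
    then have "i \<in> {0..<s}" using \<sigma>(1) by (meson permutes_def)
    then show ?thesis using i by (intro sum_pos2[of _ i]) auto
  qed
  have "2 * (int A + int i + int (\<sigma> i))\<^sup>2 + 2 * (int i - int (\<sigma> i))\<^sup>2 =
      (int A + 2 * int i)\<^sup>2 + (int A + 2 * int (\<sigma> i))\<^sup>2" for i
    by (simp add: power2_eq_square algebra_simps)
  then have "(\<Sum>i=0..<s. 2 * (int A + int i + int (\<sigma> i))\<^sup>2 + 2 * (int i - int (\<sigma> i))\<^sup>2) =
      (\<Sum>i=0..<s. (int A + 2 * int i)\<^sup>2 + (int A + 2 * int (\<sigma> i))\<^sup>2)"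
    by (intro sum.cong refl)
  then have "2 * (\<Sum>i=0..<s. (int A + int i + int (\<sigma> i))\<^sup>2) + 2 * (\<Sum>i=0..<s. (int i - int (\<sigma> i))\<^sup>2) =
      2 * (\<Sum>i=0..<s. (int A + 2 * int i)\<^sup>2)"
    unfolding sum.distrib re sum_distrib_left[symmetric] by simp
  then have "(\<Sum>i=0..<s. (int A + int i + int (\<sigma> i))\<^sup>2) < (\<Sum>i=0..<s. (int A + 2 * int i)\<^sup>2)"
    using pos by linarith
  moreover have "(\<Sum>i=0..<s. (int A + 2 * int i)\<^sup>2) = int (\<Sum>i=0..<s. (A + i + i)\<^sup>2)"
    by (simp add: algebra_simps)
  moreover have "(\<Sum>i=0..<s. (int A + int i + int (\<sigma> i))\<^sup>2) = int (\<Sum>i=0..<s. (A + i + \<sigma> i)\<^sup>2)"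
    by simp
  ultimately show ?thesis by (simp only: of_nat_less_iff)
qed

lemma has_lead_hankel_det:
  assumes "m + 2 * s \<le> c + 1"
  shows "has_lead (hdet (hvar c) s (\<lambda>i. m + i) (\<lambda>i. i) :: 'k::field mpol)
    (\<Sum>i=0..<s. Poly_Mapping.single (Suc m + i + i) 1)"
proof -
  let ?M = "\<lambda>\<sigma>. \<Sum>i=0..<s. Poly_Mapping.single (Suc m + i + \<sigma> i) (1 :: nat)"
  let ?P = "{\<sigma>. \<sigma> permutes {0..<s}}"
  have prod: "(\<Prod>i=0..<s. hvar c (m + i + \<sigma> i)) = Poly_Mapping.single (?M \<sigma>) (1 :: 'k)" if \<sigma>: "\<sigma> permutes {0..<s}" for \<sigma>
  proof -
    have "(\<Prod>i=0..<s. hvar c (m + i + \<sigma> i)) = (\<Prod>i=0..<s. Poly_Mapping.single (Poly_Mapping.single (Suc m + i + \<sigma> i) 1) (1 :: 'k))"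
    proof (rule prod.cong[OF refl])
      fix i assume i: "i \<in> {0..<s}"
      then have "\<sigma> i < s" using permutes_in_image[OF \<sigma>, of i] by simp
      then have "m + i + \<sigma> i < c" using i assms by simp
      then show "hvar c (m + i + \<sigma> i) = Poly_Mapping.single (Poly_Mapping.single (Suc m + i + \<sigma> i) 1) (1 :: 'k)"
        by (simp add: hvar_def indet_def)
    qed
    also have "\<dots> = Poly_Mapping.single (?M \<sigma>) (1 :: 'k)"
    proof -
      have "(\<Prod>i\<in>A. Poly_Mapping.single (g i) (1 :: 'k)) = Poly_Mapping.single (sum g A) 1"
        if "finite A" for A and g :: "nat \<Rightarrow> nat \<Rightarrow>\<^sub>0 nat"
        using that by (induction A rule: finite_induct) (simp_all add: mult_single)
      then show ?thesis by simp
    qed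
    finally show ?thesis .
  qed
  have fin: "finite ?P" by (rule finite_permutations) simp
  have id: "id \<in> ?P" by (simp add: permutes_id)
  have "hdet (hvar c) s (\<lambda>i. m + i) (\<lambda>i. i) =
      (\<Sum>\<sigma>\<in>?P. of_int (sign \<sigma>) * Poly_Mapping.single (?M \<sigma>) (1 :: 'k))"
    unfolding fdet_leibniz by (intro sum.cong refl) (simp add: prod)
  also have "\<dots> = Poly_Mapping.single (?M id) 1 + (\<Sum>\<sigma>\<in>?P - {id}. of_int (sign \<sigma>) * Poly_Mapping.single (?M \<sigma>) 1)"
    unfolding sum.remove[OF fin id] by (simp add: sign_id)
  finally have "hdet (hvar c) s (\<lambda>i. m + i) (\<lambda>i. i) - Poly_Mapping.single (?M id) 1 =
      (\<Sum>\<sigma>\<in>?P - {id}. of_int (sign \<sigma>) * Poly_Mapping.single (?M \<sigma>) (1 :: 'k))"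
    by simp
  also have "\<dots> \<in> below (weight (?M id))"
  proof (rule below_sum)
    fix \<sigma> assume \<sigma>: "\<sigma> \<in> ?P - {id}"
    have "weight (?M \<sigma>) < weight (?M id)"
      unfolding weight_sum using sum_rearrangement[of \<sigma> s "Suc m"] \<sigma> by simp
    then have A: "Poly_Mapping.single (?M \<sigma>) (1 :: 'k) \<in> below (weight (?M id))" by (rule single_below)
    have B: "(of_int (sign \<sigma>) :: 'k mpol) \<in> below (Suc 0)"
      by (cases \<sigma> rule: sign_cases) (simp_all add: below_def keys_minus flip: single_one)
    show "of_int (sign \<sigma>) * Poly_Mapping.single (?M \<sigma>) (1 :: 'k) \<in> below (weight (?M id))"
      using below_mult[OF A B] by (simp only: mult.commute add_0_right)
  qed
  finally show ?thesis unfolding has_lead_def by simp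
qed

context frobenius_trace
begin

text \<open>A full monomial has every exponent at least \<open>p - 1\<close>, so it is at least as
  heavy as \<open>M\<close>; all other terms of \<open>f\<close> are lighter and have trace
  0.\<close>

lemma trace_lead:
  assumes f: "has_lead f M" and M: "\<And>i. Poly_Mapping.lookup M i = (if i \<in> {1..c} then p - 1 else 0)"
  shows "trace f = 1"
proof -
  have keysM: "Poly_Mapping.keys M \<subseteq> {1..c}" by (auto simp: in_keys_iff M split: if_splits)
  have "trace (f - Poly_Mapping.single M 1) = 0"
  proof (rule poly_mapping_induct_keys[of "\<lambda>f. trace f = 0"])
    fix m a assume m: "m \<in> Poly_Mapping.keys (f - Poly_Mapping.single M 1)"
    then have less: "weight m < weight M" using f unfolding has_lead_def below_def by blast
    have "\<not> full m"
    proof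
      assume full: "full m"
      have "weight M = (\<Sum>i\<in>{1..c}. i ^ 2 * Poly_Mapping.lookup M i)"
        by (rule weight_superset[OF _ keysM]) simp
      also have "\<dots> \<le> (\<Sum>i\<in>{1..c}. i ^ 2 * Poly_Mapping.lookup m i)"
      proof (rule sum_mono)
        fix i assume i: "i \<in> {1..c}"
        have "p - 1 = Poly_Mapping.lookup m i mod p" using full i by (simp add: full_def)
        also have "\<dots> \<le> Poly_Mapping.lookup m i" by (rule mod_less_eq_dividend)
        finally show "i ^ 2 * Poly_Mapping.lookup M i \<le> i ^ 2 * Poly_Mapping.lookup m i"
          using i by (simp add: M)
      qed
      also have "\<dots> \<le> (\<Sum>i\<in>{1..c} \<union> Poly_Mapping.keys m. i ^ 2 * Poly_Mapping.lookup m i)"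
        by (rule sum_mono2) auto
      also have "\<dots> = weight m" by (rule weight_superset[symmetric]) auto
      finally show False using less by simp
    qed
    then show "trace (Poly_Mapping.single m a) = 0" by (simp add: trace_single trace_term_def)
  qed (simp_all add: trace_add)
  moreover have "trace (Poly_Mapping.single M 1) = 1"
  proof -
    have "full M" using p(2) by (simp add: full_def M)
    moreover have "mono_div p M = 0" using p(2) by (intro poly_mapping_eqI) (simp add: M)
    ultimately show ?thesis by (simp add: trace_single trace_term_def \<theta>_one)
  qed
  moreover have "trace f = trace (f - Poly_Mapping.single M 1) + trace (Poly_Mapping.single M 1)"
    using trace_add[of "f - Poly_Mapping.single M 1" "Poly_Mapping.single M 1"] by simp
  ultimately show ?thesis by simp
qed

end


section \<open>Powers of a finitely generated ideal in terms of monomials\<close>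

context type_subring
begin

text \<open>The \<open>E\<close>-th power of the ideal generated by the first \<open>h\<close>
  values of \<open>g\<close>, presented so that the exponents are at hand for the pigeonhole
  argument.\<close>

inductive_set monomial_span :: "(nat \<Rightarrow> 'a) \<Rightarrow> nat \<Rightarrow> nat \<Rightarrow> 'a set" for g h E where
  zero: "0 \<in> monomial_span g h E"
| add: "x \<in> monomial_span g h E \<Longrightarrow> y \<in> monomial_span g h E \<Longrightarrow> x + y \<in> monomial_span g h E"
| monom: "r \<in> C \<Longrightarrow> (\<Sum>i<h. a i) = E \<Longrightarrow> r * (\<Prod>i<h. g i ^ a i) \<in> monomial_span g h E"

lemma monomial_span_mult:
  assumes "x \<in> monomial_span g h E" and y: "y \<in> monomial_span g h F"
  shows "x * y \<in> monomial_span g h (E + F)"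
  using assms(1)
proof induction
  case zero
  show ?case by (simp add: monomial_span.zero)
next
  case (add x x')
  then show ?case by (simp add: distrib_right monomial_span.add)
next
  case (monom r a)
  note ra = this
  from y show ?case
  proof induction
    case zero
    show ?case by (simp add: monomial_span.zero)
  next
    case (add y y')
    then show ?case by (simp add: distrib_left monomial_span.add)
  next
    case (monom r' a')
    have "(r * r') * (\<Prod>i<h. g i ^ (a i + a' i)) \<in> monomial_span g h (E + F)"
      by (rule monomial_span.monom) (use ra monom in \<open>simp_all add: sum.distrib\<close>)
    then show ?case by (simp add: power_add prod.distrib mult_ac)
  qed
qed

lemma monomial_span_0: "r \<in> C \<Longrightarrow> r \<in> monomial_span g h 0"
  using monomial_span.monom[of r "\<lambda>_. 0" h 0 g] by simp

lemma monomial_span_generator: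
  assumes k: "k < h"
  shows "g k \<in> monomial_span g h 1"
proof -
  have "(\<Prod>i<h. g i ^ of_bool (i = k)) = (\<Prod>i<h. if i = k then g k else 1)"
    by (rule prod.cong) auto
  also have "\<dots> = g k" using k by simp
  finally have "1 * (\<Prod>i<h. g i ^ of_bool (i = k)) = g k" by simp
  moreover have "(\<Sum>i<h. of_bool (i = k)) = (1 :: nat)" using k by (simp add: of_bool_def)
  ultimately show ?thesis
    using monomial_span.monom[of 1 "\<lambda>i. of_bool (i = k)" h 1 g] by simp
qed

lemma ideal_monomial_span:
  assumes g: "\<And>i. i < h \<Longrightarrow> g i \<in> C"
  shows "ideal (monomial_span g h E) R"
  unfolding ideal_iff
proof (intro conjI ballI subsetI)
  show "x \<in> C" if "x \<in> monomial_span g h E" for x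
    using that by induction (auto intro!: mult_closed prod_closed power_closed g)
  show "a * x \<in> monomial_span g h E" if "a \<in> C" "x \<in> monomial_span g h E" for a x
    using monomial_span_mult[OF monomial_span_0[OF that(1)] that(2)] by simp
qed (auto intro: monomial_span.zero monomial_span.add)

lemma prod_power_in_ideal_power:
  fixes e :: "nat \<Rightarrow> nat" and h :: nat
  assumes I: "ideal I R" and g: "\<And>i. i < h \<Longrightarrow> g i \<in> I"
  shows "(\<Prod>i<h. g i ^ e i) \<in> ideal_power I (\<Sum>i<h. e i)"
  using g
proof (induction h)
  case (Suc h)
  have "g h \<in> ideal_power I 1"
    using ideal_power_Suc_mult[of 1 I 0 "g h"] Suc.prems[of h] by simp
  then have "g h ^ e h \<in> ideal_power I (1 * e h)" by (rule power_in_ideal_power[OF I])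
  then have "(\<Prod>i<h. g i ^ e i) * g h ^ e h \<in> ideal_power I ((\<Sum>i<h. e i) + 1 * e h)"
    using Suc by (intro ideal_power_mult[OF I]) auto
  then show ?case by simp
qed simp

end

text \<open>The \<open>h\<close> remainders modulo \<open>p\<close> account for at most
  \<open>h * (p - 1)\<close>, so \<open>p\<close> times the sum of the quotients exceeds
  \<open>n * p\<close>.\<close>

lemma sum_div_pigeonhole:
  fixes a :: "nat \<Rightarrow> nat"
  assumes "p > 0" "(\<Sum>i<h. a i) \<ge> h * (p - 1) + (n * p + 1)"
  shows "(\<Sum>i<h. a i div p) \<ge> n + 1"
proof -
  have "(\<Sum>i<h. a i) = p * (\<Sum>i<h. a i div p) + (\<Sum>i<h. a i mod p)"
    unfolding sum_distrib_left sum.distrib[symmetric] by simp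
  moreover have "(\<Sum>i<h. a i mod p) \<le> (\<Sum>i<h. p - 1)"
  proof (rule sum_mono)
    fix i
    have "a i mod p < p" using assms(1) by simp
    then show "a i mod p \<le> p - 1" by linarith
  qed
  moreover have "(\<Sum>i<h. p - 1) = h * (p - 1)" by simp
  ultimately have "n * p < p * (\<Sum>i<h. a i div p)" using assms(2) by linarith
  then have "p * n < p * (\<Sum>i<h. a i div p)" by (simp only: mult.commute[of n])
  then have "n < (\<Sum>i<h. a i div p)" by (simp only: mult_less_cancel1)
  then show ?thesis by simp
qed

lemma lookup_sum_arith:
  fixes s m x :: nat
  shows
  "Poly_Mapping.lookup (\<Sum>i=0..<s. Poly_Mapping.single (m + i + i) 1) x =
    (of_bool (\<exists>i<s. x = m + i + i) :: nat)"
proof (induction s)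
  case (Suc s)
  have "(\<exists>i<Suc s. x = m + i + i) \<longleftrightarrow> (\<exists>i<s. x = m + i + i) \<or> x = m + s + s"
    using less_Suc_eq by auto
  moreover have "\<not> (\<exists>i<s. x = m + i + i)" if "x = m + s + s" using that by auto
  ultimately show ?case
    using Suc by (auto simp: Poly_Mapping.lookup_add Poly_Mapping.lookup_single)
qed simp

section \<open>The symbolic Frobenius splitting\<close>

locale hankel_frobenius = hankel_setup q c T + frobenius_trace p c \<theta>
  for q c p :: nat and T :: "'k::field itself" and \<theta> :: "'k \<Rightarrow> 'k"
begin

definition f0_lead :: "nat \<Rightarrow>\<^sub>0 nat" where
  "f0_lead = (\<Sum>i=0..<(c + 1) div 2. Poly_Mapping.single (Suc 0 + i + i) 1) +
    (\<Sum>i=0..<c div 2. Poly_Mapping.single (Suc 1 + i + i) 1)"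

lemma lookup_f0_lead: "Poly_Mapping.lookup f0_lead x = of_bool (x \<in> {1..c})"
proof -
  let ?A = "\<exists>i<(c + 1) div 2. x = Suc 0 + i + i" and ?B = "\<exists>i<c div 2. x = Suc 1 + i + i"
  have "?A \<longleftrightarrow> odd x \<and> x \<le> c"
  proof
    assume "odd x \<and> x \<le> c"
    then have "x div 2 < (c + 1) div 2" "x = Suc 0 + x div 2 + x div 2" by presburger+
    then show ?A by blast
  qed presburger
  moreover have "?B \<longleftrightarrow> even x \<and> 1 \<le> x \<and> x \<le> c"
  proof
    assume "even x \<and> 1 \<le> x \<and> x \<le> c"
    then have "x div 2 - 1 < c div 2" "x = Suc 1 + (x div 2 - 1) + (x div 2 - 1)" by presburger+
    then show ?B by blast
  qed presburger
  ultimately show ?thesis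
    unfolding f0_lead_def Poly_Mapping.lookup_add lookup_sum_arith
    by (cases "odd x") (auto simp: odd_pos Suc_le_eq)
qed

lemma trace_f0: "trace (f0 ^ (p - 1)) = 1"
proof (rule trace_lead[of _ "mono_times (p - 1) f0_lead"])
  have "has_lead f0 f0_lead"
    unfolding f0_def f0_lead_def by (intro has_lead_mult has_lead_hankel_det) simp_all
  then show "has_lead (f0 ^ (p - 1)) (mono_times (p - 1) f0_lead)" by (rule has_lead_power)
qed (simp add: lookup_f0_lead)

lemma border_closed: "border k \<in> carr"
  unfolding border_def by (rule mp.fdet_closed) (simp add: hvar_closed)

lemma ideal_span: "ideal (mp.monomial_span c border h E) (mp.R c)"
  by (rule mp.ideal_monomial_span[OF border_closed])

text \<open>Each of the \<open>E\<close> factors from \<open>I\<close> uses up one factor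
  \<open>corner 0\<close>, by \<open>corner_mult_I\<close> with \<open>K\<close> the span in degree
  1.\<close>

lemma corner_power_mult:
  "x \<in> mp.ideal_power c I E \<Longrightarrow> corner 0 ^ E * x \<in> mp.monomial_span c border h E"
proof (induction E arbitrary: x)
  case 0
  then show ?case by (simp add: mp.monomial_span_0)
next
  case (Suc E)
  from Suc.prems show ?case
    unfolding mp.ideal_power_Suc
  proof induction
    case (prod i j)
    have "corner 0 ^ E * i \<in> mp.monomial_span c border h E" by (rule Suc.IH[OF prod(1)])
    moreover have "corner 0 * j \<in> mp.monomial_span c border h 1"
      by (rule corner_mult_I[OF ideal_span mp.monomial_span_generator prod(2)])
    ultimately have "(corner 0 ^ E * i) * (corner 0 * j) \<in> mp.monomial_span c border h (E + 1)"
      by (rule mp.monomial_span_mult)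
    then show ?case by (simp add: mult_ac)
  next
    case (sum x y)
    then show ?case by (simp add: distrib_left mp.monomial_span.add)
  qed
qed

text \<open>Divide every exponent by \<open>p\<close> with remainder. The quotients form a
  \<open>p\<close>-th power, which leaves the trace as a monomial of degree at least
  \<open>n + 1\<close> in elements of \<open>I\<close>.\<close>

lemma trace_monomial_span:
  assumes y: "y \<in> mp.monomial_span c border h E" and E: "E = h * (p - 1) + (n * p + 1)"
  shows "trace y \<in> mp.ideal_power c I (n + 1)"
  using y
proof induction
  case zero
  then show ?case using mp.ideal_ideal_power[OF ideal_I, of "n + 1"] by (simp add: mp.ideal_iff)
next
  case (add x y)
  then show ?case
    using mp.ideal_ideal_power[OF ideal_I, of "n + 1"] by (simp add: mp.ideal_iff trace_add)
next
  case (monom r a)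
  let ?u = "\<Prod>i<h. border i ^ (a i div p)" and ?v = "\<Prod>i<h. border i ^ (a i mod p)"
  have "border i ^ a i = (border i ^ (a i div p)) ^ p * border i ^ (a i mod p)" for i
    by (simp flip: power_mult power_add)
  then have "r * (\<Prod>i<h. border i ^ a i) = ?u ^ p * (r * ?v)"
    by (simp add: prod.distrib prod_power_distrib mult_ac)
  then have "trace (r * (\<Prod>i<h. border i ^ a i)) = ?u * trace (r * ?v)"
    by (simp only: trace_power_mult)
  moreover have "?u \<in> mp.ideal_power c I (\<Sum>i<h. a i div p)"
    by (rule mp.prod_power_in_ideal_power[OF ideal_I border_in_I])
  then have "?u \<in> mp.ideal_power c I (n + 1)"
    using mp.ideal_power_antimono[OF ideal_I sum_div_pigeonhole[OF p(2)], of h n a] monom(2) E by auto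
  moreover have "trace (r * ?v) \<in> carr"
    by (intro trace_closed mp.mult_closed monom(1) mp.prod_closed mp.power_closed border_closed)
  ultimately show ?case using mp.ideal_mult_right[OF mp.ideal_ideal_power[OF ideal_I]] by simp
qed

lemma trace_symbolic_power:
  assumes x: "x \<in> symbolic_power (mp.R c) I (n * p + 1)"
  shows "trace (f0 ^ (p - 1) * x) \<in> symbolic_power (mp.R c) I (n + 1)"
proof -
  note iff = mp.symbolic_power_iff[OF ideal_I primeideal_recurrence_ideal minimal_primes_I]
  have S: "mp.mult_set c (carr - Q)" by (rule mp.mult_set_compl_prime[OF primeideal_recurrence_ideal])
  have S_pow: "s ^ k \<in> carr - Q" if "s \<in> carr - Q" for s k
    using that mp.prime_power[OF primeideal_recurrence_ideal, of s] mp.power_closed[of s] by auto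
  obtain s where s: "s \<in> carr - Q" "s * x \<in> mp.ideal_power c I (n * p + 1)" and xC: "x \<in> carr"
    using x unfolding iff by blast
  define E where "E = h * (p - 1) + (n * p + 1)"
  have "(f0_denom * f0) ^ (p - 1) \<in> mp.ideal_power c I (h * (p - 1))"
    by (rule mp.power_in_ideal_power[OF ideal_I f0_local])
  then have "(f0_denom * f0) ^ (p - 1) * (s * x) \<in> mp.ideal_power c I E"
    unfolding E_def by (rule mp.ideal_power_mult[OF ideal_I _ s(2)])
  then have span: "corner 0 ^ E * ((f0_denom * f0) ^ (p - 1) * (s * x)) \<in> mp.monomial_span c border h E"
    by (rule corner_power_mult)
  \<comment> \<open>All denominators at once: for \<open>x\<close>, for \<open>f0\<close>, and for
    passing from \<open>I\<close> to the bordered minors.\<close>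
  define \<tau> where "\<tau> = corner 0 ^ E * (f0_denom ^ (p - 1) * s)"
  have "corner 0 \<in> carr - Q" by (intro DiffI corner_closed corner_notin_Q) (use qc in simp)
  then have \<tau>: "\<tau> \<in> carr - Q"
    unfolding \<tau>_def by (intro mp.denom(4)[OF S] S_pow f0_denom_in s(1))
  have "corner 0 ^ E * ((f0_denom * f0) ^ (p - 1) * (s * x)) = \<tau> * (f0 ^ (p - 1) * x)"
    by (simp add: \<tau>_def power_mult_distrib mult_ac)
  with span have "\<tau> * (f0 ^ (p - 1) * x) \<in> mp.monomial_span c border h E" by (simp only:)
  \<comment> \<open>The extra factor completes \<open>\<tau>\<close> to a \<open>p\<close>-th power,
    which the trace returns as \<open>\<tau>\<close>, again a denominator outside
    \<open>Q\<close>.\<close>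
  then have "\<tau> ^ (p - 1) * (\<tau> * (f0 ^ (p - 1) * x)) \<in> mp.monomial_span c border h E"
    by (rule mp.ideal_mult_left[OF ideal_span]) (use \<tau> in simp)
  moreover have "\<tau> ^ (p - 1) * \<tau> = \<tau> ^ p" using p(2) by (metis power_minus_mult)
  ultimately have "\<tau> ^ p * (f0 ^ (p - 1) * x) \<in> mp.monomial_span c border h E"
    by (simp only: mult.assoc[symmetric])
  from trace_monomial_span[OF this E_def]
  have "\<tau> * trace (f0 ^ (p - 1) * x) \<in> mp.ideal_power c I (n + 1)"
    by (simp only: trace_power_mult)
  moreover have "trace (f0 ^ (p - 1) * x) \<in> carr"
    by (intro trace_closed mp.mult_closed mp.power_closed f0_closed xC)
  ultimately show ?thesis unfolding iff using \<tau> by blast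
qed

lemma symbolic_F_split_I: "symbolic_F_split p (mp.R c) I"
  unfolding symbolic_F_split_def
proof (intro exI conjI allI ballI)
  let ?\<phi> = "\<lambda>x. trace (f0 ^ (p - 1) * unroot x)"
  show "linear_map (mp.R c) (root_ring p (mp.R c)) (self_module (mp.R c)) ?\<phi>"
    unfolding linear_map_def
  proof (intro conjI ballI Pi_I)
    fix x :: "'k mpol root" assume "x \<in> carrier (root_ring p (mp.R c))"
    then have x: "unroot x \<in> carr" by (auto simp: root_ring_def)
    then show "?\<phi> x \<in> carrier (self_module (mp.R c))"
      by (simp add: self_module_def trace_closed f0_closed)
    show "?\<phi> (x \<oplus>\<^bsub>root_ring p (mp.R c)\<^esub> y) = ?\<phi> x \<oplus>\<^bsub>self_module (mp.R c)\<^esub> ?\<phi> y" for y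
      by (simp add: self_module_def root_ring_def distrib_left trace_add)
    show "?\<phi> (a \<odot>\<^bsub>root_ring p (mp.R c)\<^esub> x) = a \<odot>\<^bsub>self_module (mp.R c)\<^esub> ?\<phi> x" for a
      using trace_power_mult[of a "f0 ^ (p - 1) * unroot x"]
      by (simp add: self_module_def root_ring_def root_incl_def mult.left_commute)
  qed
  show "?\<phi> (root_incl p (mp.R c) r) = r" for r
  proof -
    have "trace (r ^ p * f0 ^ (p - 1)) = r"
      unfolding trace_power_mult trace_f0 by simp
    then show ?thesis by (simp only: root_incl_def root.sel mp.nat_pow_R mult.commute)
  qed
  show "?\<phi> ` Root ` symbolic_power (mp.R c) I (n * p + 1) \<subseteq> symbolic_power (mp.R c) I (n + 1)" for n
    using trace_symbolic_power[of _ n] by auto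
qed

end

theorem theorem6p33:
  fixes j c p t :: nat
  assumes "1 \<le> j" and "j \<le> c"
    and "CHAR('k::field) = p" and "p > 0"
    and "F_finite p (ring_of_type_algebra :: 'k ring)"
    and "1 \<le> t" and "t \<le> min j (c + 1 - j)"
  shows "symbolic_F_split p (mpoly_ring c) (hankel_ideal t j c :: 'k mpol set)
    \<and> F_split p (symbolic_rees (mpoly_ring c) (hankel_ideal t j c :: 'k mpol set))
    \<and> F_split p (symbolic_gr (mpoly_ring c) (hankel_ideal t j c :: 'k mpol set))"
proof -
  obtain q where q: "t = Suc q" using assms(6) by (cases t) auto
  \<comment> \<open>Adding the two bounds on \<open>t\<close> gives
    \<open>2 * (q + 1) \<le> c + 1\<close>.\<close>
  have qc: "2 * q < c" using assms(1,2,7) unfolding q min.bounded_iff by linarith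
  obtain \<theta> :: "'k \<Rightarrow> 'k" where \<theta>: "\<forall>a b. \<theta> (a + b) = \<theta> a + \<theta> b" "\<forall>a b. \<theta> (a ^ p * b) = a * \<theta> b" "\<theta> 1 = 1"
    using field_frobenius_splitting[OF assms(3)[symmetric] assms(4)] by (elim exE conjE)
  interpret hankel_frobenius q c p "TYPE('k)" \<theta>
    by unfold_locales (use qc assms(3,4) \<theta> in auto)
  have I: "(hankel_ideal t j c :: 'k mpol set) = I"
    unfolding q I_def by (rule hankel_ideal_eq) (use assms(1,2,7) q in auto)
  have "prime p" using prime_CHAR[where ?'k = 'k] assms(3,4) by simp
  moreover have "CHAR('k mpol) = p" unfolding CHAR_mpol by (rule assms(3))
  ultimately show ?thesis
    unfolding I mpoly_ring_eq
    using symbolic_F_split_I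
      type_subring.F_split_of_symbolic_F_split[OF mp.type_subring_axioms ideal_I primeideal_recurrence_ideal minimal_primes_I _ _ symbolic_F_split_I]
    by blast
qed

end
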